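(* Let $N\geq1$ and let $(M,g)$ be a connected complete Riemannian $N$-manifold without boundary with $0<\operatorname{inj}(M)\leq\infty$ and, when $N\geq2$, $|\sec(M)|\leq\kappa$ for some $0\leq\kappa<\infty$. Assume one of the following: (i) $p>p_F$ and $1\leq q<N(p-1)/2$; (ii) $p=p_F$ and $q=1$. Then there exists a nonnegative function $u_0\in L^q_{\mathrm{uloc},\rho_\infty}(M)$ such that the problem $u_t-\Delta u=u^p$, $u(\cdot,0)=u_0$ does not admit any solutions in $M\times[0,T)$ for any $T>0$.
   Context: Here $p_F:=(N+2)/N$, $d$ is the Riemannian distance on $M$, $B(x,\rho):=\{y\in M: d(x,y)<\rho\}$ (with $B(x,\infty)=M$), $dV_g$ is the Riemannian volume, $\Delta$ is the Laplace-Beltrami operator, and $C^{2,1}$ denotes functions twice continuously differentiable in space and once in time. Set $$\rho_\infty:=\min\Big\{\tfrac14\operatorname{inj}(M),\ \tfrac{\pi}{4\sqrt\kappa}\Big\}\in(0,\infty],$$ where $\pi/(4\sqrt\kappa)=\infty$ if $\kappa=0$ or $N=1$. Uniformly local Lebesgue space: for $\rho>0$ and $q\geq1$, $L^q_{\mathrm{uloc},\rho}(M)$ is the set of $f\in L^q_{\mathrm{loc}}(M)$ with $\|f\|_{L^q_{\mathrm{uloc},\rho}(M)}:=\sup_{z\in M}\big(\int_{B(z,\rho)}|f|^q\,dV_g\big)^{1/q}<\infty$. Solution: for $T>0$ and a nonnegative function $u_0$, a function $u$ is a solution of the problem with initial data $u_0$ in $M\times[0,T)$ if $u\geq0$, $u\in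 C^{2,1}(M\times(0,T))$, $u_t-\Delta u=u^p$ in $M\times(0,T)$, and $\lim_{t\to0}\int_M\psi\,u(\cdot,t)\,dV_g=\int_M\psi\,u_0\,dV_g$ for every compactly supported continuous function $\psi$ on $M$. *)

theory Defs
  imports "HOL-Analysis.Analysis"
begin

section \<open>Smooth functions on open subsets of Euclidean space\<close>

definition pd :: "'n::finite \<Rightarrow> (real^'n \<Rightarrow> 'b::real_normed_vector) \<Rightarrow> real^'n \<Rightarrow> 'b" where
  "pd i f y = frechet_derivative f (at y) (axis i 1)"

text \<open>Only meant for open \<open>S\<close>, where \<open>at y\<close> and \<open>at y within S\<close> agree.\<close>

primrec Ck_on :: "nat \<Rightarrow> (real^'n::finite \<Rightarrow> 'b::real_normed_vector) \<Rightarrow> (real^'n) set \<Rightarrow> bool" where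
  "Ck_on 0 f S \<longleftrightarrow> continuous_on S f"
| "Ck_on (Suc k) f S \<longleftrightarrow> f differentiable_on S \<and> (\<forall>i. Ck_on k (pd i f) S)"

definition smooth_on :: "(real^'n::finite \<Rightarrow> 'b::real_normed_vector) \<Rightarrow> (real^'n) set \<Rightarrow> bool" where
  "smooth_on f S \<longleftrightarrow> (\<forall>k. Ck_on k f S)"


section \<open>Charts, smooth atlases and Riemannian metrics\<close>

text \<open>
  The manifold is a whole type \<open>'m\<close> (Hausdorff and second countable through its type classes) and
  has dimension \<open>CARD('n)\<close>. A chart is a pair of an open set and a coordinate map, whose values
  outside that open set are irrelevant.
\<close>

type_synonym ('m, 'n) chart = "'m set \<times> ('m \<Rightarrow> real^'n)"

abbreviation chart_dom :: "('m, 'n::finite) chart \<Rightarrow> 'm set" where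
  "chart_dom c \<equiv> fst c"

abbreviation coord :: "('m, 'n::finite) chart \<Rightarrow> 'm \<Rightarrow> real^'n" where
  "coord c \<equiv> snd c"

definition chart_range :: "('m, 'n::finite) chart \<Rightarrow> (real^'n) set" where
  "chart_range c = coord c ` chart_dom c"

definition chart_inv :: "('m, 'n::finite) chart \<Rightarrow> real^'n \<Rightarrow> 'm" where
  "chart_inv c = inv_into (chart_dom c) (coord c)"

definition is_chart :: "('m::topological_space, 'n::finite) chart \<Rightarrow> bool" where
  "is_chart c \<longleftrightarrow> open (chart_dom c) \<and> open (chart_range c) \<and>
     homeomorphism (chart_dom c) (chart_range c) (coord c) (chart_inv c)"

definition transition ::
    "('m, 'n::finite) chart \<Rightarrow> ('m, 'n) chart \<Rightarrow> real^'n \<Rightarrow> real^'n" where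
  "transition c c' = coord c' \<circ> chart_inv c"

definition compatible :: "('m, 'n::finite) chart \<Rightarrow> ('m, 'n) chart \<Rightarrow> bool" where
  "compatible c c' \<longleftrightarrow>
     smooth_on (transition c c') (coord c ` (chart_dom c \<inter> chart_dom c')) \<and>
     smooth_on (transition c' c) (coord c' ` (chart_dom c \<inter> chart_dom c'))"

text \<open>
  \<open>metric_comp M c y $ i $ j\<close> is the component \<open>g(\<partial>\<^sub>i, \<partial>\<^sub>j)\<close> of the metric in the chart \<open>c\<close>, at the
  point with coordinates \<open>y\<close>. Tangent vectors are likewise represented by their components in a
  given chart.
\<close>

record ('m, 'n) riemannian_structure =
  charts :: "('m, 'n::finite) chart set"
  metric_comp :: "('m, 'n) chart \<Rightarrow> real^'n \<Rightarrow> real^'n^'n"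

definition riemannian_manifold ::
    "('m::{t2_space, second_countable_topology}, 'n::finite) riemannian_structure \<Rightarrow> bool" where
  "riemannian_manifold M \<longleftrightarrow>
     (\<forall>c\<in>charts M. is_chart c) \<and>
     (\<forall>c\<in>charts M. \<forall>c'\<in>charts M. compatible c c') \<and>
     (\<Union>c\<in>charts M. chart_dom c) = UNIV \<and>
     (\<forall>c\<in>charts M. smooth_on (metric_comp M c) (chart_range c)) \<and>
     (\<forall>c\<in>charts M. \<forall>y\<in>chart_range c.
        transpose (metric_comp M c y) = metric_comp M c y \<and>
        (\<forall>v. v \<noteq> 0 \<longrightarrow> v \<bullet> (metric_comp M c y *v v) > 0)) \<and>
     (\<forall>c\<in>charts M. \<forall>c'\<in>charts M. \<forall>x\<in>chart_dom c \<inter> chart_dom c'.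
        (let J = jacobian (transition c c') (at (coord c x)) in
          metric_comp M c (coord c x) = transpose J ** metric_comp M c' (coord c' x) ** J))"

definition metric_ip ::
    "('m, 'n::finite) riemannian_structure \<Rightarrow> ('m, 'n) chart \<Rightarrow> real^'n \<Rightarrow> real^'n \<Rightarrow> real^'n \<Rightarrow> real" where
  "metric_ip M c y v w = v \<bullet> (metric_comp M c y *v w)"

definition metric_inv ::
    "('m, 'n::finite) riemannian_structure \<Rightarrow> ('m, 'n) chart \<Rightarrow> real^'n \<Rightarrow> real^'n^'n" where
  "metric_inv M c y = matrix_inv (metric_comp M c y)"

definition vol_density ::
    "('m, 'n::finite) riemannian_structure \<Rightarrow> ('m, 'n) chart \<Rightarrow> real^'n \<Rightarrow> real" where
  "vol_density M c y = sqrt (det (metric_comp M c y))"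


section \<open>Riemannian distance, balls and completeness\<close>

definition C1_curve_on ::
    "('m::topological_space, 'n::finite) riemannian_structure \<Rightarrow> (real \<Rightarrow> 'm) \<Rightarrow> real set \<Rightarrow> bool" where
  "C1_curve_on M \<gamma> I \<longleftrightarrow> continuous_on I \<gamma> \<and>
     (\<forall>c\<in>charts M. \<exists>v.
        (\<forall>t\<in>{t\<in>I. \<gamma> t \<in> chart_dom c}. (coord c \<circ> \<gamma> has_vector_derivative v t) (at t within I)) \<and>
        continuous_on {t\<in>I. \<gamma> t \<in> chart_dom c} v)"

text \<open>Piecewise \<open>C\<^sup>1\<close> on \<open>[0,1]\<close>: \<open>S\<close> contains the break points, and \<open>\<gamma>\<close> is \<open>C\<^sup>1\<close> up to the
  endpoints of every closed interval without a break point in its interior.\<close>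

definition piecewise_C1_curve ::
    "('m::topological_space, 'n::finite) riemannian_structure \<Rightarrow> (real \<Rightarrow> 'm) \<Rightarrow> bool" where
  "piecewise_C1_curve M \<gamma> \<longleftrightarrow> path \<gamma> \<and>
     (\<exists>S. finite S \<and>
       (\<forall>a b. 0 \<le> a \<and> a < b \<and> b \<le> 1 \<and> {a<..<b} \<inter> S = {} \<longrightarrow> C1_curve_on M \<gamma> {a..b}))"

text \<open>The speed does not depend on the chart around \<open>\<gamma> t\<close>.\<close>

definition speed ::
    "('m, 'n::finite) riemannian_structure \<Rightarrow> (real \<Rightarrow> 'm) \<Rightarrow> real \<Rightarrow> real" where
  "speed M \<gamma> t =
     (let c = (SOME c. c \<in> charts M \<and> \<gamma> t \<in> chart_dom c);
          v = vector_derivative (coord c \<circ> \<gamma>) (at t)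
      in sqrt (metric_ip M c (coord c (\<gamma> t)) v v))"

definition curve_length ::
    "('m, 'n::finite) riemannian_structure \<Rightarrow> (real \<Rightarrow> 'm) \<Rightarrow> ennreal" where
  "curve_length M \<gamma> = (\<integral>\<^sup>+t\<in>{0..1}. ennreal (speed M \<gamma> t) \<partial>lborel)"

text \<open>On a connected manifold the infimum is finite.\<close>

definition rdist ::
    "('m::topological_space, 'n::finite) riemannian_structure \<Rightarrow> 'm \<Rightarrow> 'm \<Rightarrow> real" where
  "rdist M x y =
     enn2real (INF \<gamma>\<in>{\<gamma>. piecewise_C1_curve M \<gamma> \<and> pathstart \<gamma> = x \<and> pathfinish \<gamma> = y}.
       curve_length M \<gamma>)"

definition rball ::
    "('m::topological_space, 'n::finite) riemannian_structure \<Rightarrow> 'm \<Rightarrow> ereal \<Rightarrow> 'm set" where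
  "rball M x \<rho> = {y. ereal (rdist M x y) < \<rho>}"

definition complete_riemannian ::
    "('m::topological_space, 'n::finite) riemannian_structure \<Rightarrow> bool" where
  "complete_riemannian M \<longleftrightarrow> Metric_space.mcomplete UNIV (rdist M)"


section \<open>Connection, curvature and injectivity radius\<close>

text \<open>\<open>christoffel M c k i j\<close> is the Levi-Civita symbol with upper index \<open>k\<close> and lower indices
  \<open>i\<close>, \<open>j\<close>.\<close>

definition christoffel ::
    "('m, 'n::finite) riemannian_structure \<Rightarrow> ('m, 'n) chart \<Rightarrow> 'n \<Rightarrow> 'n \<Rightarrow> 'n \<Rightarrow> real^'n \<Rightarrow> real" where
  "christoffel M c k i j y =
     (\<Sum>l\<in>UNIV. metric_inv M c y $ k $ l *
        (pd i (\<lambda>z. metric_comp M c z $ j $ l) y + pd j (\<lambda>z. metric_comp M c z $ i $ l) y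
          - pd l (\<lambda>z. metric_comp M c z $ i $ j) y)) / 2"

text \<open>The \<open>\<partial>\<^sub>l\<close>-component of \<open>R(\<partial>\<^sub>i, \<partial>\<^sub>j)\<partial>\<^sub>k\<close>, where
  \<open>R(X, Y)Z = \<nabla>\<^sub>X \<nabla>\<^sub>Y Z - \<nabla>\<^sub>Y \<nabla>\<^sub>X Z - \<nabla>\<^bsub>[X, Y]\<^esub> Z\<close>.\<close>

definition riemann_curv ::
    "('m, 'n::finite) riemannian_structure \<Rightarrow> ('m, 'n) chart \<Rightarrow>
      'n \<Rightarrow> 'n \<Rightarrow> 'n \<Rightarrow> 'n \<Rightarrow> real^'n \<Rightarrow> real" where
  "riemann_curv M c l i j k y =
     pd i (christoffel M c l j k) y - pd j (christoffel M c l i k) y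
     + (\<Sum>m\<in>UNIV. christoffel M c m j k y * christoffel M c l i m y)
     - (\<Sum>m\<in>UNIV. christoffel M c m i k y * christoffel M c l j m y)"

text \<open>\<open>g(R(X, Y)Y, X) / (|X|\<^sup>2 |Y|\<^sup>2 - g(X, Y)\<^sup>2)\<close>\<close>

definition sectional_curv ::
    "('m, 'n::finite) riemannian_structure \<Rightarrow> ('m, 'n) chart \<Rightarrow> real^'n \<Rightarrow> real^'n \<Rightarrow> real^'n \<Rightarrow> real" where
  "sectional_curv M c y X Y =
     metric_ip M c y
       (\<chi> l. \<Sum>i\<in>UNIV. \<Sum>j\<in>UNIV. \<Sum>k\<in>UNIV. riemann_curv M c l i j k y * X$i * Y$j * Y$k) X
     / (metric_ip M c y X X * metric_ip M c y Y Y - (metric_ip M c y X Y)\<^sup>2)"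

definition sec_bounded ::
    "('m, 'n::finite) riemannian_structure \<Rightarrow> real \<Rightarrow> bool" where
  "sec_bounded M \<kappa> \<longleftrightarrow>
     (\<forall>c\<in>charts M. \<forall>y\<in>chart_range c. \<forall>X Y. X \<noteq> Y \<and> independent {X, Y} \<longrightarrow>
        \<bar>sectional_curv M c y X Y\<bar> \<le> \<kappa>)"

definition geodesic_on ::
    "('m::topological_space, 'n::finite) riemannian_structure \<Rightarrow> (real \<Rightarrow> 'm) \<Rightarrow> real set \<Rightarrow> bool" where
  "geodesic_on M \<gamma> J \<longleftrightarrow> continuous_on J \<gamma> \<and>
     (\<forall>c\<in>charts M. \<exists>v. \<forall>t\<in>J. \<gamma> t \<in> chart_dom c \<longrightarrow>
        (coord c \<circ> \<gamma> has_vector_derivative v t) (at t) \<and>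
        (v has_vector_derivative
           (\<chi> k. - (\<Sum>i\<in>UNIV. \<Sum>j\<in>UNIV.
                      christoffel M c k i j (coord c (\<gamma> t)) * v t $ i * v t $ j))) (at t))"

text \<open>\<open>exp_map M c x v\<close> is \<open>exp\<^sub>x\<close> applied to the tangent vector at \<open>x\<close> with components \<open>v\<close> in the
  chart \<open>c\<close> around \<open>x\<close>. On a complete manifold it is defined for all \<open>v\<close>.\<close>

definition exp_map ::
    "('m::topological_space, 'n::finite) riemannian_structure \<Rightarrow> ('m, 'n) chart \<Rightarrow> 'm \<Rightarrow> real^'n \<Rightarrow> 'm" where
  "exp_map M c x v =
     (THE y. \<exists>\<gamma> J. open J \<and> is_interval J \<and> {0..1} \<subseteq> J \<and> geodesic_on M \<gamma> J \<and> \<gamma> 0 = x \<and>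
        (coord c \<circ> \<gamma> has_vector_derivative v) (at 0) \<and> \<gamma> 1 = y)"

text \<open>\<open>exp\<^sub>x\<close> is a diffeomorphism of the ball \<open>B\<close> of radius \<open>r\<close> in the tangent space onto an open
  subset of \<open>M\<close>: it is injective and its inverse is a chart of the smooth structure.\<close>

definition exp_diffeo_on_ball ::
    "('m::topological_space, 'n::finite) riemannian_structure \<Rightarrow> 'm \<Rightarrow> real \<Rightarrow> bool" where
  "exp_diffeo_on_ball M x r \<longleftrightarrow>
     (\<forall>c\<in>charts M. x \<in> chart_dom c \<longrightarrow>
       (let B = {v. sqrt (metric_ip M c (coord c x) v v) < r};
            E = exp_map M c x;
            normal_chart = (E ` B, inv_into B E)
        in inj_on E B \<and> is_chart normal_chart \<and> (\<forall>c'\<in>charts M. compatible c' normal_chart)))"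

definition inj_radius_at ::
    "('m::topological_space, 'n::finite) riemannian_structure \<Rightarrow> 'm \<Rightarrow> ereal" where
  "inj_radius_at M x = Sup {ereal r | r. 0 < r \<and> exp_diffeo_on_ball M x r}"

definition inj_radius ::
    "('m::topological_space, 'n::finite) riemannian_structure \<Rightarrow> ereal" where
  "inj_radius M = (INF x. inj_radius_at M x)"

definition rho_infty ::
    "('m::topological_space, 'n::finite) riemannian_structure \<Rightarrow> real \<Rightarrow> ereal" where
  "rho_infty M \<kappa> = min (inj_radius M / 4)
     (if \<kappa> = 0 \<or> CARD('n) = 1 then \<infinity> else ereal (pi / (4 * sqrt \<kappa>)))"


section \<open>Riemannian volume and uniformly local Lebesgue spaces\<close>

text \<open>The unique Borel measure with density \<open>sqrt (det g)\<close> in every chart.\<close>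

definition volume ::
    "('m::topological_space, 'n::finite) riemannian_structure \<Rightarrow> 'm measure" where
  "volume M = (THE \<mu>. sets \<mu> = sets borel \<and>
     (\<forall>c\<in>charts M. \<forall>A\<in>sets borel. A \<subseteq> chart_dom c \<longrightarrow>
        emeasure \<mu> A = (\<integral>\<^sup>+y\<in>coord c ` A. ennreal (vol_density M c y) \<partial>lborel)))"

definition ennreal_root :: "real \<Rightarrow> ennreal \<Rightarrow> ennreal" where
  "ennreal_root q a = (if a = \<infinity> then \<infinity> else ennreal (enn2real a powr (1 / q)))"

definition Lq_loc ::
    "('m::topological_space, 'n::finite) riemannian_structure \<Rightarrow> real \<Rightarrow> ('m \<Rightarrow> real) set" where
  "Lq_loc M q = {f \<in> borel_measurable (volume M).
     \<forall>K. compact K \<longrightarrow> (\<integral>\<^sup>+x\<in>K. ennreal (\<bar>f x\<bar> powr q) \<partial>volume M) < \<infinity>}"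

definition uloc_norm ::
    "('m::topological_space, 'n::finite) riemannian_structure \<Rightarrow> real \<Rightarrow> ereal \<Rightarrow> ('m \<Rightarrow> real) \<Rightarrow> ennreal" where
  "uloc_norm M q \<rho> f =
     (SUP z. ennreal_root q (\<integral>\<^sup>+x\<in>rball M z \<rho>. ennreal (\<bar>f x\<bar> powr q) \<partial>volume M))"

definition Lq_uloc ::
    "('m::topological_space, 'n::finite) riemannian_structure \<Rightarrow> real \<Rightarrow> ereal \<Rightarrow> ('m \<Rightarrow> real) set" where
  "Lq_uloc M q \<rho> = {f \<in> Lq_loc M q. uloc_norm M q \<rho> f < \<infinity>}"


section \<open>The semilinear heat equation\<close>

text \<open>The Laplace-Beltrami operator in the chart \<open>c\<close>,
  \<open>\<Delta> f = (det g)\<^sup>-\<^sup>1\<^sup>/\<^sup>2 \<Sum>\<^sub>i \<partial>\<^sub>i ((det g)\<^sup>1\<^sup>/\<^sup>2 \<Sum>\<^sub>j g\<^sup>i\<^sup>j \<partial>\<^sub>j f)\<close>. For \<open>x\<close> in the domain of \<open>c\<close> and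
  \<open>f\<close> of class \<open>C\<^sup>2\<close> near \<open>x\<close>, its value does not depend on \<open>c\<close>.\<close>

definition laplace_beltrami ::
    "('m, 'n::finite) riemannian_structure \<Rightarrow> ('m, 'n) chart \<Rightarrow> ('m \<Rightarrow> real) \<Rightarrow> 'm \<Rightarrow> real" where
  "laplace_beltrami M c f x =
     (\<Sum>i\<in>UNIV. pd i (\<lambda>y. vol_density M c y *
        (\<Sum>j\<in>UNIV. metric_inv M c y $ i $ j * pd j (f \<circ> chart_inv c) y)) (coord c x))
     / vol_density M c (coord c x)"

text \<open>\<open>C\<^sup>2\<^sup>,\<^sup>1(M \<times> (0,T))\<close>: in each chart the function, its spatial partial derivatives up to order two
  and its time derivative exist and are jointly continuous.\<close>

definition C21_on ::
    "('m, 'n::finite) riemannian_structure \<Rightarrow> real \<Rightarrow> ('m \<Rightarrow> real \<Rightarrow> real) \<Rightarrow> bool" where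
  "C21_on M T u \<longleftrightarrow>
     (\<forall>c\<in>charts M. let w = (\<lambda>y t. u (chart_inv c y) t); W = chart_range c; D = W \<times> {0<..<T} in
        (\<forall>t\<in>{0<..<T}. Ck_on 2 (\<lambda>y. w y t) W) \<and>
        (\<forall>y\<in>W. \<forall>t\<in>{0<..<T}. w y differentiable at t) \<and>
        continuous_on D (\<lambda>(y, t). w y t) \<and>
        (\<forall>i. continuous_on D (\<lambda>(y, t). pd i (\<lambda>z. w z t) y)) \<and>
        (\<forall>i j. continuous_on D (\<lambda>(y, t). pd i (pd j (\<lambda>z. w z t)) y)) \<and>
        continuous_on D (\<lambda>(y, t). deriv (w y) t))"

definition is_solution ::
    "('m::topological_space, 'n::finite) riemannian_structure \<Rightarrow> real \<Rightarrow> ('m \<Rightarrow> real) \<Rightarrow> real \<Rightarrow>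
      ('m \<Rightarrow> real \<Rightarrow> real) \<Rightarrow> bool" where
  "is_solution M p u0 T u \<longleftrightarrow>
     (\<forall>x. \<forall>t\<in>{0<..<T}. 0 \<le> u x t) \<and>
     C21_on M T u \<and>
     (\<forall>c\<in>charts M. \<forall>x\<in>chart_dom c. \<forall>t\<in>{0<..<T}.
        deriv (u x) t - laplace_beltrami M c (\<lambda>z. u z t) x = u x t powr p) \<and>
     (\<forall>\<psi>::'m \<Rightarrow> real. continuous_on UNIV \<psi> \<and> compact (closure {x. \<psi> x \<noteq> 0}) \<longrightarrow>
        ((\<lambda>t. \<integral>x. \<psi> x * u x t \<partial>volume M) \<longlongrightarrow> (\<integral>x. \<psi> x * u0 x \<partial>volume M)) (at_right 0))"

definition p_Fujita :: "nat \<Rightarrow> real" where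
  "p_Fujita N = (real N + 2) / real N"

end

theory Submission
  imports Defs
begin

text \<open>
  Everything happens in one coordinate chart. Test the equation with
  \<open>\<phi>\<^sub>R(y, t) = h(|y - y\<^sub>0|\<^sup>2 / R\<^sup>2) h(t / R\<^sup>2)\<close>, where \<open>h\<close> is a plateau function whose first two
  derivatives are \<open>O(h\<^sup>1\<^sup>/\<^sup>p)\<close>. With \<open>I\<^sub>R = \<integral> u\<^sub>0 \<phi>\<^sub>R(\<cdot>, 0)\<close>, Young's inequality absorbs the error
  into \<open>\<integral>\<integral> u\<^sup>p \<phi>\<^sub>R\<close> and gives \<open>I\<^sub>R \<le> C R\<^sup>N\<^sup>-\<^sup>2\<^sup>/\<^sup>(\<^sup>p\<^sup>-\<^sup>1\<^sup>)\<close>. For \<open>p > p\<^sub>F\<close> a datum of size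
  \<open>|y - y\<^sub>0|\<^sup>-\<^sup>a\<close> with \<open>2/(p-1) < a < N/q\<close> violates this as \<open>R \<rightarrow> 0\<close>.

  For \<open>p = p\<^sub>F\<close> the bound is only \<open>I\<^sub>R \<le> C\<close>. The errors of the dyadic test functions
  \<open>\<phi>\<^bsub>R/2^k\<^esub>\<close> live on disjoint parabolic shells, so a sum \<open>\<Sum>\<mu>\<^sub>k \<phi>\<^bsub>R/2^k\<^esub>\<close> with \<open>\<mu>\<^sub>0 = 1\<close> is still absorbed
  by \<open>\<integral>\<integral> u\<^sup>p \<phi>\<^sub>R\<close> alone, whence \<open>\<Sum>\<mu>\<^sub>k I\<^bsub>R/2^k\<^esub> \<le> C \<Sum>\<mu>\<^sub>k\<^sup>p\<^sup>/\<^sup>(\<^sup>p\<^sup>-\<^sup>1\<^sup>)\<close>. Optimising over constant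
  \<open>\<mu>\<close> this bounds \<open>n I\<^bsub>R/2^n\<^esub>\<^sup>p\<close>, and an integrable datum that puts mass \<open>2\<^sup>-\<^sup>i\<close> into the ball of
  radius about \<open>2^(-16^i)\<close> violates it.
\<close>

text \<open>The exponents come from parabolic scaling: the error in the test identity has size R^-2
  and lives on a set of volume about R^(N+2), so Young's inequality turns it into R^(N+2-2p') with
  p' = p/(p-1), and N+2-2p' = N-2/(p-1) is positive exactly when p > p_F. At p = p_F a single scale
  gives no contradiction, and only the number of scales that can be summed is left to exploit. The
  plateau of \<open>h\<close> ends at 1/4 because its argument is quadratic in y: halving R then
  puts the support of the smaller test function inside the plateau of the larger one. Lower-order
  terms of the operator in a chart break exact scaling, but they are O(1/R) and are dominated by
  1/R^2 for R at most 1. Two obstacles shape the rest. The volume of M is a definite description, so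
  a measure with the prescribed chart densities must be shown to exist and to be unique before any
  integral on M can be computed. Near t = 0 a solution is controlled only weakly, so every identity
  starts at a time \<epsilon> > 0 and reaches 0 through the masses alone.\<close>

section \<open>Change of variables for nonnegative functions\<close>

text \<open>
  The library proves the change of variables formula only for index types of class \<open>wellorder\<close>.
  Every finite type has a well-ordered copy, to which the formula is transported.
\<close>

typedef 'a ordered_copy = "UNIV :: 'a set"
  by simp

instance ordered_copy :: (finite) finite
proof
  have "range (Abs_ordered_copy :: 'a \<Rightarrow> _) = UNIV"
    by (metis Rep_ordered_copy_inverse surjI)
  moreover have "finite (range (Abs_ordered_copy :: 'a \<Rightarrow> _))"
    by simp
  ultimately show "finite (UNIV :: 'a ordered_copy set)"
    by metis
qed

definition copy_rank :: "'a::finite ordered_copy \<Rightarrow> nat" where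
  "copy_rank = (SOME f. inj f)"

lemma inj_copy_rank: "inj copy_rank"
proof -
  have "\<exists>f :: 'a ordered_copy \<Rightarrow> nat. inj f"
    using finite_imp_inj_to_nat_seg [of "UNIV :: 'a ordered_copy set"] by auto
  then show ?thesis
    unfolding copy_rank_def by (rule someI_ex)
qed

instantiation ordered_copy :: (finite) linorder
begin

definition "x \<le> y \<longleftrightarrow> copy_rank x \<le> copy_rank y"
definition "x < y \<longleftrightarrow> copy_rank x < copy_rank y"

instance
  by standard (auto simp: less_eq_ordered_copy_def less_ordered_copy_def
      intro: injD [OF inj_copy_rank])

end

instance ordered_copy :: (finite) wellorder
proof
  fix P :: "'a ordered_copy \<Rightarrow> bool" and a
  assume step: "\<And>x. (\<And>y. y < x \<Longrightarrow> P y) \<Longrightarrow> P x"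
  show "P a"
  proof (induction a rule: measure_induct_rule [of copy_rank])
    case (less x)
    then show ?case
      using step less_ordered_copy_def by blast
  qed
qed

lemma bij_Rep_ordered_copy: "bij Rep_ordered_copy"
  by (rule bij_betw_byWitness [where f' = Abs_ordered_copy])
     (auto simp: Rep_ordered_copy_inverse Abs_ordered_copy_inverse)

lemma bij_Abs_ordered_copy: "bij Abs_ordered_copy"
  by (rule bij_betw_byWitness [where f' = Rep_ordered_copy])
     (auto simp: Rep_ordered_copy_inverse Abs_ordered_copy_inverse)

definition to_copy :: "'b^'n::finite \<Rightarrow> 'b^'n ordered_copy" where
  "to_copy x = (\<chi> i. x $ Rep_ordered_copy i)"

definition of_copy :: "'b^'n::finite ordered_copy \<Rightarrow> 'b^'n" where
  "of_copy x = (\<chi> i. x $ Abs_ordered_copy i)"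

lemma of_to_copy [simp]: "of_copy (to_copy x) = x"
  by (simp add: to_copy_def of_copy_def vec_eq_iff Abs_ordered_copy_inverse)

lemma to_of_copy [simp]: "to_copy (of_copy x) = x"
  by (simp add: to_copy_def of_copy_def vec_eq_iff Rep_ordered_copy_inverse)

lemma linear_to_copy: "linear (to_copy :: real^'n::finite \<Rightarrow> _)"
  by (rule linearI) (simp_all add: to_copy_def vec_eq_iff)

lemma linear_of_copy: "linear (of_copy :: real^'n::finite ordered_copy \<Rightarrow> _)"
  by (rule linearI) (simp_all add: of_copy_def vec_eq_iff)

text \<open>Conjugation by a bijection of the index types matches permutations of equal sign, and
  each Leibniz product is only reordered.\<close>

lemma det_of_copy:
  fixes B :: "real^'n::finite ordered_copy^'n ordered_copy"
  shows "det (\<chi> i j. B $ Abs_ordered_copy i $ Abs_ordered_copy j) = det B"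
proof -
  let ?f = "Rep_ordered_copy :: 'n ordered_copy \<Rightarrow> 'n"
  let ?F = "map_permutation UNIV ?f"
  have bf: "bij ?f" by (rule bij_Rep_ordered_copy)
  have bg: "bij (Abs_ordered_copy :: 'n \<Rightarrow> _)"
    by (rule bij_Abs_ordered_copy)
  have "det B = (\<Sum>p | p permutes UNIV. of_int (sign p) * (\<Prod>i\<in>UNIV. B $ i $ p i))"
    by (simp add: det_def)
  also have "\<dots> = (\<Sum>p | p permutes (UNIV::'n set). of_int (sign p) *
       (\<Prod>i\<in>UNIV. B $ Abs_ordered_copy i $ Abs_ordered_copy (p i)))"
  proof (rule sum.reindex_bij_witness [of _ "map_permutation UNIV Abs_ordered_copy" ?F])
    fix p :: "'n ordered_copy \<Rightarrow> 'n ordered_copy" assume p: "p \<in> {p. p permutes UNIV}"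
    show "map_permutation UNIV Abs_ordered_copy (?F p) = p"
      using map_permutation_compose_inv [OF bf, of p Abs_ordered_copy] p
      by (simp add: Rep_ordered_copy_inverse)
    show "?F p \<in> {p. p permutes UNIV}"
      using map_permutation_permutes [OF bf] p by auto
    have s: "sign (?F p) = sign p"
      using p bf by (intro sign_map_permutation) (auto simp: bij_def)
    have e: "?F p (?f i) = ?f (p i)" for i
      using map_permutation_apply [of ?f UNIV i p] bf by (simp add: bij_def)
    have e': "Abs_ordered_copy (?F p i) = p (Abs_ordered_copy i)" for i
      using e [of "Abs_ordered_copy i"] by (simp add: Rep_ordered_copy_inverse Abs_ordered_copy_inverse)
    have "(\<Prod>i\<in>UNIV. B $ Abs_ordered_copy i $ Abs_ordered_copy (?F p i)) = (\<Prod>i\<in>UNIV. B $ i $ p i)"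
      by (rule prod.reindex_bij_witness [of _ ?f Abs_ordered_copy])
         (auto simp: Rep_ordered_copy_inverse Abs_ordered_copy_inverse e')
    then show "of_int (sign (?F p)) * (\<Prod>i\<in>UNIV. B $ Abs_ordered_copy i $ Abs_ordered_copy (?F p i))
        = of_int (sign p) * (\<Prod>i\<in>UNIV. B $ i $ p i)"
      by (simp add: s)
  next
    fix p :: "'n \<Rightarrow> 'n" assume p: "p \<in> {p. p permutes UNIV}"
    show "?F (map_permutation UNIV Abs_ordered_copy p) = p"
      using map_permutation_compose_inv [OF bg, of p ?f] p
      by (simp add: Abs_ordered_copy_inverse)
    show "map_permutation UNIV Abs_ordered_copy p \<in> {p. p permutes UNIV}"
      using map_permutation_permutes [OF bg] p by auto
  qed
  also have "\<dots> = det (\<chi> i j. B $ Abs_ordered_copy i $ Abs_ordered_copy j)"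
    by (simp add: det_def)
  finally show ?thesis by simp
qed

text \<open>Lebesgue measure is determined by its values on boxes. The preimage of a box is a box
  with relabelled edges, so the product of side lengths stays the same.\<close>

lemma lborel_to_copy: "distr lborel borel to_copy = (lborel :: (real^'n::finite ordered_copy) measure)"
proof (rule lborel_eqI [symmetric])
  have m: "to_copy \<in> borel_measurable (borel :: (real^'n) measure)"
    by (intro borel_measurable_continuous_onI linear_continuous_on linear_linear [THEN iffD2] linear_to_copy)
  fix l u :: "real^'n ordered_copy"
  assume le: "\<And>b. b \<in> Basis \<Longrightarrow> l \<bullet> b \<le> u \<bullet> b"
  have le': "l $ i \<le> u $ i" for i
    using le [of "axis i 1"] by (auto simp: Basis_vec_def inner_axis)
  have cart_prod: "prod g (Basis :: (real^'k::finite) set) = (\<Prod>i\<in>UNIV. g (axis i 1))" for g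
    by (rule prod.reindex_bij_witness [of _ "\<lambda>i. axis i 1" "\<lambda>b. THE i. b = axis i 1"])
       (auto simp: Basis_vec_def axis_eq_axis)
  have all_copy: "(\<forall>i. P (Abs_ordered_copy i) (Rep_ordered_copy (Abs_ordered_copy i))) \<longleftrightarrow> (\<forall>i. P i (Rep_ordered_copy i))" for P :: "'n ordered_copy \<Rightarrow> 'n \<Rightarrow> bool"
    using Rep_ordered_copy_inverse by metis
  have "to_copy -` box l u = (box (of_copy l) (of_copy u) :: (real^'n) set)"
    unfolding set_eq_iff vimage_eq mem_box_cart to_copy_def of_copy_def
    using all_copy [of "\<lambda>i j. l $ i < x $ j" for x] all_copy [of "\<lambda>i j. x $ j < u $ i" for x]
    by (simp add: Abs_ordered_copy_inverse all_conj_distrib)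
  then have "emeasure (distr lborel borel to_copy) (box l u) = emeasure lborel (box (of_copy l) (of_copy u))"
    using m by (subst emeasure_distr) auto
  also have "\<dots> = (\<Prod>b\<in>Basis. (of_copy u - of_copy l) \<bullet> b)"
  proof (subst emeasure_lborel_box)
    fix b :: "real^'n" assume "b \<in> Basis"
    then show "of_copy l \<bullet> b \<le> of_copy u \<bullet> b"
      by (auto simp: Basis_vec_def inner_axis of_copy_def le')
  qed simp
  also have "(\<Prod>b\<in>Basis. (of_copy u - of_copy l) \<bullet> b) = (\<Prod>i\<in>UNIV. u $ Abs_ordered_copy i - l $ Abs_ordered_copy i)"
    unfolding cart_prod by (simp add: inner_axis of_copy_def)
  also have "\<dots> = (\<Prod>i\<in>UNIV. u $ i - l $ i)"
    by (rule prod.reindex_bij_witness [of _ Rep_ordered_copy Abs_ordered_copy])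
         (auto simp: Rep_ordered_copy_inverse Abs_ordered_copy_inverse)
  also have "\<dots> = (\<Prod>b\<in>Basis. (u - l) \<bullet> b)"
    unfolding cart_prod by (simp add: inner_axis)
  finally show "emeasure (distr lborel borel to_copy) (box l u) = ennreal (\<Prod>b\<in>Basis. (u - l) \<bullet> b)" .
qed simp

text \<open>Translates a finite nonnegative integral into absolute integrability plus a value, the
  form in which the change of variables formula is available.\<close>

lemma nn_integral_eq_iff_absolutely_integrable:
  fixes h :: "'a::euclidean_space \<Rightarrow> real"
  assumes m: "set_borel_measurable borel A h" and h: "\<And>x. x \<in> A \<Longrightarrow> 0 \<le> h x" and b: "0 \<le> b"
  shows "(\<integral>\<^sup>+x\<in>A. h x \<partial>lborel) = ennreal b \<longleftrightarrow> h absolutely_integrable_on A \<and> integral A h = b"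
proof
  assume *: "(\<integral>\<^sup>+x\<in>A. h x \<partial>lborel) = ennreal b"
  then have eq: "ennreal (integral A h) = ennreal b"
    using set_nn_integral_lborel_eq_integral [OF m h] by simp
  have e: "(\<integral>\<^sup>+x. ennreal (indicator A x * h x) \<partial>lborel) = ennreal b"
    unfolding * [symmetric] by (intro nn_integral_cong) (auto simp: indicator_def)
  have "(\<lambda>x. indicator A x * h x) integrable_on UNIV"
    using m h e by (intro nn_integral_integrable_on) (auto simp: set_borel_measurable_def indicator_def)
  also have "(\<lambda>x. indicator A x * h x) = (\<lambda>x. if x \<in> A then h x else 0)"
    by (auto simp: indicator_def)
  finally have "h integrable_on A"
    using integrable_restrict_UNIV by blast
  then show "h absolutely_integrable_on A \<and> integral A h = b"
    using h b eq by (auto simp: nonnegative_absolutely_integrable_1 integral_nonneg)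
next
  assume "h absolutely_integrable_on A \<and> integral A h = b"
  then have "(h has_integral b) A"
    using set_lebesgue_integral_eq_integral(1) by blast
  then show "(\<integral>\<^sup>+x\<in>A. h x \<partial>lborel) = ennreal b"
    using nn_integral_has_integral_lebesgue' [of A h b] h by auto
qed

text \<open>The vector-valued formula is applied with values in \<open>real^1\<close>. It shows that
  both sides attain the same finite values; if one side is infinite, the other cannot be finite, so
  they agree in every case.\<close>

lemma nn_integral_change_of_variables_wellorder:
  fixes f :: "real^'m::{finite,wellorder} \<Rightarrow> real" and g :: "real^'m::_ \<Rightarrow> real^'m::_"
  assumes S: "S \<in> sets borel"
    and der: "\<And>x. x \<in> S \<Longrightarrow> (g has_derivative g' x) (at x within S)"
    and inj: "inj_on g S"
    and f0: "\<And>x. x \<in> S \<Longrightarrow> 0 \<le> f (g x)"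
    and mf: "set_borel_measurable borel (g ` S) f"
    and mg: "set_borel_measurable borel S (\<lambda>x. \<bar>det (matrix (g' x))\<bar> * f (g x))"
  shows "(\<integral>\<^sup>+y\<in>g ` S. f y \<partial>lborel) = (\<integral>\<^sup>+x\<in>S. \<bar>det (matrix (g' x))\<bar> * f (g x) \<partial>lborel)"
proof -
  let ?D = "\<lambda>x. \<bar>det (matrix (g' x))\<bar> * f (g x)"
  let ?v = "vec :: real \<Rightarrow> real^1"
  have cov: "?D absolutely_integrable_on S \<and> integral S ?D = b \<longleftrightarrow>
     f absolutely_integrable_on (g ` S) \<and> integral (g ` S) f = b" for b
  proof -
    have "(\<lambda>x. \<bar>det (matrix (g' x))\<bar> *\<^sub>R ?v (f (g x))) absolutely_integrable_on S \<and>
         integral S (\<lambda>x. \<bar>det (matrix (g' x))\<bar> *\<^sub>R ?v (f (g x))) = ?v b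
      \<longleftrightarrow> (\<lambda>x. ?v (f x)) absolutely_integrable_on (g ` S) \<and> integral (g ` S) (\<lambda>x. ?v (f x)) = ?v b"
      using S der inj by (intro has_absolute_integral_change_of_variables) auto
    moreover have "(\<lambda>x. \<bar>det (matrix (g' x))\<bar> *\<^sub>R ?v (f (g x))) = (\<lambda>x. ?v (?D x))"
      by (auto simp: fun_eq_iff vec_eq_iff)
    ultimately show ?thesis
      by (auto simp: absolutely_integrable_on_1_iff integral_on_1_eq vec_eq_iff)
  qed
  have key: "(\<integral>\<^sup>+y\<in>g ` S. f y \<partial>lborel) = ennreal b \<longleftrightarrow> (\<integral>\<^sup>+x\<in>S. ?D x \<partial>lborel) = ennreal b"
    if b: "b \<ge> 0" for b
    using nn_integral_eq_iff_absolutely_integrable [OF mf _ b]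
      nn_integral_eq_iff_absolutely_integrable [OF mg _ b] cov [of b] f0 by auto
  show ?thesis
  proof (cases "\<integral>\<^sup>+y\<in>g ` S. f y \<partial>lborel" rule: ennreal_cases)
    case (real r)
    then show ?thesis using key [of r] by simp
  next
    case top
    then show ?thesis
      using key by (cases "\<integral>\<^sup>+x\<in>S. ?D x \<partial>lborel" rule: ennreal_cases) auto
  qed
qed

text \<open>Conjugate \<open>g\<close> with the relabelling isomorphism: neither Lebesgue measure
  nor the Jacobian determinant changes, so the well-ordered version transfers.\<close>

theorem nn_integral_change_of_variables:
  fixes f :: "real^'m::finite \<Rightarrow> real" and g :: "real^'m \<Rightarrow> real^'m"
  assumes S: "S \<in> sets borel"
    and der: "\<And>x. x \<in> S \<Longrightarrow> (g has_derivative g' x) (at x within S)"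
    and inj: "inj_on g S"
    and f0: "\<And>x. x \<in> S \<Longrightarrow> 0 \<le> f (g x)"
    and mf: "set_borel_measurable borel (g ` S) f"
    and mg: "set_borel_measurable borel S (\<lambda>x. \<bar>det (matrix (g' x))\<bar> * f (g x))"
  shows "(\<integral>\<^sup>+y\<in>g ` S. f y \<partial>lborel) = (\<integral>\<^sup>+x\<in>S. \<bar>det (matrix (g' x))\<bar> * f (g x) \<partial>lborel)"
proof -
  let ?to = "to_copy :: real^'m \<Rightarrow> real^'m ordered_copy"
  let ?of = "of_copy :: _ \<Rightarrow> real^'m"
  define G where "G = ?to \<circ> g \<circ> ?of"
  define G' where "G' = (\<lambda>x. ?to \<circ> g' (?of x) \<circ> ?of)"
  have bl: "bounded_linear ?to" "bounded_linear ?of"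
    using linear_to_copy linear_of_copy by (auto simp: linear_linear)
  have m [measurable]: "?to \<in> borel_measurable borel" "?of \<in> borel_measurable borel"
    using bl by (auto intro!: borel_measurable_continuous_onI linear_continuous_on)
  have lin: "linear (g' x)" if "x \<in> S" for x
    using der [OF that] has_derivative_linear by blast
  have det: "det (matrix (G' x)) = det (matrix (g' (?of x)))" if "?of x \<in> S" for x
  proof -
    have "matrix (g' (?of x)) = (\<chi> i j. matrix (G' x) $ Abs_ordered_copy i $ Abs_ordered_copy j)"
    proof -
      have "?of (axis (Abs_ordered_copy j) 1) = axis j 1" for j
        by (auto simp: of_copy_def axis_def vec_eq_iff Abs_ordered_copy_inject)
      then show ?thesis
        by (simp add: matrix_def G'_def to_copy_def Abs_ordered_copy_inverse)
    qed
    then show ?thesis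
      by (simp add: det_of_copy)
  qed
  have im_to: "?to ` A = ?of -` A" for A
    by (auto simp: image_iff) (metis to_of_copy)
  have im: "G ` (?to ` S) = ?to ` (g ` S)"
    by (auto simp: G_def image_iff)
  have S': "?to ` S \<in> sets borel"
    using measurable_sets [OF m(2) S] by (simp add: im_to)
  have transfer: "(\<integral>\<^sup>+y\<in>?to ` A. h y \<partial>lborel) = (\<integral>\<^sup>+x\<in>A. h (?to x) \<partial>lborel)"
    if "set_borel_measurable borel (?to ` A) h" and nn: "\<And>y. y \<in> ?to ` A \<Longrightarrow> 0 \<le> h y" for h :: "_ \<Rightarrow> real" and A
  proof -
    have [measurable]: "(\<lambda>y. indicator (?to ` A) y * h y) \<in> borel_measurable borel"
      using that by (simp add: set_borel_measurable_def)
    have "(\<integral>\<^sup>+y\<in>?to ` A. h y \<partial>lborel) = (\<integral>\<^sup>+y. ennreal (indicator (?to ` A) y * h y) \<partial>distr lborel borel ?to)"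
      unfolding lborel_to_copy by (intro nn_integral_cong) (auto simp: indicator_def)
    also have "\<dots> = (\<integral>\<^sup>+x. ennreal (indicator (?to ` A) (?to x) * h (?to x)) \<partial>lborel)"
      by (rule nn_integral_distr) auto
    also have "\<dots> = (\<integral>\<^sup>+x\<in>A. h (?to x) \<partial>lborel)"
      by (intro nn_integral_cong) (auto simp: indicator_def im_to)
    finally show ?thesis .
  qed
  have mf': "set_borel_measurable borel (?to ` (g ` S)) (f \<circ> ?of)"
    unfolding set_borel_measurable_def
  proof -
    have "(\<lambda>x. indicator (g ` S) (?of x) *\<^sub>R f (?of x)) \<in> borel_measurable borel"
      using measurable_compose [OF m(2) mf [unfolded set_borel_measurable_def]] by simp
    then show "(\<lambda>x. indicator (?to ` (g ` S)) x *\<^sub>R (f \<circ> ?of) x) \<in> borel_measurable borel"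
      by (simp add: im_to indicator_def)
  qed
  have mg': "set_borel_measurable borel (?to ` S) (\<lambda>x. \<bar>det (matrix (G' x))\<bar> * (f \<circ> ?of) (G x))"
    unfolding set_borel_measurable_def
  proof -
    have "(\<lambda>x. indicator S (?of x) *\<^sub>R (\<bar>det (matrix (g' (?of x)))\<bar> * f (g (?of x)))) \<in> borel_measurable borel"
      using measurable_compose [OF m(2) mg [unfolded set_borel_measurable_def]] by simp
    also have "(\<lambda>x. indicator S (?of x) *\<^sub>R (\<bar>det (matrix (g' (?of x)))\<bar> * f (g (?of x))))
       = (\<lambda>x. indicator (?to ` S) x *\<^sub>R (\<bar>det (matrix (G' x))\<bar> * (f \<circ> ?of) (G x)))"
      using det by (auto simp: fun_eq_iff im_to indicator_def G_def)
    finally show "\<dots> \<in> borel_measurable borel" .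
  qed
  have "(\<integral>\<^sup>+y\<in>g ` S. f y \<partial>lborel) = (\<integral>\<^sup>+y\<in>?to ` (g ` S). (f \<circ> ?of) y \<partial>lborel)"
    using f0 by (subst transfer [OF mf']) auto
  also have "\<dots> = (\<integral>\<^sup>+y\<in>G ` (?to ` S). (f \<circ> ?of) y \<partial>lborel)"
    by (simp add: im)
  also have "\<dots> = (\<integral>\<^sup>+x\<in>?to ` S. \<bar>det (matrix (G' x))\<bar> * (f \<circ> ?of) (G x) \<partial>lborel)"
  proof (rule nn_integral_change_of_variables_wellorder [OF S'])
    show "(G has_derivative G' x) (at x within ?to ` S)" if x: "x \<in> ?to ` S" for x
    proof -
      have xS: "?of x \<in> S" using x by auto
      have "(g has_derivative g' (?of x)) (at (?of x) within ?of ` (?to ` S))"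
        using der [OF xS] by (simp add: image_comp comp_def)
      then have "(g \<circ> ?of has_derivative g' (?of x) \<circ> ?of) (at x within ?to ` S)"
        using bounded_linear_imp_has_derivative [OF bl(2)] by (intro diff_chain_within)
      then have "(?to \<circ> (g \<circ> ?of) has_derivative ?to \<circ> (g' (?of x) \<circ> ?of)) (at x within ?to ` S)"
        by (rule diff_chain_within [OF _ bounded_linear_imp_has_derivative [OF bl(1)]])
      then show ?thesis
        by (simp add: G_def G'_def comp_assoc)
    qed
    show "inj_on G (?to ` S)"
      using inj by (auto simp: inj_on_def G_def) (metis of_to_copy)
    show "0 \<le> (f \<circ> ?of) (G x)" if "x \<in> ?to ` S" for x
      using that f0 by (auto simp: G_def)
    show "set_borel_measurable borel (G ` (?to ` S)) (f \<circ> ?of)"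
      using mf' im by simp
  qed (rule mg')
  also have "\<dots> = (\<integral>\<^sup>+x\<in>S. \<bar>det (matrix (G' (?to x)))\<bar> * (f \<circ> ?of) (G (?to x)) \<partial>lborel)"
    using f0 by (intro transfer [OF mg']) (auto simp: G_def)
  also have "\<dots> = (\<integral>\<^sup>+x\<in>S. \<bar>det (matrix (g' x))\<bar> * f (g x) \<partial>lborel)"
    by (intro nn_integral_cong) (auto simp: indicator_def det G_def)
  finally show ?thesis .
qed

section \<open>Functions of class \<open>C\<^sup>1\<close>\<close>

text \<open>On open sets this is \<open>Ck_on 1\<close>. Differentiability is demanded separately
  because \<open>pd\<close> is read off from \<open>frechet_derivative\<close>, which says nothing
  at points where no derivative exists.\<close>

definition C1_on :: "(real^'n::finite \<Rightarrow> 'b::real_normed_vector) \<Rightarrow> (real^'n) set \<Rightarrow> bool" where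
  "C1_on f S \<longleftrightarrow> (\<forall>y\<in>S. f differentiable (at y)) \<and> (\<forall>i. continuous_on S (pd i f))"

lemma pd_eq: "(f has_derivative f') (at y) \<Longrightarrow> pd i f y = f' (axis i 1)"
  unfolding pd_def by (metis frechet_derivative_at)

lemma Ck_on_imp_C1_on: "open S \<Longrightarrow> Ck_on (Suc k) f S \<Longrightarrow> C1_on f S"
proof -
  assume S: "open S" and C: "Ck_on (Suc k) f S"
  have "continuous_on S (pd i f)" for i
    using C differentiable_imp_continuous_on by (cases k) auto
  then show ?thesis
    using C S by (simp add: C1_on_def differentiable_on_eq_differentiable_at)
qed

lemma C1_onD:
  assumes "C1_on f S" "y \<in> S"
  shows "(f has_derivative frechet_derivative f (at y)) (at y)"
  using assms frechet_derivative_works by (auto simp: C1_on_def)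

lemma C1_on_continuous_pd: "C1_on f S \<Longrightarrow> continuous_on S (pd i f)"
  by (simp add: C1_on_def)

lemma C1_on_continuous: "C1_on f S \<Longrightarrow> continuous_on S f"
  by (auto simp: C1_on_def intro!: continuous_at_imp_continuous_on differentiable_imp_continuous_within)

lemma C1_onI:
  assumes "\<And>y. y \<in> S \<Longrightarrow> (f has_derivative f' y) (at y)"
    and "\<And>i. continuous_on S (\<lambda>y. f' y (axis i 1))"
  shows "C1_on f S"
proof -
  have "continuous_on S (pd i f)" for i
    using assms(2) [of i] by (rule continuous_on_eq) (simp add: pd_eq [OF assms(1)])
  then show ?thesis
    using assms(1) by (auto simp: C1_on_def differentiable_def)
qed

lemma pd_cong_open:
  assumes "open S" "y \<in> S" "\<And>z. z \<in> S \<Longrightarrow> f z = g z" "f differentiable (at y)"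
  shows "pd i f y = pd i g y"
proof -
  have f: "(f has_derivative frechet_derivative f (at y)) (at y)"
    using assms frechet_derivative_works by blast
  then have "(g has_derivative frechet_derivative f (at y)) (at y)"
    using assms(1-3) by (rule has_derivative_transform_within_open) auto
  with f show ?thesis
    by (simp add: pd_eq)
qed

lemma C1_on_cong:
  assumes "open S" "\<And>z. z \<in> S \<Longrightarrow> f z = g z" "C1_on f S"
  shows "C1_on g S"
proof (rule C1_onI)
  show "(g has_derivative frechet_derivative f (at y)) (at y)" if "y \<in> S" for y
    by (rule has_derivative_transform_within_open [OF C1_onD [OF assms(3) that] assms(1) that assms(2)])
  show "continuous_on S (\<lambda>y. frechet_derivative f (at y) (axis i 1))" for i
    using C1_on_continuous_pd [OF assms(3), of i] by (simp add: pd_def [abs_def])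
qed

lemma C1_on_const: "C1_on (\<lambda>y. a) S"
  by (rule C1_onI [where f' = "\<lambda>y h. 0"]) auto

lemma pd_add:
  assumes "C1_on f S" "C1_on g S" "y \<in> S"
  shows "pd i (\<lambda>y. f y + g y) y = pd i f y + pd i g y"
  using has_derivative_add [OF C1_onD C1_onD, OF assms(1,3) assms(2,3)]
  by (subst pd_eq) (auto simp: pd_def)

lemma pd_mult:
  fixes f g :: "real^'n::finite \<Rightarrow> real"
  assumes "C1_on f S" "C1_on g S" "y \<in> S"
  shows "pd i (\<lambda>y. f y * g y) y = f y * pd i g y + pd i f y * g y"
  using has_derivative_mult [OF C1_onD C1_onD, OF assms(1,3) assms(2,3)]
  by (subst pd_eq) (auto simp: pd_def)

lemma C1_on_add:
  assumes "C1_on f S" "C1_on g S"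
  shows "C1_on (\<lambda>y. f y + g y) S"
  by (rule C1_onI [OF has_derivative_add [OF C1_onD C1_onD, OF assms(1) _ assms(2)]])
     (auto simp: assms pd_def [symmetric] intro!: continuous_intros C1_on_continuous_pd)

lemma C1_on_mult:
  fixes f g :: "real^'n::finite \<Rightarrow> real"
  assumes "C1_on f S" "C1_on g S"
  shows "C1_on (\<lambda>y. f y * g y) S"
proof (rule C1_onI [OF has_derivative_mult [OF C1_onD C1_onD, OF assms(1) _ assms(2)]])
  have "continuous_on S (\<lambda>y. f y * pd i g y + pd i f y * g y)" for i
    using assms by (intro continuous_on_add continuous_on_mult C1_on_continuous_pd C1_on_continuous)
  then show "continuous_on S (\<lambda>y. f y * frechet_derivative g (at y) (axis i 1) + frechet_derivative f (at y) (axis i 1) * g y)" for i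
    by (simp add: pd_def)
qed

lemma C1_on_sum: "finite I \<Longrightarrow> (\<And>i. i \<in> I \<Longrightarrow> C1_on (f i) S) \<Longrightarrow> C1_on (\<lambda>y. \<Sum>i\<in>I. f i y) S"
  by (induction I rule: finite_induct) (auto intro: C1_on_const C1_on_add)

lemma pd_sum:
  assumes "finite I" "\<And>j. j \<in> I \<Longrightarrow> C1_on (f j) S" "y \<in> S"
  shows "pd i (\<lambda>y. \<Sum>j\<in>I. f j y) y = (\<Sum>j\<in>I. pd i (f j) y)"
  using assms
proof (induction I rule: finite_induct)
  case empty
  then show ?case using pd_eq [of "\<lambda>y. 0" "\<lambda>y. 0" y i] by simp
next
  case (insert j I)
  then have "pd i (\<lambda>y. f j y + (\<Sum>j\<in>I. f j y)) y = pd i (f j) y + pd i (\<lambda>y. \<Sum>j\<in>I. f j y) y"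
    by (intro pd_add C1_on_sum) auto
  then show ?case
    using insert by simp
qed

lemma C1_on_prod:
  fixes f :: "'i \<Rightarrow> real^'n::finite \<Rightarrow> real"
  shows "finite I \<Longrightarrow> (\<And>i. i \<in> I \<Longrightarrow> C1_on (f i) S) \<Longrightarrow> C1_on (\<lambda>y. \<Prod>i\<in>I. f i y) S"
  by (induction I rule: finite_induct) (auto intro: C1_on_const C1_on_mult)

lemma has_derivative_compose_real:
  fixes f :: "real^'n::finite \<Rightarrow> real"
  assumes "(f has_derivative f') (at y)" "(\<phi> has_real_derivative d) (at (f y))"
  shows "((\<lambda>y. \<phi> (f y)) has_derivative (\<lambda>h. d * f' h)) (at y)"
  using diff_chain_at [OF assms(1) assms(2) [unfolded has_field_derivative_def]]
  by (simp add: o_def)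

lemma C1_on_compose_real:
  fixes f :: "real^'n::finite \<Rightarrow> real"
  assumes f: "C1_on f S" and d: "\<And>y. y \<in> S \<Longrightarrow> (\<phi> has_real_derivative \<phi>' (f y)) (at (f y))"
    and c: "continuous_on (f ` S) \<phi>'"
  shows "C1_on (\<lambda>y. \<phi> (f y)) S"
proof (rule C1_onI)
  show "((\<lambda>y. \<phi> (f y)) has_derivative (\<lambda>h. \<phi>' (f y) * frechet_derivative f (at y) h)) (at y)"
    if "y \<in> S" for y
    using has_derivative_compose_real [OF C1_onD [OF f that] d [OF that]] .
  have "continuous_on S (\<lambda>y. \<phi>' (f y) * pd i f y)" for i
    using f c by (intro continuous_intros C1_on_continuous_pd continuous_on_compose2 [OF c] C1_on_continuous) auto
  then show "continuous_on S (\<lambda>y. \<phi>' (f y) * frechet_derivative f (at y) (axis i 1))" for i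
    by (simp add: pd_def)
qed

lemma C1_on_det:
  fixes A :: "real^'n::finite \<Rightarrow> real^'k::finite^'k"
  assumes "\<And>i j. C1_on (\<lambda>y. A y $ i $ j) S"
  shows "C1_on (\<lambda>y. det (A y)) S"
  unfolding det_def
  by (intro C1_on_sum C1_on_mult C1_on_prod C1_on_const assms) auto

lemma C1_on_component:
  fixes A :: "real^'n::finite \<Rightarrow> real^'k::finite^'l::finite"
  assumes "C1_on A S"
  shows "C1_on (\<lambda>y. A y $ i $ j) S"
proof (rule C1_onI)
  have bl: "bounded_linear (\<lambda>B::real^'k^'l. B $ i $ j)"
    by (rule bounded_linear_compose [OF bounded_linear_vec_nth bounded_linear_vec_nth])
  show "((\<lambda>y. A y $ i $ j) has_derivative (\<lambda>h. frechet_derivative A (at y) h $ i $ j)) (at y)" if "y \<in> S" for y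
    using bounded_linear.has_derivative [OF bl C1_onD [OF assms that]] .
  show "continuous_on S (\<lambda>y. frechet_derivative A (at y) (axis k 1) $ i $ j)" for k
    using C1_on_continuous_pd [OF assms, of k] by (auto simp: pd_def [abs_def] intro!: continuous_intros)
qed

text \<open>Column \<open>j\<close> of the inverse solves the linear system with right-hand side
  \<open>axis j 1\<close>, so Cramer's rule applies. The explicit quotient makes the inverse metric
  a C^1 function of the metric.\<close>

lemma matrix_inv_cramer:
  fixes A :: "real^'n::finite^'n"
  assumes "det A \<noteq> 0"
  shows "matrix_inv A $ i $ j = det (\<chi> k l. if l = i then axis j 1 $ k else A $ k $ l) / det A"
proof -
  have "A ** matrix_inv A = mat 1"
    using someI_ex [of "\<lambda>B. A ** B = mat 1 \<and> B ** A = mat 1"] assms invertible_det_nz [of A]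
    by (auto simp: matrix_inv_def invertible_def)
  then have "A *v column j (matrix_inv A) = axis j 1"
    by (metis matrix_vector_mul_assoc matrix_vector_mult_basis matrix_vector_mul_lid)
  then show ?thesis
    unfolding cramer [OF assms] by (simp add: column_def vec_eq_iff)
qed

lemma C1_on_matrix_inv:
  fixes A :: "real^'n::finite \<Rightarrow> real^'k::finite^'k"
  assumes S: "open S" and A: "\<And>i j. C1_on (\<lambda>y. A y $ i $ j) S" and nz: "\<And>y. y \<in> S \<Longrightarrow> det (A y) \<noteq> 0"
  shows "C1_on (\<lambda>y. matrix_inv (A y) $ i $ j) S"
proof (rule C1_on_cong [OF S])
  show "det (\<chi> k l. if l = i then axis j 1 $ k else A y $ k $ l) * inverse (det (A y)) = matrix_inv (A y) $ i $ j"
    if "y \<in> S" for y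
    by (simp add: matrix_inv_cramer nz that divide_inverse)
  show "C1_on (\<lambda>y. det (\<chi> k l. if l = i then axis j 1 $ k else A y $ k $ l) * inverse (det (A y))) S"
  proof (intro C1_on_mult C1_on_det)
    show "C1_on (\<lambda>y. (\<chi> k l. if l = i then axis j 1 $ k else A y $ k $ l) $ m $ l) S" for m l
      by (cases "l = i") (simp_all add: A C1_on_const)
    show "C1_on (\<lambda>y. inverse (det (A y))) S"
    proof (rule C1_on_compose_real [where \<phi> = inverse and \<phi>' = "\<lambda>x. - inverse (x ^ 2)"])
      show "C1_on (\<lambda>y. det (A y)) S" using C1_on_det [OF A] .
      show "(inverse has_real_derivative - inverse ((det (A y))\<^sup>2)) (at (det (A y)))" if "y \<in> S" for y
        using DERIV_inverse [OF nz [OF that]] by (simp add: numeral_2_eq_2)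
      show "continuous_on ((\<lambda>y. det (A y)) ` S) (\<lambda>x. - inverse (x\<^sup>2))"
        by (intro continuous_intros) (auto simp: nz)
    qed
  qed
qed

text \<open>Every matrix on the segment from the identity to \<open>A\<close> is positive definite,
  hence invertible, so by the intermediate value theorem the determinant keeps the sign it has at
  the identity.\<close>

lemma det_pos_of_pos_def:
  fixes A :: "real^'n::finite^'n"
  assumes pos: "\<And>v. v \<noteq> 0 \<Longrightarrow> v \<bullet> (A *v v) > 0"
  shows "det A > 0"
proof (rule ccontr)
  let ?B = "\<lambda>s. (1 - s) *\<^sub>R mat 1 + s *\<^sub>R A"
  assume neg: "\<not> det A > 0"
  have "continuous_on {0..1} (\<lambda>s. det (?B s))"
    unfolding det_def by (intro continuous_intros) 
  then obtain s where s: "0 \<le> s" "s \<le> 1" "det (?B s) = 0"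
    using IVT2' [of "\<lambda>s. det (?B s)" 1 0 0] neg by (auto simp: det_I)
  then have "\<not> invertible (?B s)"
    by (simp add: invertible_det_nz)
  then obtain v where v: "v \<noteq> 0" "?B s *v v = 0"
    by (meson invertible_left_inverse matrix_left_invertible_ker)
  have "v \<bullet> (?B s *v v) = (1 - s) * (v \<bullet> v) + s * (v \<bullet> (A *v v))"
    by (simp add: matrix_vector_mult_add_rdistrib scaleR_matrix_vector_assoc [symmetric] inner_add_right)
  moreover have "\<dots> > 0"
  proof (cases "s = 0")
    case False
    then have "s * (v \<bullet> (A *v v)) > 0" using s pos v by simp
    moreover have "(1 - s) * (v \<bullet> v) \<ge> 0" using s by simp
    ultimately show ?thesis by linarith
  qed (use v in auto)
  ultimately show False
    using v by simp
qed

section \<open>The Riemannian volume\<close>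

locale riemannian =
  fixes M :: "('m::{t2_space, second_countable_topology}, 'n::finite) riemannian_structure"
  assumes riemannian_manifold: "riemannian_manifold M"
begin

section \<open>Regularity of the metric, the volume density and the Laplacian coefficients in a
  chart\<close>

lemma chart_facts:
  assumes "c \<in> charts M"
  shows open_dom: "open (chart_dom c)" and open_range: "open (chart_range c)"
    and homeo: "homeomorphism (chart_dom c) (chart_range c) (coord c) (chart_inv c)"
    and metric_smooth: "smooth_on (metric_comp M c) (chart_range c)"
  using riemannian_manifold assms by (auto simp: riemannian_manifold_def is_chart_def)

lemma chart_cover: "\<exists>c\<in>charts M. x \<in> chart_dom c"
  using riemannian_manifold by (auto simp: riemannian_manifold_def)

lemma coord_chart_inv [simp]: "c \<in> charts M \<Longrightarrow> y \<in> chart_range c \<Longrightarrow> coord c (chart_inv c y) = y"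
  using homeo homeomorphism_apply2 by blast

lemma chart_inv_coord [simp]: "c \<in> charts M \<Longrightarrow> x \<in> chart_dom c \<Longrightarrow> chart_inv c (coord c x) = x"
  using homeo homeomorphism_apply1 by blast

lemma chart_inv_in [simp]: "c \<in> charts M \<Longrightarrow> y \<in> chart_range c \<Longrightarrow> chart_inv c y \<in> chart_dom c"
  using homeo homeomorphism_image2 by blast

lemma coord_in [simp]: "x \<in> chart_dom c \<Longrightarrow> coord c x \<in> chart_range c"
  by (simp add: chart_range_def)

lemma coord_image:
  assumes c: "c \<in> charts M"
  shows "coord c ` (chart_dom c \<inter> A) = chart_range c \<inter> chart_inv c -` A"
proof
  show "chart_range c \<inter> chart_inv c -` A \<subseteq> coord c ` (chart_dom c \<inter> A)"
  proof
    fix y assume "y \<in> chart_range c \<inter> chart_inv c -` A"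
    then show "y \<in> coord c ` (chart_dom c \<inter> A)"
      using c by (intro image_eqI [of _ _ "chart_inv c y"]) simp_all
  qed
qed (use c in auto)

lemma continuous_coord: "c \<in> charts M \<Longrightarrow> continuous_on (chart_dom c) (coord c)"
  using homeo homeomorphism_cont1 by blast

lemma continuous_chart_inv: "c \<in> charts M \<Longrightarrow> continuous_on (chart_range c) (chart_inv c)"
  using homeo homeomorphism_cont2 by blast

lemma metric_C1:
  assumes c: "c \<in> charts M"
  shows "C1_on (\<lambda>y. metric_comp M c y $ i $ j) (chart_range c)"
proof (rule C1_on_component [OF Ck_on_imp_C1_on])
  show "open (chart_range c)" by (rule open_range [OF c])
  show "Ck_on (Suc 0) (metric_comp M c) (chart_range c)"
    using metric_smooth [OF c] unfolding smooth_on_def by blast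
qed

lemma det_metric_pos: "c \<in> charts M \<Longrightarrow> y \<in> chart_range c \<Longrightarrow> det (metric_comp M c y) > 0"
  using riemannian_manifold by (intro det_pos_of_pos_def) (auto simp: riemannian_manifold_def)

lemma vol_density_pos: "c \<in> charts M \<Longrightarrow> y \<in> chart_range c \<Longrightarrow> vol_density M c y > 0"
  by (simp add: vol_density_def det_metric_pos)

lemma vol_density_C1: "c \<in> charts M \<Longrightarrow> C1_on (vol_density M c) (chart_range c)"
  unfolding vol_density_def [abs_def]
proof (rule C1_on_compose_real [where \<phi> = sqrt and \<phi>' = "\<lambda>x. inverse (sqrt x) / 2"])
  assume c: "c \<in> charts M"
  show "C1_on (\<lambda>y. det (metric_comp M c y)) (chart_range c)"
    by (rule C1_on_det [OF metric_C1 [OF c]])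
  show "(sqrt has_real_derivative inverse (sqrt (det (metric_comp M c y))) / 2) (at (det (metric_comp M c y)))"
    if "y \<in> chart_range c" for y
    using DERIV_real_sqrt [OF det_metric_pos [OF c that]] .
  show "continuous_on ((\<lambda>y. det (metric_comp M c y)) ` chart_range c) (\<lambda>x. inverse (sqrt x) / 2)"
    using det_metric_pos [OF c] by (intro continuous_intros) fastforce+
qed

text \<open>These are the coefficients of the Laplace-Beltrami operator in divergence form, once it
  is multiplied by the volume density.\<close>

lemma flux_coefficient_C1:
  assumes c: "c \<in> charts M"
  shows "C1_on (\<lambda>y. vol_density M c y * metric_inv M c y $ i $ j) (chart_range c)"
  unfolding metric_inv_def
  by (intro C1_on_mult vol_density_C1 C1_on_matrix_inv open_range metric_C1 c) (use det_metric_pos [OF c] in force)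

lemma sets_coord_image:
  assumes c: "c \<in> charts M" and A: "A \<in> sets borel" "A \<subseteq> chart_dom c"
  shows "coord c ` A \<in> sets borel"
proof -
  have "chart_inv c \<in> borel_measurable (restrict_space borel (chart_range c))"
    by (rule borel_measurable_continuous_on_restrict [OF continuous_chart_inv [OF c]])
  from measurable_sets [OF this A(1)]
  have "chart_inv c -` A \<inter> chart_range c \<in> sets borel"
    using open_range [OF c] by (auto simp: sets_restrict_space_iff space_restrict_space)
  also have "chart_inv c -` A \<inter> chart_range c = coord c ` A"
    using coord_image [OF c, of A] A(2) by (metis Int_absorb1 Int_commute)
  finally show ?thesis .
qed

section \<open>Existence and uniqueness of the Riemannian volume\<close>

definition chart_vol :: "('m, 'n) chart \<Rightarrow> 'm set \<Rightarrow> ennreal" where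
  "chart_vol c A = (\<integral>\<^sup>+y\<in>coord c ` A. ennreal (vol_density M c y) \<partial>lborel)"

text \<open>The coordinate density pushed forward to M. The inverse chart is made total by
  \<open>undefined\<close> off the chart range; the density vanishes there, so that value carries no
  mass.\<close>

definition chart_measure :: "('m, 'n) chart \<Rightarrow> 'm measure" where
  "chart_measure c = distr (density lborel (\<lambda>y. ennreal (indicator (chart_range c) y * vol_density M c y))) borel
     (\<lambda>y. if y \<in> chart_range c then chart_inv c y else undefined)"

lemma measurable_chart:
  assumes c: "c \<in> charts M"
  shows "(\<lambda>y. if y \<in> chart_range c then chart_inv c y else undefined) \<in> borel_measurable borel"
    and "(\<lambda>y. indicator (chart_range c) y * vol_density M c y) \<in> borel_measurable borel"
proof -
  have m: "chart_range c \<inter> space borel \<in> sets borel"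
    using open_range [OF c] by auto
  show "(\<lambda>y. if y \<in> chart_range c then chart_inv c y else undefined) \<in> borel_measurable borel"
    using borel_measurable_continuous_on_restrict [OF continuous_chart_inv [OF c]]
    by (subst measurable_If_restrict_space_iff) (use m in auto)
  show "(\<lambda>y. indicator (chart_range c) y * vol_density M c y) \<in> borel_measurable borel"
    using borel_measurable_continuous_on_indicator [OF _ C1_on_continuous [OF vol_density_C1 [OF c]]] open_range [OF c]
    by auto
qed

lemma sets_chart_measure [simp]: "sets (chart_measure c) = sets borel"
  by (simp add: chart_measure_def)

lemma emeasure_chart_measure:
  assumes c: "c \<in> charts M" and A: "A \<in> sets borel"
  shows "emeasure (chart_measure c) A = chart_vol c (A \<inter> chart_dom c)"
proof -
  note [measurable] = measurable_chart [OF c] A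
  have "emeasure (chart_measure c) A =
      (\<integral>\<^sup>+y. ennreal (indicator (chart_range c) y * vol_density M c y) *
         indicator ((\<lambda>y. if y \<in> chart_range c then chart_inv c y else undefined) -` A) y \<partial>lborel)"
    unfolding chart_measure_def
    using measurable_sets [OF measurable_chart(1) [OF c] A]
    by (subst emeasure_distr) (auto simp: emeasure_density)
  also have "\<dots> = chart_vol c (A \<inter> chart_dom c)"
    unfolding chart_vol_def
  proof (intro nn_integral_cong)
    fix y
    have "y \<in> coord c ` (A \<inter> chart_dom c) \<longleftrightarrow> y \<in> chart_range c \<and> chart_inv c y \<in> A"
      using coord_image [OF c, of A] by (auto simp: Int_commute)
    then show "ennreal (indicator (chart_range c) y * vol_density M c y) *
         indicator ((\<lambda>y. if y \<in> chart_range c then chart_inv c y else undefined) -` A) y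
       = ennreal (vol_density M c y) * indicator (coord c ` (A \<inter> chart_dom c)) y"
      by (auto simp: indicator_def)
  qed
  finally show ?thesis .
qed

text \<open>Taking determinants in the transformation law of the metric gives sqrt(det g_c) = |det
  J| sqrt(det g_d), which is exactly the factor in the change of variables along the transition
  map.\<close>

lemma chart_vol_compatible:
  assumes c: "c \<in> charts M" and d: "d \<in> charts M" and A: "A \<in> sets borel" "A \<subseteq> chart_dom c" "A \<subseteq> chart_dom d"
  shows "chart_vol c A = chart_vol d A"
proof -
  let ?O = "coord c ` (chart_dom c \<inter> chart_dom d)"
  let ?T = "transition c d"
  let ?J = "\<lambda>y. frechet_derivative ?T (at y)"
  have dom: "open (chart_dom c \<inter> chart_dom d)"
    using open_dom c d by blast
  have "chart_range c \<inter> chart_inv c -` (chart_dom c \<inter> chart_dom d) = ?O"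
    using coord_image [OF c, of "chart_dom d"] chart_inv_in [OF c] by auto
  then have O: "open ?O"
    using continuous_open_preimage [OF continuous_chart_inv [OF c] open_range [OF c] dom] by simp
  have "compatible c d"
    using riemannian_manifold c d by (auto simp: riemannian_manifold_def)
  then have "Ck_on (Suc 0) ?T ?O"
    unfolding compatible_def smooth_on_def by blast
  then have der: "(?T has_derivative ?J y) (at y)" if "y \<in> ?O" for y
    using C1_onD [OF Ck_on_imp_C1_on [OF O]] that by blast
  have T: "?T (coord c x) = coord d x" if "x \<in> chart_dom c" for x
    using that c by (simp add: transition_def)
  have dens: "vol_density M c y = \<bar>det (matrix (?J y))\<bar> * vol_density M d (?T y)" if "y \<in> ?O" for y
  proof -
    obtain x where x: "x \<in> chart_dom c \<inter> chart_dom d" "y = coord c x"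
      using \<open>y \<in> ?O\<close> by blast
    have "metric_comp M c y = transpose (jacobian ?T (at y)) ** metric_comp M d (coord d x) ** jacobian ?T (at y)"
      using riemannian_manifold c d x unfolding riemannian_manifold_def Let_def by blast
    then have "det (metric_comp M c y) = (det (matrix (?J y)))\<^sup>2 * det (metric_comp M d (?T y))"
      using x T by (simp add: jacobian_def det_mul det_transpose power2_eq_square)
    then show ?thesis
      by (simp add: vol_density_def real_sqrt_mult)
  qed
  have sub: "coord c ` A \<subseteq> ?O"
    using A by auto
  have im: "?T ` coord c ` A = coord d ` A"
    unfolding image_image using A T by (intro image_cong) auto
  have smb: "set_borel_measurable borel (coord e ` A) (vol_density M e)" if "e \<in> charts M" "A \<subseteq> chart_dom e" for e
  proof -
    have "continuous_on (coord e ` A) (vol_density M e)"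
      by (rule continuous_on_subset [OF C1_on_continuous [OF vol_density_C1 [OF that(1)]]])
         (use that(2) in \<open>auto simp: chart_range_def\<close>)
    then show ?thesis
      unfolding set_borel_measurable_def
      by (rule borel_measurable_continuous_on_indicator [OF sets_coord_image [OF that(1) A(1) that(2)]])
  qed
  have "chart_vol d A = (\<integral>\<^sup>+y\<in>?T ` coord c ` A. vol_density M d y \<partial>lborel)"
    by (simp add: chart_vol_def im)
  also have "\<dots> = (\<integral>\<^sup>+y\<in>coord c ` A. \<bar>det (matrix (?J y))\<bar> * vol_density M d (?T y) \<partial>lborel)"
  proof (rule nn_integral_change_of_variables)
    show "coord c ` A \<in> sets borel"
      using sets_coord_image [OF c A(1,2)] .
    show "(?T has_derivative ?J y) (at y within coord c ` A)" if "y \<in> coord c ` A" for y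
      by (rule has_derivative_at_withinI [OF der]) (use that sub in blast)
    show "inj_on ?T (coord c ` A)"
    proof (rule inj_onI)
      fix y z assume "y \<in> coord c ` A" "z \<in> coord c ` A" "?T y = ?T z"
      then obtain a b where ab: "a \<in> A" "b \<in> A" "y = coord c a" "z = coord c b" "?T y = ?T z"
        by blast
      then have dom: "a \<in> chart_dom c" "b \<in> chart_dom c" "a \<in> chart_dom d" "b \<in> chart_dom d"
        using A by blast+
      have "coord d a = coord d b"
        using ab(5) unfolding ab(3,4) T [OF dom(1)] T [OF dom(2)] .
      then have "a = b"
        using chart_inv_coord [OF d dom(3)] chart_inv_coord [OF d dom(4)] by argo
      then show "y = z" using ab by simp
    qed
    show "0 \<le> vol_density M d (?T y)" if "y \<in> coord c ` A" for y
    proof -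
      obtain x where "x \<in> A" "y = coord c x"
        using \<open>y \<in> coord c ` A\<close> by blast
      moreover have "x \<in> chart_dom c" "x \<in> chart_dom d"
        using A \<open>x \<in> A\<close> by blast+
      ultimately show ?thesis
        using T vol_density_pos [OF d, of "coord d x"] by simp
    qed
    show "set_borel_measurable borel (?T ` coord c ` A) (vol_density M d)"
      unfolding im using smb d A by blast
    have "(\<lambda>y. indicator (coord c ` A) y *\<^sub>R (\<bar>det (matrix (?J y))\<bar> * vol_density M d (?T y)))
       = (\<lambda>y. indicator (coord c ` A) y *\<^sub>R vol_density M c y)"
      using dens sub by (auto simp: indicator_def fun_eq_iff)
    then show "set_borel_measurable borel (coord c ` A) (\<lambda>y. \<bar>det (matrix (?J y))\<bar> * vol_density M d (?T y))"
      using smb [OF c A(2)] by (simp add: set_borel_measurable_def)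
  qed
  also have "\<dots> = chart_vol c A"
    unfolding chart_vol_def using dens sub by (intro nn_integral_cong) (auto simp: indicator_def)
  finally show ?thesis ..
qed

text \<open>Second countability gives a countable subcover by chart domains (Lindelof), and
  \<open>disjointed\<close> turns it into a Borel partition. On each piece a measure can be handled
  in one chart.\<close>

lemma countable_disjoint_charts:
  "\<exists>(c :: nat \<Rightarrow> ('m, 'n) chart) (D :: nat \<Rightarrow> 'm set).
     (\<forall>k. c k \<in> charts M \<and> D k \<subseteq> chart_dom (c k) \<and> D k \<in> sets borel) \<and>
     disjoint_family D \<and> (\<Union>k. D k) = UNIV"
proof -
  obtain F where F: "F \<subseteq> chart_dom ` charts M" "countable F" "\<Union>F = \<Union>(chart_dom ` charts M)"
    using Lindelof [of "chart_dom ` charts M"] open_dom by blast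
  have UF: "\<Union>F = UNIV"
    using F(3) chart_cover by blast
  then have ne: "F \<noteq> {}"
    by auto
  define U where "U = from_nat_into F"
  have "\<exists>c. c \<in> charts M \<and> chart_dom c = U k" for k
    using from_nat_into [OF ne, of k] F(1) unfolding U_def by blast
  then obtain c where c: "\<And>k. c k \<in> charts M" "\<And>k. chart_dom (c k) = U k"
    by metis
  have Ub: "range U \<subseteq> sets borel"
    using open_dom c by (metis image_subsetI borel_open)
  show ?thesis
  proof (intro exI conjI allI)
    show "c k \<in> charts M" for k by (rule c)
    show "disjointed U k \<subseteq> chart_dom (c k)" for k
      using disjointed_subset [of U k] c by simp
    show "disjointed U k \<in> sets borel" for k
      using sets.range_disjointed_sets [OF Ub] by auto
    show "disjoint_family (disjointed U)"
      by (rule disjoint_family_disjointed)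
    show "(\<Union>k. disjointed U k) = UNIV"
      using UF range_from_nat_into [OF ne F(2)] by (simp add: UN_disjointed_eq U_def)
  qed
qed

lemma emeasure_split_family:
  assumes "sets \<mu> = sets (borel :: 'm measure)" "disjoint_family D" "(\<Union>k::nat. D k) = UNIV" "\<And>k. D k \<in> sets borel" "A \<in> sets borel"
  shows "emeasure \<mu> A = (\<Sum>k. emeasure \<mu> (A \<inter> D k))"
proof -
  have "(\<Sum>k. emeasure \<mu> (A \<inter> D k)) = emeasure \<mu> (\<Union>k. A \<inter> D k)"
    using assms by (intro suminf_emeasure) (auto simp: disjoint_family_on_def)
  also have "(\<Union>k. A \<inter> D k) = A"
    using assms by auto
  finally show ?thesis ..
qed

text \<open>The predicate under the definite description in \<open>volume\<close>, with the chart
  integral folded into \<open>chart_vol\<close>.\<close>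

definition is_volume :: "'m measure \<Rightarrow> bool" where
  "is_volume \<mu> \<longleftrightarrow> sets \<mu> = sets borel \<and>
     (\<forall>c\<in>charts M. \<forall>A\<in>sets borel. A \<subseteq> chart_dom c \<longrightarrow> emeasure \<mu> A = chart_vol c A)"

lemma is_volume_unique:
  assumes "is_volume \<mu>" "is_volume \<nu>"
  shows "\<mu> = \<nu>"
proof (rule measure_eqI)
  show "sets \<mu> = sets \<nu>"
    using assms by (simp add: is_volume_def)
  fix A assume "A \<in> sets \<mu>"
  then have A: "A \<in> sets borel"
    using assms by (simp add: is_volume_def)
  obtain c :: "nat \<Rightarrow> ('m, 'n) chart" and D :: "nat \<Rightarrow> 'm set" where
    "(\<forall>k. c k \<in> charts M \<and> D k \<subseteq> chart_dom (c k) \<and> D k \<in> sets borel) \<and>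
     disjoint_family D \<and> (\<Union>k. D k) = UNIV"
    using countable_disjoint_charts by (elim exE)
  then have cD: "c k \<in> charts M" "D k \<subseteq> chart_dom (c k)" "D k \<in> sets borel"
    "disjoint_family D" "(\<Union>k. D k) = UNIV" for k
    by simp_all
  have eq: "emeasure \<mu> (A \<inter> D k) = emeasure \<nu> (A \<inter> D k)" for k
  proof -
    have "A \<inter> D k \<in> sets borel" "A \<inter> D k \<subseteq> chart_dom (c k)"
      using A cD by auto
    then show ?thesis
      using assms cD(1) [of k] unfolding is_volume_def by metis
  qed
  have "sets \<mu> = sets borel" "sets \<nu> = sets borel"
    using assms by (simp_all add: is_volume_def)
  then show "emeasure \<mu> A = emeasure \<nu> A"
    using emeasure_split_family [OF _ cD(4,5,3) A] eq by simp
qed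

text \<open>The chart measures are glued along a countable Borel partition. That the glued measure
  has the right density in every other chart as well is the content of
  \<open>chart_vol_compatible\<close>.\<close>

lemma is_volume_exists: "\<exists>\<mu>. is_volume \<mu>"
proof -
  obtain c :: "nat \<Rightarrow> ('m, 'n) chart" and D :: "nat \<Rightarrow> 'm set" where
    "(\<forall>k. c k \<in> charts M \<and> D k \<subseteq> chart_dom (c k) \<and> D k \<in> sets borel) \<and>
     disjoint_family D \<and> (\<Union>k. D k) = UNIV"
    using countable_disjoint_charts by (elim exE)
  then have cD: "c k \<in> charts M" "D k \<subseteq> chart_dom (c k)" "D k \<in> sets borel"
    "disjoint_family D" "(\<Union>k. D k) = UNIV" for k
    by simp_all
  define m where "m = (\<lambda>A. \<Sum>k. emeasure (chart_measure (c k)) (A \<inter> D k))"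
  define \<mu> where "\<mu> = measure_of UNIV (sets (borel :: 'm measure)) m"
  have "sigma_algebra UNIV (sets (borel :: 'm measure))"
    using sets.sigma_algebra_axioms [of "borel :: 'm measure"] by simp
  then have s: "sets \<mu> = sets borel"
    unfolding \<mu>_def by (rule sigma_algebra.sets_measure_of_eq)
  have ca: "countably_additive (sets \<mu>) m"
  proof (rule countably_additiveI)
    fix A :: "nat \<Rightarrow> 'm set"
    assume A: "range A \<subseteq> sets \<mu>" "disjoint_family A" "(\<Union>i. A i) \<in> sets \<mu>"
    \<comment> \<open>The two nonnegative series are interchanged by reading the outer one as an
      integral over counting measure.\<close>
    have "(\<Sum>i. m (A i)) = (\<integral>\<^sup>+i. (\<Sum>k. emeasure (chart_measure (c k)) (A i \<inter> D k)) \<partial>count_space UNIV)"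
      by (simp add: m_def nn_integral_count_space_nat)
    also have "\<dots> = (\<Sum>k. \<integral>\<^sup>+i. emeasure (chart_measure (c k)) (A i \<inter> D k) \<partial>count_space UNIV)"
      by (rule nn_integral_suminf) simp
    also have "\<dots> = (\<Sum>k. emeasure (chart_measure (c k)) ((\<Union>i. A i) \<inter> D k))"
    proof (rule arg_cong [where f = suminf], rule ext)
      fix k
      have "(\<Sum>i. emeasure (chart_measure (c k)) (A i \<inter> D k)) = emeasure (chart_measure (c k)) (\<Union>i. A i \<inter> D k)"
        using A cD s by (intro suminf_emeasure) (auto simp: disjoint_family_on_def)
      then show "(\<integral>\<^sup>+i. emeasure (chart_measure (c k)) (A i \<inter> D k) \<partial>count_space UNIV)
         = emeasure (chart_measure (c k)) ((\<Union>i. A i) \<inter> D k)"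
        by (simp add: nn_integral_count_space_nat)
    qed
    finally show "(\<Sum>i. m (A i)) = m (\<Union>i. A i)"
      by (simp add: m_def)
  qed
  have em: "emeasure \<mu> A = m A" if "A \<in> sets borel" for A
  proof (rule emeasure_measure_of [OF \<mu>_def])
    show "positive (sets \<mu>) m"
      by (simp add: positive_def m_def)
  qed (use that ca s in auto)
  have "is_volume \<mu>"
    unfolding is_volume_def
  proof (intro conjI ballI impI s)
    fix d A assume d: "d \<in> charts M" and A: "A \<in> sets (borel :: 'm measure)" "A \<subseteq> chart_dom d"
    have e: "emeasure (chart_measure (c k)) (A \<inter> D k) = emeasure (chart_measure d) (A \<inter> D k)" for k
    proof -
      have AD: "A \<inter> D k \<in> sets borel" "A \<inter> D k \<subseteq> chart_dom d" "A \<inter> D k \<subseteq> chart_dom (c k)"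
        using A cD by auto
      then have "A \<inter> D k \<inter> chart_dom d = A \<inter> D k" "A \<inter> D k \<inter> chart_dom (c k) = A \<inter> D k"
        by auto
      then show ?thesis
        using emeasure_chart_measure [OF cD(1) AD(1)] emeasure_chart_measure [OF d AD(1)]
          chart_vol_compatible [OF cD(1) d AD(1,3,2)] by simp
    qed
    have "emeasure \<mu> A = (\<Sum>k. emeasure (chart_measure d) (A \<inter> D k))"
      by (simp add: em A m_def e)
    also have "\<dots> = emeasure (chart_measure d) A"
      using emeasure_split_family [OF sets_chart_measure cD(4,5,3) A(1)] by simp
    also have "\<dots> = chart_vol d A"
      using emeasure_chart_measure [OF d A(1)] A(2) by (simp add: Int_absorb2)
    finally show "emeasure \<mu> A = chart_vol d A" .
  qed
  then show ?thesis ..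
qed

lemma is_volume_volume: "is_volume (volume M)"
proof -
  have "\<exists>!\<mu>. is_volume \<mu>"
    using is_volume_exists is_volume_unique by blast
  then have "is_volume (THE \<mu>. is_volume \<mu>)"
    by (rule theI')
  then show ?thesis
    by (simp add: volume_def is_volume_def chart_vol_def)
qed

lemma sets_volume [simp, measurable_cong]: "sets (volume M) = sets borel"
  using is_volume_volume by (simp add: is_volume_def)

lemma emeasure_volume:
  "c \<in> charts M \<Longrightarrow> A \<in> sets borel \<Longrightarrow> A \<subseteq> chart_dom c \<Longrightarrow> emeasure (volume M) A = chart_vol c A"
  using is_volume_volume by (simp add: is_volume_def)

lemma chart_measure_eq_density:
  assumes c: "c \<in> charts M"
  shows "chart_measure c = density (volume M) (indicator (chart_dom c))"
proof (rule measure_eqI)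
  fix A assume "A \<in> sets (chart_measure c)"
  then have A: "A \<in> sets borel" by simp
  have d: "chart_dom c \<in> sets borel"
    using open_dom [OF c] by simp
  have "emeasure (density (volume M) (indicator (chart_dom c))) A = emeasure (volume M) (A \<inter> chart_dom c)"
    using A d by (subst emeasure_density) (auto simp: indicator_inter_arith [symmetric] Int_commute)
  then show "emeasure (chart_measure c) A = emeasure (density (volume M) (indicator (chart_dom c))) A"
    using A d emeasure_chart_measure [OF c A] emeasure_volume [OF c, of "A \<inter> chart_dom c"] by simp
qed simp

text \<open>\<open>chart_measure c\<close> is both the restriction of the volume to the chart domain
  and a push-forward from coordinates; for \<open>f\<close> vanishing off the domain the integral
  can be evaluated either way.\<close>

lemma integral_volume_chart:
  fixes f :: "'m \<Rightarrow> real"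
  assumes c: "c \<in> charts M" and f: "f \<in> borel_measurable borel" and out: "\<And>x. x \<notin> chart_dom c \<Longrightarrow> f x = 0"
  shows "(\<integral>x. f x \<partial>volume M) = (\<integral>y. indicator (chart_range c) y * vol_density M c y * f (chart_inv c y) \<partial>lborel)"
    and "integrable (volume M) f \<longleftrightarrow>
      integrable lborel (\<lambda>y. indicator (chart_range c) y * vol_density M c y * f (chart_inv c y))"
proof -
  note [measurable] = measurable_chart [OF c] f
  let ?g = "\<lambda>y. if y \<in> chart_range c then chart_inv c y else undefined"
  have d [measurable]: "chart_dom c \<in> sets borel"
    using open_dom [OF c] by simp
  have eq: "density (volume M) (indicator (chart_dom c)) = density (volume M) (\<lambda>x. ennreal (indicator (chart_dom c) x))"
    by (simp add: ennreal_indicator)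
  have f1: "(\<lambda>x. indicator (chart_dom c) x *\<^sub>R f x) = f"
    using out by (auto simp: indicator_def fun_eq_iff)
  have nn: "0 \<le> indicator (chart_range c) y * vol_density M c y" for y
    using vol_density_pos [OF c] by (auto simp: indicator_def less_imp_le)
  have f2: "(\<lambda>y. (indicator (chart_range c) y * vol_density M c y) *\<^sub>R f (?g y))
     = (\<lambda>y. indicator (chart_range c) y * vol_density M c y * f (chart_inv c y))"
    by (auto simp: indicator_def fun_eq_iff)
  have "(\<integral>x. f x \<partial>volume M) = (\<integral>x. f x \<partial>chart_measure c)"
    unfolding chart_measure_eq_density [OF c] eq by (subst integral_density) (auto simp: f1 [simplified])
  also have "\<dots> = (\<integral>y. indicator (chart_range c) y * vol_density M c y * f (chart_inv c y) \<partial>lborel)"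
    unfolding chart_measure_def
    by (subst integral_distr) (auto simp: integral_density nn f2 [symmetric])
  finally show "(\<integral>x. f x \<partial>volume M) = (\<integral>y. indicator (chart_range c) y * vol_density M c y * f (chart_inv c y) \<partial>lborel)" .
  have "integrable (volume M) f \<longleftrightarrow> integrable (chart_measure c) f"
    unfolding chart_measure_eq_density [OF c] eq by (subst integrable_density) (auto simp: f1 [simplified])
  also have "\<dots> \<longleftrightarrow> integrable lborel (\<lambda>y. indicator (chart_range c) y * vol_density M c y * f (chart_inv c y))"
    unfolding chart_measure_def
    by (subst integrable_distr_eq) (auto simp: integrable_density nn f2 [symmetric])
  finally show "integrable (volume M) f \<longleftrightarrow>
      integrable lborel (\<lambda>y. indicator (chart_range c) y * vol_density M c y * f (chart_inv c y))" .
qed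

end

section \<open>Cutoff functions and integration by parts\<close>

text \<open>Only the kink at 0 needs an argument: there the difference quotient is at most
  |h|^(n-1), which tends to 0.\<close>

lemma DERIV_pos_part_power:
  fixes x :: real
  assumes "n \<ge> 2"
  shows "((\<lambda>x. max 0 x ^ n) has_real_derivative real n * max 0 x ^ (n - 1)) (at x)"
proof -
  consider "x > 0" | "x < 0" | "x = 0" by linarith
  then show ?thesis
  proof cases
    case 1
    have "((\<lambda>x. x ^ n) has_real_derivative real n * max 0 x ^ (n - 1)) (at x)"
      using 1 by (auto intro!: derivative_eq_intros)
    then show ?thesis
      by (rule has_field_derivative_transform_within_open [where S = "{0<..}"]) (use 1 in auto)
  next
    case 2
    have "((\<lambda>x::real. 0) has_real_derivative real n * max 0 x ^ (n - 1)) (at x)"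
      using 2 assms by (auto intro!: derivative_eq_intros)
    then show ?thesis
      by (rule has_field_derivative_transform_within_open [where S = "{..<0}"]) (use 2 assms in auto)
  next
    case 3
    have "((\<lambda>h::real. max 0 h ^ n / h) \<longlongrightarrow> 0) (at 0)"
    proof (rule Lim_null_comparison)
      have le: "\<bar>max 0 h ^ n / h\<bar> \<le> \<bar>h\<bar> ^ (n - 1)" for h :: real
      proof (cases "h > 0")
        case True
        then show ?thesis
          using assms by (simp add: power_diff divide_simps flip: power_Suc)
      next
        case False
        then have "max 0 h = 0" by simp
        then show ?thesis using assms by (simp add: power_0_left)
      qed
      show "\<forall>\<^sub>F h in at (0::real). norm (max 0 h ^ n / h) \<le> \<bar>h\<bar> ^ (n - 1)"
        using le by simp
      have "((\<lambda>h::real. \<bar>h\<bar> ^ (n - 1)) \<longlongrightarrow> \<bar>0\<bar> ^ (n - 1)) (at 0)"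
        by (intro tendsto_intros)
      then show "((\<lambda>h::real. \<bar>h\<bar> ^ (n - 1)) \<longlongrightarrow> 0) (at 0)"
        using assms by (simp add: power_0_left)
    qed
    then show ?thesis
      using assms by (simp add: DERIV_def 3 power_0_left)
  qed
qed

text \<open>The plateau bound 1/4 is the square of 1/2, since \<open>h\<close> is evaluated at |y -
  y0|^2 / R^2 and at t / R^2. The bounds by the power 1/p of \<open>h\<close> are what Young's
  inequality needs in order to absorb the derivatives into u^p times the test function.\<close>

locale cutoff =
  fixes p K :: real and h h1 h2 :: "real \<Rightarrow> real"
  assumes p_gt_1: "p > 1"
    and h_DERIV: "\<And>s. (h has_real_derivative h1 s) (at s)"
    and h1_DERIV: "\<And>s. (h1 has_real_derivative h2 s) (at s)"
    and h2_cont: "continuous_on UNIV h2"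
    and h_nonneg: "\<And>s. 0 \<le> h s" and h_le_1: "\<And>s. h s \<le> 1"
    and h_plateau: "\<And>s. s \<le> 1/4 \<Longrightarrow> h s = 1 \<and> h1 s = 0 \<and> h2 s = 0"
    and h_outside: "\<And>s. s \<ge> 1 \<Longrightarrow> h s = 0 \<and> h1 s = 0 \<and> h2 s = 0"
    and h1_bound: "\<And>s. \<bar>h1 s\<bar> \<le> K * h s powr (1/p)"
    and h2_bound: "\<And>s. \<bar>h2 s\<bar> \<le> K * h s powr (1/p)"
    and K_pos: "K > 0"

text \<open>Two derivatives of a power \<open>k^l\<close> of a plateau function \<open>k\<close> leave a factor \<open>k^(l - 2)\<close>, which is
  at most \<open>(k^l)^(1/p)\<close> once \<open>l\<close> is large.\<close>

lemma cutoff_exists: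
  fixes p :: real
  assumes p: "p > 1"
  shows "\<exists>K h h1 h2. cutoff p K h h1 h2"
proof -
  obtain l0 :: nat where l0: "2 * p / (p - 1) < real l0"
    using reals_Archimedean2 by blast
  \<comment> \<open>\<open>l0\<close> makes l/p at most l - 2, the inequality behind both bounds by
    the power 1/p. The extra 3 keeps l - 1 at least 2, so that \<open>DERIV_pos_part_power\<close>
    applies twice.\<close>
  define l where "l = l0 + 3"
  have l3: "l \<ge> 3" by (simp add: l_def)
  have "2 * p / (p - 1) \<le> real l"
    using l0 by (simp add: l_def)
  then have lp: "real l / p \<le> real (l - 2)"
    using p l3 by (simp add: field_simps of_nat_diff)
  \<comment> \<open>Affine map taking 1/4 to 0 and 1 to 1. The cube of its positive part is C^2 at
    the junction, so \<open>k\<close> falls from 1 to 0 on this interval without losing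
    smoothness.\<close>
  define \<sigma> where "\<sigma> = (\<lambda>s::real. (4 * s - 1) / 3)"
  define k where "k = (\<lambda>s. 1 - max 0 (\<sigma> s) ^ 3)"
  define k1 where "k1 = (\<lambda>s. - 4 * max 0 (\<sigma> s) ^ 2)"
  define k2 where "k2 = (\<lambda>s. - (32 / 3) * max 0 (\<sigma> s))"
  define h where "h = (\<lambda>s. max 0 (k s) ^ l)"
  define h1 where "h1 = (\<lambda>s. real l * max 0 (k s) ^ (l - 1) * k1 s)"
  define h2 where "h2 = (\<lambda>s. real l * (real (l - 1) * max 0 (k s) ^ (l - 2) * k1 s) * k1 s + real l * max 0 (k s) ^ (l - 1) * k2 s)"
  \<comment> \<open>Where \<open>k\<close> is positive, |\<open>k1\<close>| is at most 4 and
    |\<open>k2\<close>| at most 32/3 < 11; the 16 is the square of the first bound.\<close>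
  define K where "K = 16 * real l * real l + 11 * real l"
  have d\<sigma>: "(\<sigma> has_real_derivative 4/3) (at s)" for s
    unfolding \<sigma>_def by (auto intro!: derivative_eq_intros)
  have dk: "(k has_real_derivative k1 s) (at s)" for s
  proof -
    have "((\<lambda>s. max 0 (\<sigma> s) ^ 3) has_real_derivative real 3 * max 0 (\<sigma> s) ^ (3 - 1) * (4/3)) (at s)"
      by (rule DERIV_chain2 [OF DERIV_pos_part_power d\<sigma>]) simp
    then show ?thesis
      using DERIV_diff [OF DERIV_const [of 1]] unfolding k_def k1_def by fastforce
  qed
  have dk1: "(k1 has_real_derivative k2 s) (at s)" for s
  proof -
    have "((\<lambda>s. max 0 (\<sigma> s) ^ 2) has_real_derivative real 2 * max 0 (\<sigma> s) ^ (2 - 1) * (4/3)) (at s)"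
      by (rule DERIV_chain2 [OF DERIV_pos_part_power d\<sigma>]) simp
    then have "((\<lambda>s. - 4 * max 0 (\<sigma> s) ^ 2) has_real_derivative - 4 * (real 2 * max 0 (\<sigma> s) ^ (2 - 1) * (4/3))) (at s)"
      by (rule DERIV_cmult)
    then show ?thesis
      unfolding k1_def k2_def by simp
  qed
  have dh: "(h has_real_derivative h1 s) (at s)" for s
    unfolding h_def h1_def by (rule DERIV_chain2 [OF DERIV_pos_part_power dk]) (use l3 in simp)
  have dh1: "(h1 has_real_derivative h2 s) (at s)" for s
  proof -
    have "((\<lambda>s. max 0 (k s) ^ (l - 1)) has_real_derivative real (l - 1) * max 0 (k s) ^ (l - 1 - 1) * k1 s) (at s)"
      by (rule DERIV_chain2 [OF DERIV_pos_part_power dk]) (use l3 in simp)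
    then have "((\<lambda>s. real l * max 0 (k s) ^ (l - 1)) has_real_derivative real l * (real (l - 1) * max 0 (k s) ^ (l - 1 - 1) * k1 s)) (at s)"
      by (rule DERIV_cmult)
    from DERIV_mult [OF this dk1 [of s]] show ?thesis
      unfolding h1_def h2_def by (simp add: algebra_simps numeral_2_eq_2)
  qed
  have ck: "continuous_on UNIV k" "continuous_on UNIV k1" "continuous_on UNIV k2"
    unfolding k_def k1_def k2_def \<sigma>_def by (intro continuous_intros; simp)+
  have ch2: "continuous_on UNIV h2"
    unfolding h2_def by (intro continuous_intros ck)
  have bnd: "\<bar>h1 s\<bar> \<le> K * h s powr (1/p) \<and> \<bar>h2 s\<bar> \<le> K * h s powr (1/p)" for s
  proof (cases "k s \<le> 0")
    case True
    then show ?thesis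
      using l3 by (simp add: h1_def h2_def h_def max_def power_0_left)
  next
    case False
    define q where "q = max 0 (\<sigma> s)"
    have q0: "q \<ge> 0" by (simp add: q_def)
    have "q ^ 3 < 1 ^ 3" using False by (simp add: k_def q_def)
    then have q1: "q < 1" using power_less_imp_less_base by fastforce
    then have "q\<^sup>2 \<le> 1" using q0 by (simp add: power_le_one)
    then have b1: "\<bar>k1 s\<bar> \<le> 4" by (simp add: k1_def q_def)
    have b2: "\<bar>k2 s\<bar> \<le> 11" using q0 q1 by (simp add: k2_def flip: q_def)
    have k01: "0 < k s" "k s \<le> 1" using False q0 by (auto simp: k_def simp flip: q_def)
    have "k s ^ (l - 2) = k s powr real (l - 2)" using k01 by (simp add: powr_realpow)
    also have "\<dots> \<le> k s powr (real l / p)" using k01 lp by (intro powr_mono') auto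
    also have "\<dots> = h s powr (1/p)"
      using k01 by (simp add: h_def powr_powr flip: powr_realpow)
    finally have e: "k s ^ (l - 2) \<le> h s powr (1/p)" .
    have e1: "k s ^ (l - 1) \<le> k s ^ (l - 2)" using k01 by (intro power_decreasing) auto
    have p0: "0 \<le> k s ^ (l - 1)" using k01 by simp
    have "\<bar>h1 s\<bar> = real l * k s ^ (l - 1) * \<bar>k1 s\<bar>"
      using k01 by (simp add: h1_def abs_mult)
    also have "\<dots> \<le> real l * k s ^ (l - 2) * 4"
      using b1 e1 p0 by (intro mult_mono) auto
    also have "\<dots> = (4 * real l) * k s ^ (l - 2)" by simp
    also have "\<dots> \<le> K * k s ^ (l - 2)"
      using k01 by (intro mult_right_mono) (auto simp: K_def)
    also have "\<dots> \<le> K * h s powr (1/p)"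
      using e by (intro mult_left_mono) (auto simp: K_def)
    finally have r1: "\<bar>h1 s\<bar> \<le> K * h s powr (1/p)" .
    have "\<bar>h2 s\<bar> \<le> real l * (real (l - 1) * k s ^ (l - 2) * \<bar>k1 s\<bar>) * \<bar>k1 s\<bar> + real l * k s ^ (l - 1) * \<bar>k2 s\<bar>"
      unfolding h2_def using k01 by (intro abs_triangle_ineq [THEN order_trans]) (simp add: abs_mult)
    also have "\<dots> \<le> real l * (real l * k s ^ (l - 2) * 4) * 4 + real l * k s ^ (l - 2) * 11"
      using b1 b2 e1 p0 k01 by (intro add_mono mult_mono) auto
    also have "\<dots> = K * k s ^ (l - 2)" by (simp add: K_def algebra_simps)
    also have "\<dots> \<le> K * h s powr (1/p)"
      using e by (intro mult_left_mono) (auto simp: K_def)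
    finally show ?thesis using r1 by simp
  qed
  have "cutoff p K h h1 h2"
  proof
    show "h s \<ge> 0" for s by (simp add: h_def)
    show "h s \<le> 1" for s
      by (simp add: h_def k_def power_le_one)
    show "h s = 1 \<and> h1 s = 0 \<and> h2 s = 0" if "s \<le> 1/4" for s
    proof -
      have "max 0 (\<sigma> s) = 0" using that by (simp add: \<sigma>_def)
      then show ?thesis by (simp add: h_def h1_def h2_def k_def k1_def k2_def)
    qed
    show "h s = 0 \<and> h1 s = 0 \<and> h2 s = 0" if "s \<ge> 1" for s
    proof -
      have "max 0 (\<sigma> s) \<ge> 1" using that by (simp add: \<sigma>_def)
      then have "max 0 (\<sigma> s) ^ 3 \<ge> 1" by (rule one_le_power)
      then have "max 0 (k s) = 0" by (simp add: k_def)
      then show ?thesis using l3 by (simp add: h_def h1_def h2_def power_0_left)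
    qed
    show "K > 0" using l3 by (simp add: K_def add_pos_pos)
  qed (use p dh dh1 ch2 bnd in auto)
  then show ?thesis by blast
qed

text \<open>By translation invariance every difference quotient of \<open>G\<close> in direction
  \<open>i\<close> has integral 0. The mean value theorem bounds the quotients uniformly, so
  dominated convergence passes this to the derivative.\<close>

lemma integral_pd_eq_0:
  fixes G :: "real^'n::finite \<Rightarrow> real"
  assumes G: "C1_on G UNIV" and K: "compact K" "\<And>y. y \<notin> K \<Longrightarrow> G y = 0"
  shows "integral\<^sup>L lborel (pd i G) = 0"
proof -
  let ?e = "axis i 1 :: real^'n"
  obtain r where r: "K \<subseteq> cball 0 r"
    using bounded_subset_ballD [OF compact_imp_bounded [OF K(1)], of 0] ball_subset_cball by blast
  \<comment> \<open>The shifts have length 1/(n+1), at most 1, so this ball contains the support of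
    all difference quotients.\<close>
  let ?B = "cball 0 (r + 1) :: (real^'n) set"
  have cont: "continuous_on UNIV G" "continuous_on UNIV (pd i G)"
    using G C1_on_continuous C1_on_continuous_pd by blast+
  have "bounded (pd i G ` ?B)"
    using cont(2) by (intro compact_imp_bounded compact_continuous_image) (auto intro: continuous_on_subset)
  then obtain L where L: "\<And>y. y \<in> ?B \<Longrightarrow> \<bar>pd i G y\<bar> \<le> L"
    unfolding bounded_iff by (metis imageI real_norm_def)
  have out: "pd i G y = 0" if "y \<notin> K" for y
  proof -
    have "pd i G y = pd i (\<lambda>z. 0) y"
      using K that G by (intro pd_cong_open [of "- K"]) (auto simp: compact_imp_closed C1_on_def open_Compl)
    then show ?thesis
      using pd_eq [of "\<lambda>z. 0" "\<lambda>z. 0" y i] by simp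
  qed
  have bound: "\<bar>pd i G y\<bar> \<le> max L 0" for y
  proof (cases "y \<in> K")
    case True
    then have "y \<in> ?B"
      using r by fastforce
    then show ?thesis
      using L [of y] by simp
  qed (use out in simp)
  have line: "((\<lambda>t. G (y + t *\<^sub>R ?e)) has_real_derivative pd i G (y + t *\<^sub>R ?e)) (at t)" for y t
  proof -
    have "((\<lambda>t. y + t *\<^sub>R ?e) has_derivative (\<lambda>h. h *\<^sub>R ?e)) (at t)"
      by (auto intro!: derivative_eq_intros)
    from diff_chain_at [OF this C1_onD [OF G]]
    have d: "((\<lambda>t. G (y + t *\<^sub>R ?e)) has_derivative (\<lambda>h. frechet_derivative G (at (y + t *\<^sub>R ?e)) (h *\<^sub>R ?e))) (at t)"
      by (simp add: o_def)
    have "linear (frechet_derivative G (at (y + t *\<^sub>R ?e)))"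
      using C1_onD [OF G] has_derivative_linear by blast
    then have "(\<lambda>h. frechet_derivative G (at (y + t *\<^sub>R ?e)) (h *\<^sub>R ?e)) = (*) (pd i G (y + t *\<^sub>R ?e))"
      by (auto simp: pd_def linear_cmul)
    with d show ?thesis
      by (simp add: has_field_derivative_def)
  qed
  define q where "q = (\<lambda>(n::nat) y. (G (y + (1 / real (Suc n)) *\<^sub>R ?e) - G y) * real (Suc n))"
  have m [measurable]: "G \<in> borel_measurable borel" "pd i G \<in> borel_measurable borel"
    using cont by (auto intro: borel_measurable_continuous_onI)
  have qb: "\<bar>q n y\<bar> \<le> max L 0 * indicator ?B y" for n y
  proof -
    define s where "s = 1 / real (Suc n)"
    have s: "0 < s" "s \<le> 1" by (auto simp: s_def)
    obtain z where "z > 0" "z < s" "G (y + s *\<^sub>R ?e) - G (y + 0 *\<^sub>R ?e) = (s - 0) * pd i G (y + z *\<^sub>R ?e)"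
      using MVT2 [OF s(1), of "\<lambda>t. G (y + t *\<^sub>R ?e)" "\<lambda>t. pd i G (y + t *\<^sub>R ?e)"] line by blast
    then have "q n y = pd i G (y + z *\<^sub>R ?e)"
      by (simp add: q_def s_def)
    moreover have "q n y = 0" if "y \<notin> ?B"
    proof -
      have "norm (y + s *\<^sub>R ?e) \<ge> norm y - norm (s *\<^sub>R ?e)"
        by (metis norm_diff_ineq)
      then have "y + s *\<^sub>R ?e \<notin> K" "y \<notin> K"
        using that r s by (auto simp: subset_iff dist_norm) 
      then show ?thesis by (simp add: q_def s_def K)
    qed
    ultimately show ?thesis
      using bound by (cases "y \<in> ?B") auto
  qed
  have lim: "(\<lambda>n. q n y) \<longlonglongrightarrow> pd i G y" for y
  proof -
    have "((\<lambda>h. (G (y + h *\<^sub>R ?e) - G y) / h) \<longlongrightarrow> pd i G y) (at 0)"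
      using line [of y 0] by (simp add: DERIV_def)
    moreover have "filterlim (\<lambda>n. 1 / real (Suc n)) (at 0) sequentially"
      using LIMSEQ_Suc [OF lim_1_over_n] by (auto simp: filterlim_at)
    ultimately have "(\<lambda>n. (G (y + (1 / real (Suc n)) *\<^sub>R ?e) - G y) / (1 / real (Suc n))) \<longlonglongrightarrow> pd i G y"
      by (rule filterlim_compose)
    then show ?thesis
      by (simp add: q_def)
  qed
  have "(\<lambda>n. integral\<^sup>L lborel (q n)) \<longlonglongrightarrow> integral\<^sup>L lborel (pd i G)"
  proof (rule integral_dominated_convergence [where w = "\<lambda>y. max L 0 * indicator ?B y"])
    show "q n \<in> borel_measurable lborel" for n
      unfolding q_def by measurable
    show "integrable lborel (\<lambda>y. max L 0 * indicator ?B y)"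
      by (intro integrable_mult_right) (auto intro!: integrable_real_indicator emeasure_lborel_cball_finite)
  qed (use lim qb in auto)
  moreover have "integral\<^sup>L lborel (q n) = 0" for n
  proof -
    let ?v = "(1 / real (Suc n)) *\<^sub>R ?e"
    have Gi: "integrable lborel G"
    proof -
      have "integrable lborel (\<lambda>x. indicator K x *\<^sub>R G x)"
        using K(1) cont(1) by (intro borel_integrable_compact) (auto intro: continuous_on_subset)
      moreover have "(\<lambda>x. indicator K x *\<^sub>R G x) = G"
        using K(2) by (auto simp: indicator_def fun_eq_iff)
      ultimately show ?thesis by simp
    qed
    have "integrable (distr lborel borel ((+) ?v)) G" "integral\<^sup>L (distr lborel borel ((+) ?v)) G = integral\<^sup>L lborel G"
      using Gi by (simp_all add: lborel_distr_plus)
    then have "integrable lborel (\<lambda>y. G (y + ?v))" "integral\<^sup>L lborel (\<lambda>y. G (y + ?v)) = integral\<^sup>L lborel G"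
      by (simp_all add: integrable_distr_eq integral_distr add.commute)
    then show ?thesis
      unfolding q_def using Gi by simp
  qed
  ultimately show ?thesis
    by (simp add: LIMSEQ_const_iff)
qed

lemma integral_lborel_compact_support:
  fixes f :: "real^'n::finite \<Rightarrow> real"
  assumes c: "continuous_on (cbox a b) f" and out: "\<And>y. y \<notin> cbox a b \<Longrightarrow> f y = 0"
  shows "integral\<^sup>L lborel f = integral (cbox a b) f"
proof -
  have "set_integrable lborel (cbox a b) f"
    unfolding set_integrable_def using c by (intro borel_integrable_compact) auto
  then have "(LINT x:cbox a b|lborel. f x) = integral (cbox a b) f"
    by (rule set_borel_integral_eq_integral)
  moreover have "(\<lambda>x. indicator (cbox a b) x *\<^sub>R f x) = f"
    using out by (auto simp: indicator_def fun_eq_iff)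
  ultimately show ?thesis
    by (simp add: set_lebesgue_integral_def)
qed

lemma C1_on_open_Un:
  assumes "open S" "open S'" "C1_on f S" "C1_on f S'"
  shows "C1_on f (S \<union> S')"
  using assms by (auto simp: C1_on_def intro: continuous_on_open_Un)

lemma pd_diff:
  fixes f g :: "real^'n::finite \<Rightarrow> real"
  assumes "C1_on f S" "C1_on g S" "y \<in> S"
  shows "pd i (\<lambda>y. f y - g y) y = pd i f y - pd i g y"
  using has_derivative_diff [OF C1_onD C1_onD, OF assms(1,3) assms(2,3)]
  by (subst pd_eq) (auto simp: pd_def)

lemma C1_on_diff:
  fixes f g :: "real^'n::finite \<Rightarrow> real"
  assumes "C1_on f S" "C1_on g S"
  shows "C1_on (\<lambda>y. f y - g y) S"
proof (rule C1_onI [OF has_derivative_diff [OF C1_onD C1_onD, OF assms(1) _ assms(2)]])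
  have "continuous_on S (\<lambda>y. pd i f y - pd i g y)" for i
    using assms by (intro continuous_on_diff C1_on_continuous_pd)
  then show "continuous_on S (\<lambda>y. frechet_derivative f (at y) (axis i 1) - frechet_derivative g (at y) (axis i 1))" for i
    by (simp add: pd_def)
qed

text \<open>Green's second identity, with the test function \<open>\<alpha>\<close> absorbing the boundary terms; the matrix
  of coefficients need not be symmetric.\<close>

lemma green_identity:
  fixes w \<alpha> :: "real^'n::finite \<Rightarrow> real" and a :: "'n \<Rightarrow> 'n \<Rightarrow> real^'n \<Rightarrow> real"
  assumes W: "open W" and K: "compact K" "K \<subseteq> cbox l u" and Q: "cbox l u \<subseteq> W"
    and w: "C1_on w W" "\<And>j. C1_on (pd j w) W"
    and \<alpha>: "C1_on \<alpha> W" "\<And>i. C1_on (pd i \<alpha>) W" "\<And>y. y \<notin> K \<Longrightarrow> \<alpha> y = 0"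
    and a: "\<And>i j. C1_on (a i j) W"
  shows "integral (cbox l u) (\<lambda>y. \<alpha> y * (\<Sum>i\<in>UNIV. pd i (\<lambda>y. \<Sum>j\<in>UNIV. a i j y * pd j w y) y))
       = integral (cbox l u) (\<lambda>y. w y * (\<Sum>j\<in>UNIV. pd j (\<lambda>y. \<Sum>i\<in>UNIV. a i j y * pd i \<alpha> y) y))"
proof -
  define F where "F = (\<lambda>i y. \<Sum>j\<in>UNIV. a i j y * pd j w y)"
  define E where "E = (\<lambda>j y. \<Sum>i\<in>UNIV. a i j y * pd i \<alpha> y)"
  have F: "C1_on (F i) W" and E: "C1_on (E i) W" for i
    unfolding F_def E_def by (intro C1_on_sum C1_on_mult a w \<alpha>; simp)+
  have d\<alpha>: "pd i \<alpha> y = 0" if "y \<in> W" "y \<notin> K" for i y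
  proof -
    have "pd i \<alpha> y = pd i (\<lambda>z. 0) y"
      using K that \<alpha> W by (intro pd_cong_open [of "W - K"]) (auto simp: compact_imp_closed C1_on_def)
    then show ?thesis
      using pd_eq [of "\<lambda>z. 0" "\<lambda>z. 0" y i] by simp
  qed
  have E0: "E j y = 0" if "y \<in> W" "y \<notin> K" for j y
    using d\<alpha> that by (simp add: E_def)
  \<comment> \<open>The flux field whose divergence integrates to 0. Setting it to 0 off
    \<open>W\<close> makes it C^1 on the whole space, because it already vanishes on the open set
    \<open>- K\<close> and \<open>W\<close> together with \<open>- K\<close> covers
    everything.\<close>
  define G where "G = (\<lambda>i y. if y \<in> W then \<alpha> y * F i y - w y * E i y else 0)"
  have G0: "G i y = 0" if "y \<notin> K" for i y
    using that \<alpha> E0 by (simp add: G_def)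
  have GW: "C1_on (G i) W" for i
  proof (rule C1_on_cong [OF W])
    show "C1_on (\<lambda>y. \<alpha> y * F i y - w y * E i y) W"
      by (intro C1_on_diff C1_on_mult \<alpha> F w E)
  qed (simp add: G_def)
  have "C1_on (G i) (- K)" for i
    by (rule C1_on_cong [OF _ _ C1_on_const [where a = 0]]) (use K G0 in \<open>auto simp: compact_imp_closed\<close>)
  moreover have KW: "W \<union> - K = UNIV"
    using K Q by blast
  ultimately have G1: "C1_on (G i) UNIV" for i
    using C1_on_open_Un [OF W _ GW, of "- K" i] K(1) KW by (simp add: compact_imp_closed open_Compl)
  have pdG: "pd i (G i) y = \<alpha> y * pd i (F i) y + pd i \<alpha> y * F i y - (w y * pd i (E i) y + pd i w y * E i y)"
    if "y \<in> W" for i y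
  proof -
    have "pd i (G i) y = pd i (\<lambda>y. \<alpha> y * F i y - w y * E i y) y"
      using GW that W by (intro pd_cong_open [of W]) (auto simp: G_def C1_on_def)
    also have "\<dots> = pd i (\<lambda>y. \<alpha> y * F i y) y - pd i (\<lambda>y. w y * E i y) y"
      by (intro pd_diff [OF _ _ that] C1_on_mult \<alpha> F w E)
    finally show ?thesis
      by (simp add: pd_mult [OF \<alpha>(1) F that] pd_mult [OF w(1) E that])
  qed
  have pdG0: "pd i (G i) y = 0" if "y \<notin> cbox l u" for i y
  proof -
    have "y \<notin> K" using that K by blast
    then have "pd i (G i) y = pd i (\<lambda>z. 0) y"
      using K G0 G1 by (intro pd_cong_open [of "- K"]) (auto simp: compact_imp_closed C1_on_def open_Compl)
    then show ?thesis
      using pd_eq [of "\<lambda>z. 0" "\<lambda>z. 0" y i] by simp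
  qed
  have cG: "continuous_on (cbox l u) (pd i (G i))" for i
    using C1_on_continuous_pd [OF G1] continuous_on_subset by blast
  have intG: "integral (cbox l u) (pd i (G i)) = 0" for i
    using integral_pd_eq_0 [OF G1 K(1) G0] integral_lborel_compact_support [OF cG pdG0] by simp
  have cont: "continuous_on (cbox l u) (\<lambda>y. \<alpha> y * (\<Sum>i\<in>UNIV. pd i (F i) y))"
    "continuous_on (cbox l u) (\<lambda>y. w y * (\<Sum>i\<in>UNIV. pd i (E i) y))"
    by (intro continuous_on_mult continuous_on_sum continuous_on_subset [OF _ Q] C1_on_continuous C1_on_continuous_pd \<alpha> F w E)+
  have "(\<Sum>i\<in>UNIV. pd i (G i) y) = \<alpha> y * (\<Sum>i\<in>UNIV. pd i (F i) y) - w y * (\<Sum>i\<in>UNIV. pd i (E i) y)"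
    if y: "y \<in> cbox l u" for y
  proof -
    \<comment> \<open>The first-order cross terms of the two product rules are the same double sum,
      so they cancel in the divergence of \<open>G\<close>.\<close>
    have "(\<Sum>i\<in>UNIV. pd i \<alpha> y * F i y) = (\<Sum>i\<in>UNIV. \<Sum>j\<in>UNIV. pd i \<alpha> y * (a i j y * pd j w y))"
      by (simp add: F_def sum_distrib_left)
    also have "\<dots> = (\<Sum>j\<in>UNIV. \<Sum>i\<in>UNIV. pd i \<alpha> y * (a i j y * pd j w y))"
      by (rule sum.swap)
    also have "\<dots> = (\<Sum>j\<in>UNIV. pd j w y * E j y)"
      by (simp add: E_def sum_distrib_left mult_ac)
    finally have s: "(\<Sum>i\<in>UNIV. pd i \<alpha> y * F i y) = (\<Sum>j\<in>UNIV. pd j w y * E j y)" .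
    have "y \<in> W" using y Q by blast
    then show ?thesis
      using s by (simp add: pdG sum.distrib sum_subtractf sum_distrib_left)
  qed
  then have "integral (cbox l u) (\<lambda>y. \<alpha> y * (\<Sum>i\<in>UNIV. pd i (F i) y) - w y * (\<Sum>i\<in>UNIV. pd i (E i) y))
    = integral (cbox l u) (\<lambda>y. \<Sum>i\<in>UNIV. pd i (G i) y)"
    by (intro integral_cong) simp
  also have "\<dots> = 0"
    using intG by (subst integral_sum) (auto intro!: integrable_continuous cG)
  finally show ?thesis
    using cont unfolding F_def E_def by (simp add: integral_diff integrable_continuous)
qed

section \<open>Radial bumps in coordinates and the size of their derivatives\<close>

context cutoff
begin

definition bump :: "real^'n::finite \<Rightarrow> real \<Rightarrow> real^'n \<Rightarrow> real" where
  "bump y0 R y = h ((y - y0) \<bullet> (y - y0) / R\<^sup>2)"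

text \<open>Closed form of the first partial derivatives of \<open>bump\<close>, as
  \<open>pd_bump\<close> confirms; \<open>bump2\<close> plays the same role for the second
  ones.\<close>

definition bump1 :: "real^'n::finite \<Rightarrow> real \<Rightarrow> 'n \<Rightarrow> real^'n \<Rightarrow> real" where
  "bump1 y0 R i y = h1 ((y - y0) \<bullet> (y - y0) / R\<^sup>2) * (2 * (y - y0) $ i / R\<^sup>2)"

definition bump2 :: "real^'n::finite \<Rightarrow> real \<Rightarrow> 'n \<Rightarrow> 'n \<Rightarrow> real^'n \<Rightarrow> real" where
  "bump2 y0 R i j y = h2 ((y - y0) \<bullet> (y - y0) / R\<^sup>2) * (2 * (y - y0) $ i / R\<^sup>2) * (2 * (y - y0) $ j / R\<^sup>2)
     + h1 ((y - y0) \<bullet> (y - y0) / R\<^sup>2) * (if i = j then 2 / R\<^sup>2 else 0)"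

lemma h_continuous: "continuous_on S h" and h1_continuous: "continuous_on S h1"
  and h2_continuous: "continuous_on S h2"
  using h_DERIV h1_DERIV h2_cont
  by (auto intro: continuous_at_imp_continuous_on DERIV_isCont continuous_on_subset)

lemma square_deriv:
  "((\<lambda>y. (y - y0) \<bullet> (y - y0) / R\<^sup>2) has_derivative (\<lambda>v. 2 * ((y - y0) \<bullet> v) / R\<^sup>2)) (at y)"
  for y y0 :: "real^'n::finite"
proof -
  have "((\<lambda>y. (y - y0) \<bullet> (y - y0)) has_derivative (\<lambda>v. 2 * ((y - y0) \<bullet> v))) (at y)"
    by (auto intro!: derivative_eq_intros simp: inner_commute)
  then show ?thesis
    by (rule bounded_linear.has_derivative [OF bounded_linear_divide])
qed

lemma continuous_on_divide_const: "continuous_on S f \<Longrightarrow> continuous_on S (\<lambda>y. f y / (k :: real))"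
  by (rule bounded_linear.continuous_on [OF bounded_linear_divide])

lemma square_continuous: "continuous_on S (\<lambda>y. (y - y0) \<bullet> (y - y0) / R\<^sup>2)"
  for y0 :: "real^'n::finite"
  by (intro continuous_on_divide_const continuous_intros)

lemma bump_deriv: "(bump y0 R has_derivative (\<lambda>v. h1 ((y - y0) \<bullet> (y - y0) / R\<^sup>2) * (2 * ((y - y0) \<bullet> v) / R\<^sup>2))) (at y)"
  unfolding bump_def [abs_def] by (rule has_derivative_compose_real [OF square_deriv h_DERIV])

lemma pd_bump: "pd i (bump y0 R) = bump1 y0 R i"
  by (rule ext) (simp add: pd_eq [OF bump_deriv] bump1_def inner_axis)

lemma C1_bump: "C1_on (bump y0 R) S"
  by (rule C1_onI [OF bump_deriv])
     (intro continuous_intros continuous_on_divide_const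
        continuous_on_compose2 [OF h1_continuous [of UNIV] square_continuous] subset_UNIV)

lemma bump1_deriv:
  "(bump1 y0 R i has_derivative (\<lambda>v. h1 ((y - y0) \<bullet> (y - y0) / R\<^sup>2) * (2 * v $ i / R\<^sup>2)
      + h2 ((y - y0) \<bullet> (y - y0) / R\<^sup>2) * (2 * ((y - y0) \<bullet> v) / R\<^sup>2) * (2 * (y - y0) $ i / R\<^sup>2))) (at y)"
proof -
  have "((\<lambda>y. (y - y0) $ i) has_derivative (\<lambda>v. v $ i)) (at y)"
    by (rule bounded_linear.has_derivative [OF bounded_linear_vec_nth]) (auto intro!: derivative_eq_intros)
  then have lin: "((\<lambda>y. 2 * (y - y0) $ i / R\<^sup>2) has_derivative (\<lambda>v. 2 * v $ i / R\<^sup>2)) (at y)"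
    by (intro bounded_linear.has_derivative [OF bounded_linear_divide] has_derivative_mult_right)
  show ?thesis
    unfolding bump1_def [abs_def]
    by (rule has_derivative_mult [OF has_derivative_compose_real [OF square_deriv h1_DERIV] lin])
qed

lemma pd_bump1: "pd j (bump1 y0 R i) = bump2 y0 R i j"
proof
  have "axis j (1::real) $ i = (if i = j then 1 else 0)"
    by (auto simp: axis_def)
  then show "pd j (bump1 y0 R i) y = bump2 y0 R i j y" for y
    by (simp add: pd_eq [OF bump1_deriv] bump2_def inner_axis)
qed

lemma bump2_continuous: "continuous_on S (bump2 y0 R i j)"
  unfolding bump2_def [abs_def]
  by (intro continuous_intros continuous_on_divide_const
        continuous_on_compose2 [OF h1_continuous [of UNIV] square_continuous]
        continuous_on_compose2 [OF h2_continuous [of UNIV] square_continuous] subset_UNIV)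

lemma C1_bump1: "C1_on (bump1 y0 R i) S"
  unfolding C1_on_def pd_bump1 using bump2_continuous
  by (auto intro: differentiableI [OF bump1_deriv])

lemma bump_bounds: "0 \<le> bump y0 R y" "bump y0 R y \<le> 1"
  by (simp_all add: bump_def h_nonneg h_le_1)

lemma bump_inside:
  assumes "R > 0" "norm (y - y0) \<le> R / 2"
  shows "bump y0 R y = 1" "bump1 y0 R i y = 0" "bump2 y0 R i j y = 0"
proof -
  have "(norm (y - y0))\<^sup>2 \<le> (R / 2)\<^sup>2"
    using assms by (intro power_mono) auto
  then have "(y - y0) \<bullet> (y - y0) / R\<^sup>2 \<le> 1/4"
    using assms by (simp add: dot_square_norm power_divide field_simps)
  from h_plateau [OF this]
  show "bump y0 R y = 1" "bump1 y0 R i y = 0" "bump2 y0 R i j y = 0"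
    by (simp_all add: bump_def bump1_def bump2_def)
qed

lemma bump_outside:
  assumes "R > 0" "norm (y - y0) \<ge> R"
  shows "bump y0 R y = 0" "bump1 y0 R i y = 0" "bump2 y0 R i j y = 0"
proof -
  have "(norm (y - y0))\<^sup>2 \<ge> R\<^sup>2"
    using assms by (intro power_mono) auto
  then have "(y - y0) \<bullet> (y - y0) / R\<^sup>2 \<ge> 1"
    using assms by (simp add: dot_square_norm field_simps)
  from h_outside [OF this]
  show "bump y0 R y = 0" "bump1 y0 R i y = 0" "bump2 y0 R i j y = 0"
    by (simp_all add: bump_def bump1_def bump2_def)
qed

lemma bump1_bound:
  assumes R: "R > 0"
  shows "\<bar>bump1 y0 R i y\<bar> \<le> 2 * K / R * bump y0 R y powr (1/p)"
proof (cases "norm (y - y0) \<ge> R")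
  case True
  then show ?thesis using bump_outside [OF R True] by simp
next
  case False
  have "\<bar>(y - y0) $ i\<bar> \<le> R"
    using component_le_norm_cart [of "y - y0" i] False by linarith
  then have "\<bar>2 * (y - y0) $ i / R\<^sup>2\<bar> \<le> 2 / R"
    using R by (simp add: abs_mult field_simps power2_eq_square)
  then have "\<bar>bump1 y0 R i y\<bar> \<le> (K * bump y0 R y powr (1/p)) * (2 / R)"
    unfolding bump1_def abs_mult bump_def using h1_bound K_pos by (intro mult_mono) auto
  then show ?thesis by (simp add: mult_ac)
qed

text \<open>Where |y - y0| < R, each factor 2 (y - y0)_i / R^2 is at most 2/R. The constant 6 is 4
  from the \<open>h2\<close> term plus 2 from the diagonal \<open>h1\<close> term.\<close>

lemma bump2_bound:
  assumes R: "R > 0"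
  shows "\<bar>bump2 y0 R i j y\<bar> \<le> 6 * K / R\<^sup>2 * bump y0 R y powr (1/p)"
proof (cases "norm (y - y0) \<ge> R")
  case True
  then show ?thesis using bump_outside [OF R True] by simp
next
  case False
  have b: "\<bar>2 * (y - y0) $ i / R\<^sup>2\<bar> \<le> 2 / R" for i
  proof -
    have "\<bar>(y - y0) $ i\<bar> \<le> R"
      using component_le_norm_cart [of "y - y0" i] False by linarith
    then show ?thesis
      using R by (simp add: abs_mult field_simps power2_eq_square)
  qed
  have B: "0 \<le> K * bump y0 R y powr (1/p)"
    using K_pos by simp
  have "\<bar>bump2 y0 R i j y\<bar> \<le> \<bar>h2 ((y - y0) \<bullet> (y - y0) / R\<^sup>2)\<bar> * \<bar>2 * (y - y0) $ i / R\<^sup>2\<bar> * \<bar>2 * (y - y0) $ j / R\<^sup>2\<bar>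
     + \<bar>h1 ((y - y0) \<bullet> (y - y0) / R\<^sup>2)\<bar> * \<bar>if i = j then 2 / R\<^sup>2 else 0\<bar>"
    unfolding bump2_def abs_mult [symmetric] by (rule abs_triangle_ineq)
  also have "\<dots> \<le> (K * bump y0 R y powr (1/p)) * (2 / R) * (2 / R) + (K * bump y0 R y powr (1/p)) * (2 / R\<^sup>2)"
    using b h1_bound h2_bound B R unfolding bump_def by (intro add_mono mult_mono) auto
  also have "\<dots> = 6 * K / R\<^sup>2 * bump y0 R y powr (1/p)"
    using R by (simp add: field_simps power2_eq_square)
  finally show ?thesis .
qed

end

section \<open>The test function estimate in coordinates\<close>

text \<open>The coordinate form of the problem: \<open>W\<close> stands for the chart range,
  \<open>\<rho>\<close> for the volume density, \<open>a\<close> for the density times the inverse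
  metric. The box around \<open>y0\<close> is the domain of all coordinate integrals.\<close>

locale local_problem = cutoff +
  fixes W :: "(real^'n::finite) set" and \<rho> :: "real^'n \<Rightarrow> real" and a :: "'n \<Rightarrow> 'n \<Rightarrow> real^'n \<Rightarrow> real"
    and y0 :: "real^'n" and r0 :: real
  assumes W: "open W" and r0: "0 < r0" "r0 \<le> 1"
    and box_subset: "cbox (\<chi> i. y0 $ i - r0) (\<chi> i. y0 $ i + r0) \<subseteq> W"
    and \<rho>_C1: "C1_on \<rho> W" and \<rho>_pos: "\<And>y. y \<in> W \<Longrightarrow> \<rho> y > 0"
    and a_C1: "\<And>i j. C1_on (a i j) W"
begin

abbreviation "Q \<equiv> cbox (\<chi> i. y0 $ i - r0) (\<chi> i. y0 $ i + r0)"

text \<open>The formal adjoint of the divergence-form operator applied to the bump, with derivatives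
  expanded; see \<open>adjoint_eq\<close>. Only derivatives of the bump occur, so it vanishes
  wherever the bump is locally constant.\<close>

definition adjoint :: "real \<Rightarrow> real^'n \<Rightarrow> real" where
  "adjoint R y = (\<Sum>j\<in>UNIV. \<Sum>i\<in>UNIV. pd j (a i j) y * bump1 y0 R i y + a i j y * bump2 y0 R i j y)"

text \<open>The factor multiplying \<open>w\<close> once all derivatives sit on the test function
  \<open>h (t / R\<^sup>2) * bump y0 R y\<close>: its time derivative times \<open>\<rho>\<close>,
  plus the adjoint operator applied to it.\<close>

definition \<Phi> :: "real \<Rightarrow> real \<Rightarrow> real^'n \<Rightarrow> real" where
  "\<Phi> R t y = h1 (t / R\<^sup>2) / R\<^sup>2 * (\<rho> y * bump y0 R y) + h (t / R\<^sup>2) * adjoint R y"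

lemma cball_subset_Q: "R \<le> r0 \<Longrightarrow> cball y0 R \<subseteq> Q"
proof
  fix y assume R: "R \<le> r0" and y: "y \<in> cball y0 R"
  have "\<bar>(y - y0) $ i\<bar> \<le> r0" for i
    using component_le_norm_cart [of "y - y0" i] y R by (simp add: dist_norm norm_minus_commute)
  then show "y \<in> Q"
    by (simp add: mem_box_cart abs_le_iff algebra_simps) 
qed

lemma adjoint_eq:
  assumes "y \<in> W"
  shows "(\<Sum>j\<in>UNIV. pd j (\<lambda>y. \<Sum>i\<in>UNIV. a i j y * pd i (bump y0 R) y) y) = adjoint R y"
  unfolding adjoint_def pd_bump
proof (rule sum.cong [OF refl])
  fix j
  have "pd j (\<lambda>y. \<Sum>i\<in>UNIV. a i j y * bump1 y0 R i y) y = (\<Sum>i\<in>UNIV. pd j (\<lambda>y. a i j y * bump1 y0 R i y) y)"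
    by (intro pd_sum [OF _ _ assms] C1_on_mult a_C1 C1_bump1) simp
  also have "\<dots> = (\<Sum>i\<in>UNIV. pd j (a i j) y * bump1 y0 R i y + a i j y * bump2 y0 R i j y)"
    by (simp add: pd_mult [OF a_C1 C1_bump1 assms] pd_bump1 add.commute)
  finally show "pd j (\<lambda>y. \<Sum>i\<in>UNIV. a i j y * bump1 y0 R i y) y
     = (\<Sum>i\<in>UNIV. pd j (a i j) y * bump1 y0 R i y + a i j y * bump2 y0 R i j y)" .
qed

lemma adjoint_continuous: "continuous_on Q (adjoint R)"
  unfolding adjoint_def [abs_def]
  by (intro continuous_intros continuous_on_subset [OF _ box_subset] C1_on_continuous_pd a_C1 C1_on_continuous C1_bump1 bump2_continuous)

lemma bounded_on_Q:
  assumes "continuous_on W f"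
  obtains B :: real where "B > 0" "\<And>y. y \<in> Q \<Longrightarrow> \<bar>f y\<bar> \<le> B"
proof -
  have "bounded (f ` Q)"
    using assms box_subset by (intro compact_imp_bounded compact_continuous_image compact_cbox) (auto intro: continuous_on_subset)
  then show ?thesis
    using that unfolding bounded_pos by (metis imageI real_norm_def)
qed

text \<open>One time derivative and two space derivatives both cost R^-2, and a single space
  derivative costs 1/R, which is smaller since R is at most 1. Undifferentiated factors lie in
  [0, 1] and are therefore below their own power 1/p. The constant depends on neither R nor
  t.\<close>

lemma \<Phi>_bound:
  obtains B where "B > 0"
    "\<And>R t y. 0 < R \<Longrightarrow> R \<le> 1 \<Longrightarrow> y \<in> Q \<Longrightarrow> \<bar>\<Phi> R t y\<bar> \<le> B / R\<^sup>2 * (h (t / R\<^sup>2) * bump y0 R y) powr (1/p)"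
proof -
  obtain B\<rho> where B\<rho>: "B\<rho> > 0" "\<And>y. y \<in> Q \<Longrightarrow> \<bar>\<rho> y\<bar> \<le> B\<rho>"
    using bounded_on_Q [OF C1_on_continuous [OF \<rho>_C1]] by blast
  have "\<exists>B. \<forall>y\<in>Q. \<bar>a i j y\<bar> \<le> B \<and> \<bar>pd j (a i j) y\<bar> \<le> B" for i j
  proof -
    obtain B1 where B1: "\<And>y. y \<in> Q \<Longrightarrow> \<bar>a i j y\<bar> \<le> B1"
      using bounded_on_Q [OF C1_on_continuous [OF a_C1]] by blast
    obtain B2 where B2: "\<And>y. y \<in> Q \<Longrightarrow> \<bar>pd j (a i j) y\<bar> \<le> B2"
      using bounded_on_Q [OF C1_on_continuous_pd [OF a_C1]] by blast
    show ?thesis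
      by (rule exI [of _ "max B1 B2"]) (use B1 B2 in fastforce)
  qed
  then obtain Ba where Ba: "\<And>i j y. y \<in> Q \<Longrightarrow> \<bar>a i j y\<bar> \<le> Ba i j \<and> \<bar>pd j (a i j) y\<bar> \<le> Ba i j"
    by metis
  \<comment> \<open>The 8 collects the constants 2 and 6 of \<open>bump1_bound\<close> and
    \<open>bump2_bound\<close>.\<close>
  define A where "A = (\<Sum>j\<in>UNIV. \<Sum>i\<in>UNIV. \<bar>Ba i j\<bar>) * (8 * K)"
  have A0: "A \<ge> 0" using K_pos by (auto simp: A_def intro!: mult_nonneg_nonneg sum_nonneg)
  have adj: "\<bar>adjoint R y\<bar> \<le> A / R\<^sup>2 * bump y0 R y powr (1/p)" if R: "0 < R" "R \<le> 1" and y: "y \<in> Q" for R y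
  proof -
    let ?b = "bump y0 R y powr (1/p)"
    have inv: "1 / R \<le> 1 / R\<^sup>2"
      using R by (simp add: field_simps power2_eq_square)
    have term_le: "\<bar>pd j (a i j) y * bump1 y0 R i y + a i j y * bump2 y0 R i j y\<bar> \<le> \<bar>Ba i j\<bar> * (8 * K / R\<^sup>2 * ?b)" for i j
    proof -
      have 1: "\<bar>pd j (a i j) y\<bar> \<le> \<bar>Ba i j\<bar>" "\<bar>a i j y\<bar> \<le> \<bar>Ba i j\<bar>"
        using Ba [OF y, of i j] by auto
      have "2 * K * ?b * (1 / R) \<le> 2 * K * ?b * (1 / R\<^sup>2)"
        using inv K_pos by (intro mult_left_mono) auto
      then have 2: "\<bar>bump1 y0 R i y\<bar> \<le> 2 * K / R\<^sup>2 * ?b"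
        using bump1_bound [OF R(1), of y0 i y] by (simp add: mult_ac)
      have "\<bar>pd j (a i j) y * bump1 y0 R i y + a i j y * bump2 y0 R i j y\<bar>
         \<le> \<bar>pd j (a i j) y\<bar> * \<bar>bump1 y0 R i y\<bar> + \<bar>a i j y\<bar> * \<bar>bump2 y0 R i j y\<bar>"
        by (metis abs_mult abs_triangle_ineq)
      also have "\<dots> \<le> \<bar>Ba i j\<bar> * (2 * K / R\<^sup>2 * ?b) + \<bar>Ba i j\<bar> * (6 * K / R\<^sup>2 * ?b)"
        using 1 2 bump2_bound [OF R(1)] by (intro add_mono mult_mono) auto
      also have "\<dots> = \<bar>Ba i j\<bar> * (8 * K / R\<^sup>2 * ?b)"
        by (simp add: field_simps)
      finally show ?thesis .
    qed
    have "\<bar>adjoint R y\<bar> \<le> (\<Sum>j\<in>UNIV. \<Sum>i\<in>UNIV. \<bar>pd j (a i j) y * bump1 y0 R i y + a i j y * bump2 y0 R i j y\<bar>)"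
      unfolding adjoint_def by (intro order_trans [OF sum_abs] sum_mono sum_abs)
    also have "\<dots> \<le> (\<Sum>j\<in>UNIV. \<Sum>i\<in>UNIV. \<bar>Ba i j\<bar> * (8 * K / R\<^sup>2 * ?b))"
      by (intro sum_mono term_le)
    also have "\<dots> = (\<Sum>j\<in>UNIV. \<Sum>i\<in>UNIV. \<bar>Ba i j\<bar>) * (8 * K / R\<^sup>2 * ?b)"
      by (simp only: sum_distrib_right)
    also have "\<dots> = A / R\<^sup>2 * ?b"
      by (simp add: A_def)
    finally show ?thesis .
  qed
  show ?thesis
  proof (rule that [of "K * B\<rho> + A"])
    show "K * B\<rho> + A > 0" using A0 B\<rho> K_pos by (simp add: add_pos_nonneg)
    fix R t y assume R: "0 < R" "R \<le> (1::real)" and y: "y \<in> Q"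
    let ?b = "bump y0 R y" and ?t = "h (t / R\<^sup>2)"
    have p1: "0 \<le> 1 / p" "1 / p \<le> 1" using p_gt_1 by auto
    have b: "?b \<le> ?b powr (1/p)"
      using powr_mono' [OF p1(2) bump_bounds(1,2) [of y0 R y]] bump_bounds(1) [of y0 R y] by simp
    have t: "?t \<le> ?t powr (1/p)"
      using powr_mono' [OF p1(2) h_nonneg h_le_1] h_nonneg by simp
    have "\<bar>\<Phi> R t y\<bar> \<le> \<bar>h1 (t / R\<^sup>2)\<bar> / R\<^sup>2 * (\<bar>\<rho> y\<bar> * ?b) + ?t * \<bar>adjoint R y\<bar>"
      unfolding \<Phi>_def using bump_bounds [of y0 R y] h_nonneg
      by (intro abs_triangle_ineq [THEN order_trans]) (simp add: abs_mult)
    also have "\<dots> \<le> (K * ?t powr (1/p)) / R\<^sup>2 * (B\<rho> * ?b powr (1/p)) + ?t powr (1/p) * (A / R\<^sup>2 * ?b powr (1/p))"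
      using h1_bound B\<rho>(2) [OF y] b t adj [OF R y] bump_bounds [of y0 R y] K_pos B\<rho>(1)
      by (intro add_mono mult_mono divide_right_mono) auto
    also have "\<dots> = (K * B\<rho> + A) / R\<^sup>2 * (?t * ?b) powr (1/p)"
      using h_nonneg bump_bounds [of y0 R y] by (simp add: powr_mult algebra_simps add_divide_distrib)
    finally show "\<bar>\<Phi> R t y\<bar> \<le> (K * B\<rho> + A) / R\<^sup>2 * (?t * ?b) powr (1/p)" .
  qed
qed

text \<open>The test function equals 1 on the inner cylinder (for t > 0) and 0 outside the outer
  one, so its derivatives live on the parabolic shell between them.\<close>

lemma \<Phi>_eq_0:
  assumes R: "R > 0" and "norm (y - y0) \<le> R / 2 \<and> t \<le> R\<^sup>2 / 4 \<or> norm (y - y0) \<ge> R \<or> t \<ge> R\<^sup>2"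
  shows "\<Phi> R t y = 0"
  using assms(2)
proof (elim disjE conjE)
  assume *: "norm (y - y0) \<le> R / 2" "t \<le> R\<^sup>2 / 4"
  then have "t / R\<^sup>2 \<le> 1/4" using R by (simp add: field_simps)
  then show ?thesis
    using h_plateau bump_inside [OF R *(1)] by (simp add: \<Phi>_def adjoint_def)
next
  assume "norm (y - y0) \<ge> R"
  then show ?thesis
    by (simp add: \<Phi>_def adjoint_def bump_outside [OF R])
next
  assume "t \<ge> R\<^sup>2"
  then have "t / R\<^sup>2 \<ge> 1" using R by (simp add: field_simps)
  then show ?thesis
    using h_outside by (simp add: \<Phi>_def)
qed

text \<open>\<open>wt\<close> is the time derivative of \<open>w\<close>, and the last conjunct is the equation
  \<open>u\<^sub>t - \<Delta>u = u\<^sup>p\<close> multiplied by the volume density \<open>\<rho>\<close>.\<close>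

definition local_solution :: "real \<Rightarrow> (real \<Rightarrow> real^'n \<Rightarrow> real) \<Rightarrow> (real \<Rightarrow> real^'n \<Rightarrow> real) \<Rightarrow> bool" where
  "local_solution T w wt \<longleftrightarrow>
     (\<forall>t\<in>{0<..<T}. \<forall>y\<in>W. 0 \<le> w t y) \<and>
     (\<forall>t\<in>{0<..<T}. C1_on (w t) W \<and> (\<forall>j. C1_on (pd j (w t)) W)) \<and>
     (\<forall>t\<in>{0<..<T}. \<forall>y\<in>W. ((\<lambda>t. w t y) has_real_derivative wt t y) (at t)) \<and>
     continuous_on ({0<..<T} \<times> W) (\<lambda>(t, y). w t y) \<and>
     continuous_on ({0<..<T} \<times> W) (\<lambda>(t, y). wt t y) \<and>
     (\<forall>t\<in>{0<..<T}. \<forall>y\<in>W. \<rho> y * wt t y =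
        (\<Sum>i\<in>UNIV. pd i (\<lambda>y. \<Sum>j\<in>UNIV. a i j y * pd j (w t) y) y) + \<rho> y * w t y powr p)"

definition mass :: "(real \<Rightarrow> real^'n \<Rightarrow> real) \<Rightarrow> real \<Rightarrow> real \<Rightarrow> real" where
  "mass w R t = integral Q (\<lambda>y. \<rho> y * bump y0 R y * w t y)"

section \<open>The tested equation for a local solution\<close>

context
  fixes T w wt
  assumes sol: "local_solution T w wt"
begin

lemma w_nonneg: "t \<in> {0<..<T} \<Longrightarrow> y \<in> Q \<Longrightarrow> 0 \<le> w t y"
  using sol box_subset unfolding local_solution_def by blast

lemma w_cont: "continuous_on ({0<..<T} \<times> Q) (\<lambda>(t, y). w t y)"
  and wt_cont: "continuous_on ({0<..<T} \<times> Q) (\<lambda>(t, y). wt t y)"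
proof -
  have "{0<..<T} \<times> Q \<subseteq> {0<..<T} \<times> W"
    using box_subset by blast
  then show "continuous_on ({0<..<T} \<times> Q) (\<lambda>(t, y). w t y)" "continuous_on ({0<..<T} \<times> Q) (\<lambda>(t, y). wt t y)"
    using sol unfolding local_solution_def by (blast intro: continuous_on_subset)+
qed

lemma cont_space: "continuous_on Q g \<Longrightarrow> continuous_on (S \<times> Q) (\<lambda>(t, y). g y)"
  and cont_time: "continuous_on UNIV f \<Longrightarrow> continuous_on (S \<times> Q) (\<lambda>(t, y). f t)"
  for f g :: "_ \<Rightarrow> real"
  by (auto simp: case_prod_beta intro!: continuous_on_compose2 [of Q g] continuous_on_compose2 [of UNIV f] continuous_intros)

lemma slice_cont:
  assumes "continuous_on (S \<times> Q) (\<lambda>(t, y). F t y)" "t \<in> S"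
  shows "continuous_on Q (F t)"
proof -
  have "continuous_on Q (\<lambda>y. (t, y))"
    by (intro continuous_on_Pair continuous_on_const continuous_on_id)
  from continuous_on_compose2 [OF assms(1) this] show ?thesis
    using assms(2) by auto
qed

lemma \<rho>_cont: "continuous_on Q \<rho>"
  using C1_on_continuous [OF \<rho>_C1] box_subset continuous_on_subset by blast

lemma bump_cont: "continuous_on S (bump y0 R)"
  using C1_on_continuous [OF C1_bump] .

lemma wp_cont: "continuous_on ({0<..<T} \<times> Q) (\<lambda>(t, y). w t y powr p)"
proof -
  have "continuous_on ({0<..<T} \<times> Q) (\<lambda>z. (\<lambda>(t, y). w t y) z powr p)"
    using w_nonneg p_gt_1 by (intro continuous_on_powr' w_cont continuous_on_const) auto
  then show ?thesis by (simp add: case_prod_beta)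
qed

lemma power_term_cont:
  "continuous_on ({0<..<T} \<times> Q) (\<lambda>(t, y). \<rho> y * (h (t / R\<^sup>2) * bump y0 R y) * w t y powr p)"
proof -
  have "continuous_on UNIV (\<lambda>t. h (t / R\<^sup>2))"
    by (intro continuous_on_compose2 [OF h_continuous [of UNIV]] continuous_on_divide_const continuous_on_id) auto
  from continuous_on_mult [OF continuous_on_mult [OF cont_space [OF \<rho>_cont] continuous_on_mult [OF cont_time [OF this] cont_space [OF bump_cont]]] wp_cont]
  show ?thesis by (simp add: case_prod_beta)
qed

lemma \<Phi>_cont: "continuous_on ({0<..<T} \<times> Q) (\<lambda>(t, y). \<Phi> R t y * w t y)"
proof -
  have "continuous_on UNIV (\<lambda>t. h (t / R\<^sup>2))" "continuous_on UNIV (\<lambda>t. h1 (t / R\<^sup>2) / R\<^sup>2)"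
    by (intro continuous_on_divide_const continuous_on_compose2 [OF h_continuous [of UNIV]]
       continuous_on_compose2 [OF h1_continuous [of UNIV]] continuous_on_id subset_UNIV)+
  from continuous_on_mult [OF continuous_on_add [OF
      continuous_on_mult [OF cont_time [OF this(2)] continuous_on_mult [OF cont_space [OF \<rho>_cont] cont_space [OF bump_cont]]]
      continuous_on_mult [OF cont_time [OF this(1)] cont_space [OF adjoint_continuous]]] w_cont]
  show ?thesis by (simp add: case_prod_beta \<Phi>_def)
qed

text \<open>Differentiate under the integral, replace \<open>wt\<close> by means of the equation,
  and move the elliptic operator onto the bump by \<open>green_identity\<close>; the bump is
  supported in a ball inside \<open>Q\<close>.\<close>

lemma mass_deriv:
  assumes t: "t \<in> {0<..<T}" and R: "0 < R" "R \<le> r0"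
  shows "(mass w R has_real_derivative integral Q (\<lambda>y. adjoint R y * w t y + \<rho> y * bump y0 R y * w t y powr p)) (at t)"
proof -
  have fx: "((\<lambda>t. \<rho> y * bump y0 R y * w t y) has_vector_derivative \<rho> y * bump y0 R y * wt t y) (at t within {0<..<T})"
    if "t \<in> {0<..<T}" "y \<in> Q" for t y
  proof -
    have "((\<lambda>t. w t y) has_real_derivative wt t y) (at t within {0<..<T})"
    proof (rule has_field_derivative_at_within)
      have "y \<in> W" using that box_subset by blast
      with that show "((\<lambda>t. w t y) has_real_derivative wt t y) (at t)"
        using sol unfolding local_solution_def by blast
    qed
    then show ?thesis
      unfolding has_real_derivative_iff_has_vector_derivative [symmetric] by (rule DERIV_cmult)
  qed
  have c: "continuous_on ({0<..<T} \<times> Q) (\<lambda>(t, y). \<rho> y * bump y0 R y * wt t y)"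
    using continuous_on_mult [OF continuous_on_mult [OF cont_space [OF \<rho>_cont] cont_space [OF bump_cont]] wt_cont]
    by (simp add: case_prod_beta)
  have c': "continuous_on ({0<..<T} \<times> Q) (\<lambda>(t, y). \<rho> y * bump y0 R y * w t y)"
    using continuous_on_mult [OF continuous_on_mult [OF cont_space [OF \<rho>_cont] cont_space [OF bump_cont]] w_cont]
    by (simp add: case_prod_beta)
  have "((\<lambda>t. integral Q (\<lambda>y. \<rho> y * bump y0 R y * w t y)) has_vector_derivative
      integral Q (\<lambda>y. \<rho> y * bump y0 R y * wt t y)) (at t within {0<..<T})"
    by (rule leibniz_rule_vector_derivative [OF fx _ c t])
       (auto intro!: integrable_continuous slice_cont [OF c'])
  then have d: "(mass w R has_real_derivative integral Q (\<lambda>y. \<rho> y * bump y0 R y * wt t y)) (at t)"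
    unfolding has_real_derivative_iff_has_vector_derivative mass_def [abs_def]
    using at_within_open [OF t open_greaterThanLessThan] by metis
  let ?L = "\<lambda>y. \<Sum>i\<in>UNIV. pd i (\<lambda>y. \<Sum>j\<in>UNIV. a i j y * pd j (w t) y) y"
  have wC1: "C1_on (w t) W" "\<And>j. C1_on (pd j (w t)) W"
    using sol t unfolding local_solution_def by blast+
  have cL: "continuous_on Q ?L"
    by (intro continuous_on_sum continuous_on_subset [OF _ box_subset] C1_on_continuous_pd C1_on_sum C1_on_mult a_C1 wC1) simp_all
  have cp: "continuous_on Q (\<lambda>y. \<rho> y * bump y0 R y * w t y powr p)"
    by (intro continuous_on_mult \<rho>_cont bump_cont slice_cont [OF wp_cont t])
  have ca: "continuous_on Q (\<lambda>y. adjoint R y * w t y)"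
    by (intro continuous_on_mult adjoint_continuous slice_cont [OF w_cont t])
  have "integral Q (\<lambda>y. \<rho> y * bump y0 R y * wt t y) = integral Q (\<lambda>y. bump y0 R y * ?L y + \<rho> y * bump y0 R y * w t y powr p)"
  proof (rule integral_cong)
    fix y assume "y \<in> Q"
    then have "\<rho> y * wt t y = ?L y + \<rho> y * w t y powr p"
      using sol t box_subset unfolding local_solution_def by blast
    then have "bump y0 R y * (\<rho> y * wt t y) = bump y0 R y * (?L y + \<rho> y * w t y powr p)"
      by simp
    then show "\<rho> y * bump y0 R y * wt t y = bump y0 R y * ?L y + \<rho> y * bump y0 R y * w t y powr p"
      by (simp add: algebra_simps)
  qed
  also have "\<dots> = integral Q (\<lambda>y. bump y0 R y * ?L y) + integral Q (\<lambda>y. \<rho> y * bump y0 R y * w t y powr p)"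
    by (intro integral_add integrable_continuous cp continuous_on_mult bump_cont cL)
  also have "integral Q (\<lambda>y. bump y0 R y * ?L y)
      = integral Q (\<lambda>y. w t y * (\<Sum>j\<in>UNIV. pd j (\<lambda>y. \<Sum>i\<in>UNIV. a i j y * pd i (bump y0 R) y) y))"
  proof (rule green_identity [OF W _ _ box_subset wC1])
    show "compact (cball y0 R)" by simp
    show "cball y0 R \<subseteq> Q" by (rule cball_subset_Q [OF R(2)])
    show "C1_on (bump y0 R) W" "\<And>i. C1_on (pd i (bump y0 R)) W"
      by (simp_all add: pd_bump C1_bump C1_bump1)
    show "bump y0 R y = 0" if "y \<notin> cball y0 R" for y
      using that R by (intro bump_outside) (auto simp: dist_norm norm_minus_commute)
  qed (rule a_C1)
  also have "\<dots> = integral Q (\<lambda>y. adjoint R y * w t y)"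
  proof (rule integral_cong)
    fix y assume "y \<in> Q"
    then have "y \<in> W"
      using box_subset by blast
    then show "w t y * (\<Sum>j\<in>UNIV. pd j (\<lambda>y. \<Sum>i\<in>UNIV. a i j y * pd i (bump y0 R) y) y) = adjoint R y * w t y"
      by (simp add: adjoint_eq)
  qed
  also have "\<dots> + integral Q (\<lambda>y. \<rho> y * bump y0 R y * w t y powr p)
      = integral Q (\<lambda>y. adjoint R y * w t y + \<rho> y * bump y0 R y * w t y powr p)"
    by (intro integral_add [symmetric] integrable_continuous cp ca)
  finally show ?thesis
    using d by simp
qed

lemma slice_integral_cont:
  fixes F :: "real \<Rightarrow> real^'n \<Rightarrow> real"
  assumes F: "continuous_on ({0<..<T} \<times> Q) (\<lambda>(t, y). F t y)" and "0 < \<epsilon>" "\<tau> < T"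
  shows "continuous_on {\<epsilon>..\<tau>} (\<lambda>t. integral Q (F t))"
proof -
  have "continuous_on ({\<epsilon>..\<tau>} \<times> Q) (\<lambda>(t, y). F t y)"
    by (rule continuous_on_subset [OF F]) (use assms in auto)
  then show ?thesis
    by (rule integral_continuous_on_param)
qed

text \<open>Integrate the derivative of \<open>h (t / R\<^sup>2) * mass w R t\<close> over the time
  interval: the time cutoff is 1 at \<open>\<epsilon>\<close> and 0 at \<open>\<tau>\<close>.
  Leaving \<open>\<tau>\<close> free above \<open>R\<^sup>2\<close> lets all dyadic scales share one
  interval.\<close>

lemma test_identity:
  assumes R: "0 < R" "R \<le> r0" and \<epsilon>: "0 < \<epsilon>" "\<epsilon> \<le> R\<^sup>2 / 4" and \<tau>: "R\<^sup>2 \<le> \<tau>" "\<tau> < T"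
  shows "mass w R \<epsilon> + integral {\<epsilon>..\<tau>} (\<lambda>t. integral Q (\<lambda>y. \<rho> y * (h (t / R\<^sup>2) * bump y0 R y) * w t y powr p))
    = - integral {\<epsilon>..\<tau>} (\<lambda>t. integral Q (\<lambda>y. \<Phi> R t y * w t y))"
proof -
  have le: "\<epsilon> \<le> \<tau>"
    using \<epsilon> \<tau> zero_le_power2 [of R] by linarith
  let ?P = "\<lambda>t. integral Q (\<lambda>y. \<rho> y * (h (t / R\<^sup>2) * bump y0 R y) * w t y powr p)"
  let ?E = "\<lambda>t. integral Q (\<lambda>y. \<Phi> R t y * w t y)"
  have d: "((\<lambda>t. h (t / R\<^sup>2) * mass w R t) has_real_derivative ?E t + ?P t) (at t)" if t: "t \<in> {\<epsilon>..\<tau>}" for t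
  proof -
    have t': "t \<in> {0<..<T}" using t \<epsilon> \<tau> by auto
    have "((\<lambda>t. h (t / R\<^sup>2)) has_real_derivative h1 (t / R\<^sup>2) * (1 / R\<^sup>2)) (at t)"
      by (rule DERIV_chain2 [OF h_DERIV DERIV_cdivide [OF DERIV_ident]])
    from DERIV_mult [OF this mass_deriv [OF t' R]]
    have "((\<lambda>t. h (t / R\<^sup>2) * mass w R t) has_real_derivative
       h1 (t / R\<^sup>2) * (1 / R\<^sup>2) * mass w R t +
       integral Q (\<lambda>y. adjoint R y * w t y + \<rho> y * bump y0 R y * w t y powr p) * h (t / R\<^sup>2)) (at t)" .
    moreover have "h1 (t / R\<^sup>2) * (1 / R\<^sup>2) * mass w R t +
       integral Q (\<lambda>y. adjoint R y * w t y + \<rho> y * bump y0 R y * w t y powr p) * h (t / R\<^sup>2) = ?E t + ?P t"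
    proof -
      have c1: "continuous_on Q (\<lambda>y. \<rho> y * bump y0 R y * w t y)"
        by (intro continuous_on_mult \<rho>_cont bump_cont slice_cont [OF w_cont t'])
      have c2: "continuous_on Q (\<lambda>y. adjoint R y * w t y + \<rho> y * bump y0 R y * w t y powr p)"
        by (intro continuous_on_add continuous_on_mult \<rho>_cont bump_cont adjoint_continuous slice_cont [OF wp_cont t'] slice_cont [OF w_cont t'])
      have "?E t + ?P t = integral Q (\<lambda>y. \<Phi> R t y * w t y + \<rho> y * (h (t / R\<^sup>2) * bump y0 R y) * w t y powr p)"
        by (intro integral_add [symmetric] integrable_continuous slice_cont [OF \<Phi>_cont t'] slice_cont [OF power_term_cont t'])
      also have "\<dots> = integral Q (\<lambda>y. (h1 (t / R\<^sup>2) * (1 / R\<^sup>2)) * (\<rho> y * bump y0 R y * w t y)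
          + (adjoint R y * w t y + \<rho> y * bump y0 R y * w t y powr p) * h (t / R\<^sup>2))"
        by (intro integral_cong) (simp add: \<Phi>_def algebra_simps)
      also have "\<dots> = integral Q (\<lambda>y. (h1 (t / R\<^sup>2) * (1 / R\<^sup>2)) * (\<rho> y * bump y0 R y * w t y))
          + integral Q (\<lambda>y. (adjoint R y * w t y + \<rho> y * bump y0 R y * w t y powr p) * h (t / R\<^sup>2))"
        by (intro integral_add integrable_continuous continuous_on_mult continuous_on_const c1 c2)
      finally show ?thesis
        by (simp add: mass_def)
    qed
    ultimately show ?thesis by simp
  qed
  have ci: "continuous_on {\<epsilon>..\<tau>} ?E" "continuous_on {\<epsilon>..\<tau>} ?P"
    using slice_integral_cont [OF \<Phi>_cont \<epsilon>(1) \<tau>(2)] slice_integral_cont [OF power_term_cont \<epsilon>(1) \<tau>(2)] by auto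
  have "((\<lambda>t. ?E t + ?P t) has_integral (h (\<tau> / R\<^sup>2) * mass w R \<tau> - h (\<epsilon> / R\<^sup>2) * mass w R \<epsilon>)) {\<epsilon>..\<tau>}"
    using d by (intro fundamental_theorem_of_calculus [OF le])
      (auto simp: has_real_derivative_iff_has_vector_derivative [symmetric] intro: has_field_derivative_at_within)
  moreover have "h (\<tau> / R\<^sup>2) = 0"
    using h_outside [of "\<tau> / R\<^sup>2"] \<tau> R by (simp add: field_simps)
  moreover have "h (\<epsilon> / R\<^sup>2) = 1"
    using h_plateau [of "\<epsilon> / R\<^sup>2"] \<epsilon> R by (simp add: field_simps)
  ultimately have "integral {\<epsilon>..\<tau>} (\<lambda>t. ?E t + ?P t) = - mass w R \<epsilon>"
    by (simp add: integral_unique)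
  moreover have "integral {\<epsilon>..\<tau>} (\<lambda>t. ?E t + ?P t) = integral {\<epsilon>..\<tau>} ?E + integral {\<epsilon>..\<tau>} ?P"
    by (intro integral_add integrable_continuous_interval ci)
  ultimately show ?thesis by linarith
qed

end

end

text \<open>With z = \<phi>^(1/p) w, either b \<le> \<rho>0 z^(p-1), and the first summand alone
  dominates b z, or z \<le> (b/\<rho>0)^(1/(p-1)), and the second one does. The power term keeps the
  coefficient \<open>\<rho>0\<close>, a lower bound of the density, so that it can be absorbed
  completely.\<close>

lemma young_absorb:
  fixes w b \<phi> \<rho>0 p :: real
  assumes p: "p > 1" and nn: "0 \<le> w" "0 \<le> b" "0 \<le> \<phi>" and \<rho>0: "\<rho>0 > 0"
  shows "b * \<phi> powr (1/p) * w \<le> \<rho>0 * \<phi> * w powr p + \<rho>0 powr (- 1 / (p - 1)) * b powr (p / (p - 1))"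
proof -
  define z where "z = \<phi> powr (1/p) * w"
  have z0: "z \<ge> 0" using nn by (simp add: z_def)
  have zp: "z powr p = \<phi> * w powr p"
    using nn p by (simp add: z_def powr_mult powr_powr)
  have "b * z \<le> \<rho>0 * z powr p + \<rho>0 powr (- 1 / (p - 1)) * b powr (p / (p - 1))"
  proof (cases "b \<le> \<rho>0 * z powr (p - 1)")
    case True
    then have "b * z \<le> (\<rho>0 * z powr (p - 1)) * z"
      using z0 by (rule mult_right_mono)
    also have "\<dots> = \<rho>0 * z powr p"
      using z0 p by (cases "z = 0") (simp_all add: powr_diff)
    finally show ?thesis by (simp add: add_increasing2)
  next
    case False
    then have "b > 0" using \<rho>0 z0 by (smt (verit) mult_nonneg_nonneg powr_ge_zero)
    have "z powr (p - 1) \<le> b / \<rho>0"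
      using False \<rho>0 by (simp add: field_simps)
    then have "(z powr (p - 1)) powr (1 / (p - 1)) \<le> (b / \<rho>0) powr (1 / (p - 1))"
      using p by (intro powr_mono2) auto
    then have "z \<le> (b / \<rho>0) powr (1 / (p - 1))"
      using z0 p by (simp add: powr_powr)
    then have "b * z \<le> b * (b / \<rho>0) powr (1 / (p - 1))"
      using nn by (intro mult_left_mono)
    also have "\<dots> = \<rho>0 powr (- 1 / (p - 1)) * (b powr 1 * b powr (1 / (p - 1)))"
      using \<open>b > 0\<close> \<rho>0 powr_minus [of \<rho>0 "1 / (p - 1)"] by (simp add: powr_divide divide_simps)
    also have "b powr 1 * b powr (1 / (p - 1)) = b powr (p / (p - 1))"
      using p by (subst powr_add [symmetric]) (simp add: field_simps)
    finally show ?thesis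
      using zp nn \<rho>0 by (simp add: add_increasing)
  qed
  then show ?thesis
    unfolding zp by (simp add: z_def mult.assoc)
qed

section \<open>Absorption of all dyadic errors into a single power term\<close>

context local_problem
begin

lemma \<rho>_lower_bound: obtains \<rho>0 where "\<rho>0 > 0" "\<And>y. y \<in> Q \<Longrightarrow> \<rho>0 \<le> \<rho> y"
proof -
  have "y0 \<in> Q" using cball_subset_Q [of r0] r0 by auto
  then have ne: "Q \<noteq> {}" by blast
  have "continuous_on Q \<rho>"
    by (rule continuous_on_subset [OF C1_on_continuous [OF \<rho>_C1] box_subset])
  from continuous_attains_inf [OF compact_cbox ne this]
  obtain z where "z \<in> Q" "\<And>y. y \<in> Q \<Longrightarrow> \<rho> z \<le> \<rho> y"
    by blast
  then show ?thesis
    using that [of "\<rho> z"] \<rho>_pos box_subset by blast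
qed

text \<open>Passing from \<open>j\<close> to \<open>k\<close> at least halves the scale, so the
  smaller error lives inside the inner cylinder of scale \<open>j\<close>. The two inclusions are
  recorded because they also show that the larger test function equals 1 there.\<close>

lemma \<Phi>_disjoint:
  assumes R: "R > 0" and jk: "j < k" and nz: "\<Phi> (R / 2 ^ k) t y \<noteq> 0"
  shows "norm (y - y0) \<le> (R / 2 ^ j) / 2" "t \<le> (R / 2 ^ j)\<^sup>2 / 4" "\<Phi> (R / 2 ^ j) t y = 0"
proof -
  have Rk: "R / 2 ^ k > 0" "R / 2 ^ j > 0" using R by auto
  have lt: "norm (y - y0) < R / 2 ^ k" "t < (R / 2 ^ k)\<^sup>2"
    using \<Phi>_eq_0 [OF Rk(1), of y t] nz by (auto simp: not_le [symmetric])
  have "(2::real) ^ Suc j \<le> 2 ^ k" using jk by (intro power_increasing) auto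
  then have le: "R / 2 ^ k \<le> (R / 2 ^ j) / 2"
    using R by (simp add: field_simps)
  then have "(R / 2 ^ k)\<^sup>2 \<le> ((R / 2 ^ j) / 2)\<^sup>2"
    using Rk by (intro power_mono) auto
  also have "\<dots> = (R / 2 ^ j)\<^sup>2 / 4" by (simp add: power_divide)
  finally have le2: "(R / 2 ^ k)\<^sup>2 \<le> (R / 2 ^ j)\<^sup>2 / 4" .
  show 1: "norm (y - y0) \<le> (R / 2 ^ j) / 2" and 2: "t \<le> (R / 2 ^ j)\<^sup>2 / 4"
    using lt le le2 by linarith+
  then show "\<Phi> (R / 2 ^ j) t y = 0"
    using \<Phi>_eq_0 [OF Rk(2)] by blast
qed

text \<open>At each point at most one of the errors is nonzero, and its test function is dominated
  by that of scale 0, so Young's inequality absorbs the whole weighted sum into the power term of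
  scale 0. Normalising \<open>\<mu> 0 = 1\<close> gives that term coefficient 1. What remains is
  Young's constant on a cylinder of volume about r^(N+2). \<open>I k\<close> is the initial mass at
  scale \<open>k\<close>, reached as the starting time tends to 0.\<close>

theorem mass_sum_bound:
  obtains C where "C > 0"
    "\<And>T w wt R n \<mu> I. local_solution T w wt \<Longrightarrow> 0 < R \<Longrightarrow> R \<le> r0 \<Longrightarrow> R\<^sup>2 < T \<Longrightarrow> \<mu> 0 = 1 \<Longrightarrow>
       (\<And>k. 0 \<le> \<mu> k) \<Longrightarrow> (\<And>k. k \<le> n \<Longrightarrow> (mass w (R / 2 ^ k) \<longlongrightarrow> I k) (at_right 0)) \<Longrightarrow>
       (\<Sum>k\<le>n. \<mu> k * I k) \<le>
         C * (\<Sum>k\<le>n. \<mu> k powr (p / (p - 1)) * (R / 2 ^ k) powr (real CARD('n) + 2 - 2 * (p / (p - 1))))"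
proof -
  obtain B where B: "B > 0" and \<Phi>B:
    "\<And>R t y. 0 < R \<Longrightarrow> R \<le> 1 \<Longrightarrow> y \<in> Q \<Longrightarrow> \<bar>\<Phi> R t y\<bar> \<le> B / R\<^sup>2 * (h (t / R\<^sup>2) * bump y0 R y) powr (1/p)"
    using \<Phi>_bound by blast
  obtain \<rho>0 where \<rho>0: "\<rho>0 > 0" "\<And>y. y \<in> Q \<Longrightarrow> \<rho>0 \<le> \<rho> y"
    using \<rho>_lower_bound by blast
  define p' where "p' = p / (p - 1)"
  define V where "V = unit_ball_vol (real CARD('n))"
  define D where "D = \<rho>0 powr (- 1 / (p - 1))"
  define C where "C = D * B powr p' * V"
  have V: "V > 0" by (simp add: V_def)
  have D: "D > 0" using \<rho>0 by (simp add: D_def)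
  show ?thesis
  proof (rule that [of C])
    show "C > 0" using D B V by (simp add: C_def)
    fix T R :: real and w wt :: "real \<Rightarrow> real^'n \<Rightarrow> real" and n :: nat and \<mu> I :: "nat \<Rightarrow> real"
    assume sol: "local_solution T w wt" and R: "0 < R" "R \<le> r0" "R\<^sup>2 < T"
      and \<mu>: "\<mu> 0 = 1" "\<And>k. (0::real) \<le> \<mu> k"
      and lim: "\<And>k. k \<le> n \<Longrightarrow> (mass w (R / 2 ^ k) \<longlongrightarrow> I k) (at_right 0)"
    define r where "r = (\<lambda>k::nat. R / 2 ^ k)"
    \<comment> \<open>The remainder of \<open>young_absorb\<close> for b = B \<mu>_k / r_k^2, the
      size of the weighted error at scale \<open>k\<close>.\<close>
    define c where "c = (\<lambda>k. D * (B * \<mu> k / (r k)\<^sup>2) powr p')"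
    define ind where "ind = (\<lambda>k y. c k * indicator (cball y0 (r k)) y)"
    define chi where "chi = (\<lambda>k t. indicator {..(r k)\<^sup>2} t :: real)"
    define E where "E = (\<lambda>k t. integral Q (\<lambda>y. \<Phi> (r k) t y * w t y))"
    define P where "P = (\<lambda>k t. integral Q (\<lambda>y. \<rho> y * (h (t / (r k)\<^sup>2) * bump y0 (r k) y) * w t y powr p))"
    have r: "0 < r k" "r k \<le> R" "r k \<le> r0" "r k \<le> 1" for k
    proof -
      show "0 < r k" using R by (simp add: r_def)
      have "R / 2 ^ k \<le> R / 1" using R by (intro divide_left_mono) auto
      then show "r k \<le> R" by (simp add: r_def)
      then show "r k \<le> r0" "r k \<le> 1" using R r0 by auto
    qed
    have r2: "(r k)\<^sup>2 \<le> R\<^sup>2" for k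
      using r [of k] by (intro power_mono) auto
    have rmono: "(r n)\<^sup>2 \<le> (r k)\<^sup>2" if "k \<le> n" for k
    proof -
      have "r n \<le> r k" using that R unfolding r_def by (intro divide_left_mono power_increasing) auto
      then show ?thesis using r [of n] by (intro power_mono) auto
    qed
    have c0: "c k \<ge> 0" for k
      using D by (simp add: c_def)
    have pointwise: "(\<Sum>k\<le>n. \<mu> k * (- (\<Phi> (r k) t y * w t y)))
        - \<rho> y * (h (t / (r 0)\<^sup>2) * bump y0 (r 0) y) * w t y powr p \<le> (\<Sum>k\<le>n. ind k y * chi k t)"
      if t: "t \<in> {0<..<T}" and y: "y \<in> Q" for t y
    proof -
      let ?\<phi> = "\<lambda>k. h (t / (r k)\<^sup>2) * bump y0 (r k) y"
      have w0: "0 \<le> w t y" using w_nonneg [OF sol t y] .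
      have \<phi>0: "0 \<le> ?\<phi> k" "?\<phi> k \<le> 1" for k
        using h_nonneg h_le_1 bump_bounds [of y0 "r k" y] by (auto intro: mult_le_one)
      have rhs0: "0 \<le> ind k y * chi k t" for k
        using c0 by (simp add: ind_def chi_def)
      have pow0: "0 \<le> \<rho> y * ?\<phi> 0 * w t y powr p"
        using \<phi>0(1) [of 0] \<rho>0(1) \<rho>0(2) [OF y] by (intro mult_nonneg_nonneg [OF mult_nonneg_nonneg]) simp_all
      show ?thesis
      proof (cases "\<forall>k\<le>n. \<Phi> (r k) t y = 0")
        case True
        then have "(\<Sum>k\<le>n. \<mu> k * (- (\<Phi> (r k) t y * w t y))) = 0" by simp
        moreover have "0 \<le> (\<Sum>k\<le>n. ind k y * chi k t)" using rhs0 by (intro sum_nonneg)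
        ultimately show ?thesis using pow0 by linarith
      next
        case False
        then obtain k where k: "k \<le> n" "\<Phi> (r k) t y \<noteq> 0" by blast
        have others: "\<Phi> (r j) t y = 0" if "j \<noteq> k" for j
          using that k \<Phi>_disjoint(3) [OF R(1), of j k t y] \<Phi>_disjoint(3) [OF R(1), of k j t y]
          unfolding r_def by (metis linorder_neqE_nat)
        have yk: "y \<in> cball y0 (r k)" "t \<le> (r k)\<^sup>2"
        proof -
          have "\<not> norm (y - y0) \<ge> r k" "\<not> t \<ge> (r k)\<^sup>2"
            using \<Phi>_eq_0 [OF r(1) [of k], of y t] k(2) by blast+
          then show "y \<in> cball y0 (r k)" "t \<le> (r k)\<^sup>2"
            by (auto simp: dist_norm norm_minus_commute)
        qed
        have \<phi>le: "?\<phi> k \<le> ?\<phi> 0"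
        \<comment> \<open>For k > 0 the point lies in the plateau of scale 0, where the larger test
          function is 1.\<close>
        proof (cases "k = 0")
          case False
          then have in0: "norm (y - y0) \<le> r 0 / 2" "t \<le> (r 0)\<^sup>2 / 4"
            using \<Phi>_disjoint(1,2) [OF R(1), of 0 k t y] k unfolding r_def by auto
          then have "t / (r 0)\<^sup>2 \<le> 1/4" using r(1) [of 0] by (simp add: field_simps)
          then have "?\<phi> 0 = 1" using h_plateau bump_inside(1) [OF r(1) in0(1)] by simp
          then show ?thesis using \<phi>0 by simp
        qed simp
        have "(\<Sum>j\<le>n. \<mu> j * (- (\<Phi> (r j) t y * w t y))) = \<mu> k * (- (\<Phi> (r k) t y * w t y))"
          using k others by (subst sum.remove [of _ k]) auto
        also have "\<dots> \<le> \<mu> k * (\<bar>\<Phi> (r k) t y\<bar> * w t y)"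
        proof (rule mult_left_mono [OF _ \<mu>(2)])
          have "(- \<Phi> (r k) t y) * w t y \<le> \<bar>\<Phi> (r k) t y\<bar> * w t y"
            using w0 by (intro mult_right_mono) auto
          then show "- (\<Phi> (r k) t y * w t y) \<le> \<bar>\<Phi> (r k) t y\<bar> * w t y" by simp
        qed
        also have "\<dots> \<le> \<mu> k * ((B / (r k)\<^sup>2 * ?\<phi> k powr (1/p)) * w t y)"
          using \<mu> w0 \<Phi>B [OF r(1) r(4) y] by (intro mult_left_mono mult_right_mono)
        also have "\<dots> \<le> \<mu> k * ((B / (r k)\<^sup>2 * ?\<phi> 0 powr (1/p)) * w t y)"
          using \<mu> w0 B \<phi>le \<phi>0 p_gt_1 by (intro mult_left_mono mult_right_mono powr_mono2) auto
        also have "\<dots> = (B * \<mu> k / (r k)\<^sup>2) * ?\<phi> 0 powr (1/p) * w t y"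
          by simp
        also have "\<dots> \<le> \<rho>0 * ?\<phi> 0 * w t y powr p + c k"
          unfolding c_def D_def p'_def using \<mu> B \<rho>0 w0 \<phi>0 p_gt_1 by (intro young_absorb) auto
        also have "\<dots> \<le> \<rho> y * ?\<phi> 0 * w t y powr p + c k"
          using \<rho>0(2) [OF y] \<phi>0 by (intro add_right_mono mult_right_mono) auto
        also have "c k = ind k y * chi k t"
          using yk by (simp add: ind_def chi_def)
        also have "\<dots> \<le> (\<Sum>j\<le>n. ind j y * chi j t)"
          using k rhs0 by (intro member_le_sum) auto
        finally show ?thesis by simp
      qed
    qed
    have ind_int: "(ind k has_integral c k * (V * r k ^ CARD('n))) Q" for k
    proof -
      have "((\<lambda>y. 1::real) has_integral measure lborel (cball y0 (r k))) (cball y0 (r k))"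
        using emeasure_lborel_cball_finite [of y0 "r k"] by (intro has_integral_measure_lborel) (auto simp: top.not_eq_extremum)
      then have "((\<lambda>y. if y \<in> cball y0 (r k) then 1 else 0::real) has_integral measure lborel (cball y0 (r k))) Q"
        by (subst has_integral_restrict [OF cball_subset_Q [OF r(3)]])
      moreover have "measure lborel (cball y0 (r k)) = V * r k ^ CARD('n)"
        using content_cball [of "r k" y0] r(1) [of k] by (simp add: V_def)
      ultimately have "((\<lambda>y. c k * (if y \<in> cball y0 (r k) then 1 else 0)) has_integral c k * (V * r k ^ CARD('n))) Q"
        by (intro has_integral_mult_right) simp
      then show ?thesis
        by (simp add: ind_def [abs_def] indicator_def of_bool_def)
    qed
    \<comment> \<open>The ball contributes r^N, the time interval r^2, and \<open>c k\<close>
      contributes r^(-2p').\<close>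
    have cterm: "c k * (V * r k ^ CARD('n)) * (r k)\<^sup>2
        = C * (\<mu> k powr p' * r k powr (real CARD('n) + 2 - 2 * p'))" for k
    proof -
      have "(B * \<mu> k / (r k)\<^sup>2) powr p' = B powr p' * \<mu> k powr p' * r k powr (- 2 * p')"
      proof -
        have "(B * \<mu> k / (r k)\<^sup>2) powr p' = B powr p' * \<mu> k powr p' / ((r k)\<^sup>2) powr p'"
          using B \<mu> by (simp add: powr_divide powr_mult)
        also have "((r k)\<^sup>2) powr p' = r k powr (2 * p')"
          using r(1) [of k] by (simp add: powr_powr flip: powr_numeral)
        finally show ?thesis by (simp add: powr_minus divide_inverse)
      qed
      moreover have "r k ^ CARD('n) = r k powr real CARD('n)" "(r k)\<^sup>2 = r k powr 2"
        using r(1) [of k] by (simp_all add: powr_realpow)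
      moreover have "r k powr (- 2 * p') * (r k powr real CARD('n) * r k powr 2) = r k powr (real CARD('n) + 2 - 2 * p')"
        by (simp add: powr_add [symmetric] algebra_simps)
      ultimately show ?thesis
        unfolding c_def C_def by (simp add: mult_ac)
    qed
    have main: "(\<Sum>k\<le>n. \<mu> k * mass w (r k) \<epsilon>) \<le> C * (\<Sum>k\<le>n. \<mu> k powr p' * r k powr (real CARD('n) + 2 - 2 * p'))"
      if \<epsilon>: "0 < \<epsilon>" "\<epsilon> < (r n)\<^sup>2 / 4" for \<epsilon>
    proof -
      have \<epsilon>k: "\<epsilon> \<le> (r k)\<^sup>2 / 4" if "k \<le> n" for k
        using \<epsilon> rmono [OF that] by linarith
      have \<epsilon>R: "\<epsilon> \<le> R\<^sup>2" using \<epsilon>k [of 0] r2 [of 0] zero_le_power2 [of R] by linarith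
      have sub: "t \<in> {0<..<T}" if "t \<in> {\<epsilon>..R\<^sup>2}" for t
        using that \<epsilon> R by auto
      have Ec: "continuous_on {\<epsilon>..R\<^sup>2} (E k)" and Pc: "continuous_on {\<epsilon>..R\<^sup>2} (P k)" for k
        unfolding E_def P_def
        using slice_integral_cont [OF sol \<Phi>_cont [OF sol] \<epsilon>(1) R(3)] slice_integral_cont [OF sol power_term_cont [OF sol] \<epsilon>(1) R(3)]
        by auto
      have P0: "0 \<le> integral {\<epsilon>..R\<^sup>2} (P k)" for k
      proof (rule integral_nonneg)
        show "P k integrable_on {\<epsilon>..R\<^sup>2}" by (intro integrable_continuous_interval Pc)
        show "0 \<le> P k t" if "t \<in> {\<epsilon>..R\<^sup>2}" for t
          unfolding P_def
        proof (rule integral_nonneg)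
          show "(\<lambda>y. \<rho> y * (h (t / (r k)\<^sup>2) * bump y0 (r k) y) * w t y powr p) integrable_on Q"
            by (intro integrable_continuous slice_cont [OF sol power_term_cont [OF sol] sub [OF that]])
          show "0 \<le> \<rho> y * (h (t / (r k)\<^sup>2) * bump y0 (r k) y) * w t y powr p" if "y \<in> Q" for y
            using \<rho>0(1) \<rho>0(2) [OF that] h_nonneg bump_bounds(1) [of y0 "r k" y] by (intro mult_nonneg_nonneg) auto
        qed
      qed
      have id: "mass w (r k) \<epsilon> = - integral {\<epsilon>..R\<^sup>2} (E k) - integral {\<epsilon>..R\<^sup>2} (P k)" if "k \<le> n" for k
        using test_identity [OF sol r(1) r(3) \<epsilon>(1) \<epsilon>k [OF that] r2 R(3)] unfolding E_def P_def by simp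
      have ci: "(chi k has_integral ((r k)\<^sup>2 - \<epsilon>)) {\<epsilon>..R\<^sup>2}" if "k \<le> n" for k
      proof -
        have \<epsilon>r: "\<epsilon> \<le> (r k)\<^sup>2" using \<epsilon>k [OF that] zero_le_power2 [of "r k"] by linarith
        have "((\<lambda>t. 1::real) has_integral ((r k)\<^sup>2 - \<epsilon>)) {\<epsilon>..(r k)\<^sup>2}"
          using has_integral_const_real [of "1::real" \<epsilon> "(r k)\<^sup>2"] \<epsilon>r by simp
        then have "((\<lambda>t. if t \<in> {\<epsilon>..(r k)\<^sup>2} then 1 else 0::real) has_integral ((r k)\<^sup>2 - \<epsilon>)) {\<epsilon>..R\<^sup>2}"
          using r2 by (subst has_integral_restrict) auto
        then show ?thesis
          by (rule has_integral_eq [rotated]) (auto simp: chi_def indicator_def)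
      qed
      have "(\<Sum>k\<le>n. \<mu> k * mass w (r k) \<epsilon>)
          = (\<Sum>k\<le>n. \<mu> k * (- integral {\<epsilon>..R\<^sup>2} (E k))) - (\<Sum>k\<le>n. \<mu> k * integral {\<epsilon>..R\<^sup>2} (P k))"
        using id by (simp add: right_diff_distrib sum_subtractf)
      \<comment> \<open>The power terms of the smaller scales are nonnegative and are discarded;
        only the one of scale 0 has to absorb.\<close>
      also have "\<dots> \<le> (\<Sum>k\<le>n. \<mu> k * (- integral {\<epsilon>..R\<^sup>2} (E k))) - integral {\<epsilon>..R\<^sup>2} (P 0)"
        using member_le_sum [of 0 "{..n}" "\<lambda>k. \<mu> k * integral {\<epsilon>..R\<^sup>2} (P k)"] \<mu> P0 by simp
      also have "\<dots> = integral {\<epsilon>..R\<^sup>2} (\<lambda>t. (\<Sum>k\<le>n. \<mu> k * (- E k t)) - P 0 t)"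
        by (intro integral_unique [symmetric] has_integral_diff has_integral_sum has_integral_mult_right
              has_integral_neg integrable_integral integrable_continuous_interval Ec Pc) simp
      also have "\<dots> \<le> integral {\<epsilon>..R\<^sup>2} (\<lambda>t. \<Sum>k\<le>n. (c k * (V * r k ^ CARD('n))) * chi k t)"
      proof (rule integral_le)
        show "(\<lambda>t. (\<Sum>k\<le>n. \<mu> k * (- E k t)) - P 0 t) integrable_on {\<epsilon>..R\<^sup>2}"
          using Ec Pc by (intro integrable_continuous_interval continuous_intros) auto
        show "(\<lambda>t. \<Sum>k\<le>n. (c k * (V * r k ^ CARD('n))) * chi k t) integrable_on {\<epsilon>..R\<^sup>2}"
          by (intro integrable_sum integrable_on_mult_right has_integral_integrable [OF ci]) auto
        fix t assume t: "t \<in> {\<epsilon>..R\<^sup>2}"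
        note t' = sub [OF t]
        have cE: "continuous_on Q (\<lambda>y. \<Phi> (r k) t y * w t y)" for k
          by (rule slice_cont [OF sol \<Phi>_cont [OF sol] t'])
        have cP: "continuous_on Q (\<lambda>y. \<rho> y * (h (t / (r 0)\<^sup>2) * bump y0 (r 0) y) * w t y powr p)"
          by (rule slice_cont [OF sol power_term_cont [OF sol] t'])
        have "(\<Sum>k\<le>n. \<mu> k * (- E k t)) - P 0 t
          = integral Q (\<lambda>y. (\<Sum>k\<le>n. \<mu> k * (- (\<Phi> (r k) t y * w t y)))
              - \<rho> y * (h (t / (r 0)\<^sup>2) * bump y0 (r 0) y) * w t y powr p)"
          unfolding E_def P_def
          by (intro integral_unique [symmetric] has_integral_diff has_integral_sum has_integral_mult_right
                has_integral_neg integrable_integral integrable_continuous cE cP) simp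
        also have "\<dots> \<le> integral Q (\<lambda>y. \<Sum>k\<le>n. ind k y * chi k t)"
        proof (rule integral_le)
          show "(\<lambda>y. (\<Sum>k\<le>n. \<mu> k * (- (\<Phi> (r k) t y * w t y)))
              - \<rho> y * (h (t / (r 0)\<^sup>2) * bump y0 (r 0) y) * w t y powr p) integrable_on Q"
            by (intro integrable_diff integrable_sum integrable_on_mult_right integrable_neg integrable_continuous cE cP) simp
          show "(\<lambda>y. \<Sum>k\<le>n. ind k y * chi k t) integrable_on Q"
            using ind_int by (intro integrable_sum integrable_on_mult_left) auto
        qed (rule pointwise [OF t'])
        also have "\<dots> = (\<Sum>k\<le>n. (c k * (V * r k ^ CARD('n))) * chi k t)"
          by (intro integral_unique has_integral_sum has_integral_mult_left ind_int) simp
        finally show "(\<Sum>k\<le>n. \<mu> k * (- E k t)) - P 0 t \<le> (\<Sum>k\<le>n. (c k * (V * r k ^ CARD('n))) * chi k t)" .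
      qed
      also have "\<dots> \<le> (\<Sum>k\<le>n. (c k * (V * r k ^ CARD('n))) * (r k)\<^sup>2)"
      proof -
        have "integral {\<epsilon>..R\<^sup>2} (\<lambda>t. \<Sum>k\<le>n. (c k * (V * r k ^ CARD('n))) * chi k t)
           = (\<Sum>k\<le>n. (c k * (V * r k ^ CARD('n))) * ((r k)\<^sup>2 - \<epsilon>))"
          by (intro integral_unique has_integral_sum has_integral_mult_right ci) auto
        also have "\<dots> \<le> (\<Sum>k\<le>n. (c k * (V * r k ^ CARD('n))) * (r k)\<^sup>2)"
          using c0 V r(1) \<epsilon> by (intro sum_mono mult_left_mono mult_nonneg_nonneg) (auto simp: less_imp_le)
        finally show ?thesis .
      qed
      also have "\<dots> = C * (\<Sum>k\<le>n. \<mu> k powr p' * r k powr (real CARD('n) + 2 - 2 * p'))"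
        by (simp only: cterm sum_distrib_left)
      finally show ?thesis .
    qed
    have "((\<lambda>\<epsilon>. \<Sum>k\<le>n. \<mu> k * mass w (r k) \<epsilon>) \<longlongrightarrow> (\<Sum>k\<le>n. \<mu> k * I k)) (at_right 0)"
      using lim unfolding r_def by (intro tendsto_intros) auto
    moreover have "\<forall>\<^sub>F \<epsilon> in at_right 0. (\<Sum>k\<le>n. \<mu> k * mass w (r k) \<epsilon>)
        \<le> C * (\<Sum>k\<le>n. \<mu> k powr p' * r k powr (real CARD('n) + 2 - 2 * p'))"
      using main r(1) [of n] unfolding eventually_at_right_field by (intro exI [of _ "(r n)\<^sup>2 / 4"]) auto
    ultimately have "(\<Sum>k\<le>n. \<mu> k * I k) \<le> C * (\<Sum>k\<le>n. \<mu> k powr p' * r k powr (real CARD('n) + 2 - 2 * p'))"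
      by (intro tendsto_upperbound) (auto simp: trivial_limit_at_right_real)
    then show "(\<Sum>k\<le>n. \<mu> k * I k) \<le>
         C * (\<Sum>k\<le>n. \<mu> k powr (p / (p - 1)) * (R / 2 ^ k) powr (real CARD('n) + 2 - 2 * (p / (p - 1))))"
      by (simp add: r_def p'_def)
  qed
qed

end

section \<open>Singular initial data on the manifold\<close>

locale chart_problem =
  riemannian M +
  local_problem p K h h1 h2 "chart_range c" "vol_density M c"
    "\<lambda>i j y. vol_density M c y * metric_inv M c y $ i $ j" y0 r0
  for M :: "('m::{t2_space, second_countable_topology}, 'n::finite) riemannian_structure"
    and p K h h1 h2 c y0 r0 +
  assumes c: "c \<in> charts M"
begin

section \<open>Test functions on M supported in one chart, and the passage to coordinates\<close>

definition lift :: "real \<Rightarrow> 'm \<Rightarrow> real" where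
  "lift R x = (if x \<in> chart_dom c then bump y0 R (coord c x) else 0)"

definition coord_ball :: "real \<Rightarrow> 'm set" where
  "coord_ball R = chart_inv c ` cball y0 R"

lemma cball_range: "R \<le> r0 \<Longrightarrow> cball y0 R \<subseteq> chart_range c"
  using cball_subset_Q box_subset by blast

lemma coord_ball_facts:
  assumes "R \<le> r0"
  shows compact_coord_ball: "compact (coord_ball R)"
    and coord_ball_dom: "coord_ball R \<subseteq> chart_dom c"
    and coord_coord_ball: "coord c ` coord_ball R = cball y0 R"
    and borel_coord_ball: "coord_ball R \<in> sets borel"
proof -
  note sub = cball_range [OF assms]
  show "compact (coord_ball R)"
    unfolding coord_ball_def
    by (rule compact_continuous_image [OF continuous_on_subset [OF continuous_chart_inv [OF c] sub] compact_cball])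
  then show "coord_ball R \<in> sets borel"
    by (simp add: compact_imp_closed)
  show "coord_ball R \<subseteq> chart_dom c"
    unfolding coord_ball_def using sub chart_inv_in [OF c] by blast
  show "coord c ` coord_ball R = cball y0 R"
    unfolding coord_ball_def image_image using sub coord_chart_inv [OF c] by (auto simp: image_iff subset_iff)
qed

lemma lift_outside:
  assumes "0 < R" "R \<le> r0" "x \<notin> coord_ball R"
  shows "lift R x = 0"
proof (cases "x \<in> chart_dom c")
  case True
  have "coord c x \<notin> cball y0 R"
  proof
    assume "coord c x \<in> cball y0 R"
    then have "chart_inv c (coord c x) \<in> coord_ball R"
      unfolding coord_ball_def by (rule imageI)
    with True assms c show False by simp
  qed
  then show ?thesis
    using assms bump_outside(1) [of R "coord c x" y0] by (simp add: lift_def dist_norm norm_minus_commute)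
qed (simp add: lift_def)

lemma lift_inside:
  assumes "0 < R" "2 * s \<le> R" "R \<le> r0" "x \<in> coord_ball s"
  shows "lift R x = 1"
proof -
  have s: "s \<le> r0" using assms by linarith
  have "x \<in> chart_dom c" "coord c x \<in> cball y0 s"
    using coord_ball_dom [OF s] coord_coord_ball [OF s] assms(4) by blast+
  then show ?thesis
    using assms bump_inside(1) [of R "coord c x" y0] by (simp add: lift_def dist_norm norm_minus_commute)
qed

lemma lift_bounds: "0 \<le> lift R x" "lift R x \<le> 1"
  using bump_bounds [of y0 R "coord c x"] by (simp_all add: lift_def)

text \<open>Continuity is glued over two open sets, the chart domain and the complement of the
  coordinate ball; the latter is open since a compact set in a Hausdorff space is closed.\<close>

lemma lift_continuous:
  assumes "0 < R" "R \<le> r0"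
  shows "continuous_on UNIV (lift R)"
proof -
  have "continuous_on (chart_dom c) (\<lambda>x. bump y0 R (coord c x))"
    by (rule continuous_on_compose2 [OF C1_on_continuous [OF C1_bump] continuous_coord [OF c] subset_UNIV])
  then have 1: "continuous_on (chart_dom c) (lift R)"
    by (rule continuous_on_eq) (simp add: lift_def)
  have "continuous_on (- coord_ball R) (\<lambda>x. 0::real)"
    by simp
  then have 2: "continuous_on (- coord_ball R) (lift R)"
    by (rule continuous_on_eq) (simp add: lift_outside assms)
  have "open (- coord_ball R)"
    using compact_coord_ball [OF assms(2)] by (simp add: compact_imp_closed open_Compl)
  moreover have "chart_dom c \<union> - coord_ball R = UNIV"
    using coord_ball_dom [OF assms(2)] by blast
  ultimately show ?thesis
    using continuous_on_open_Un [OF open_dom [OF c] _ 1 2] by simp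
qed

lemma lift_support: "0 < R \<Longrightarrow> R \<le> r0 \<Longrightarrow> compact (closure {x. lift R x \<noteq> 0})"
proof -
  assume R: "0 < R" "R \<le> r0"
  have "{x. lift R x \<noteq> 0} \<subseteq> coord_ball R"
    using lift_outside [OF R] by blast
  then have "closure {x. lift R x \<noteq> 0} \<subseteq> coord_ball R"
    using compact_coord_ball [OF R(2)] compact_imp_closed closure_minimal by blast
  then show ?thesis
    using compact_coord_ball [OF R(2)] by (metis closed_Int_compact closed_closure inf.absorb1)
qed

text \<open>Regularity of \<open>f\<close> inside the chart suffices, because \<open>lift R\<close>
  vanishes elsewhere. The right-hand side has the shape of \<open>mass\<close>.\<close>

lemma lift_integral:
  fixes f :: "'m \<Rightarrow> real"
  assumes R: "0 < R" "R \<le> r0" and f: "continuous_on (chart_range c) (\<lambda>y. f (chart_inv c y))"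
  shows "(\<integral>x. lift R x * f x \<partial>volume M) = integral Q (\<lambda>y. vol_density M c y * bump y0 R y * f (chart_inv c y))"
    and "integrable (volume M) (\<lambda>x. lift R x * f x)"
proof -
  have d: "chart_dom c \<in> sets borel"
    using open_dom [OF c] by simp
  have "continuous_on (chart_dom c) (\<lambda>x. f (chart_inv c (coord c x)))"
    by (rule continuous_on_compose2 [OF f continuous_coord [OF c]]) (simp add: chart_range_def)
  then have "continuous_on (chart_dom c) f"
    by (rule continuous_on_eq) (simp add: c)
  then have "continuous_on (chart_dom c) (\<lambda>x. lift R x * f x)"
    using lift_continuous [OF R] by (intro continuous_on_mult) (auto intro: continuous_on_subset)
  from borel_measurable_continuous_on_indicator [OF d this]
  have "(\<lambda>x. indicator (chart_dom c) x *\<^sub>R (lift R x * f x)) \<in> borel_measurable borel" .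
  also have "(\<lambda>x. indicator (chart_dom c) x *\<^sub>R (lift R x * f x)) = (\<lambda>x. lift R x * f x)"
    by (auto simp: lift_def indicator_def fun_eq_iff)
  finally have m: "(\<lambda>x. lift R x * f x) \<in> borel_measurable borel" .
  let ?g = "\<lambda>y. indicator (chart_range c) y * vol_density M c y * (lift R (chart_inv c y) * f (chart_inv c y))"
  have g: "?g y = vol_density M c y * bump y0 R y * f (chart_inv c y)" if "y \<in> Q" for y
    using that box_subset c by (auto simp: lift_def subset_iff)
  have cont: "continuous_on Q (\<lambda>y. vol_density M c y * bump y0 R y * f (chart_inv c y))"
    by (intro continuous_on_mult continuous_on_subset [OF _ box_subset] C1_on_continuous \<rho>_C1 C1_bump f)
  then have gc: "continuous_on Q ?g"
    by (rule continuous_on_eq) (simp add: g)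
  have out: "?g y = 0" if "y \<notin> Q" for y
  proof (cases "y \<in> chart_range c")
    case True
    have "y \<notin> cball y0 R" using that cball_subset_Q [OF R(2)] by blast
    then have "bump y0 R y = 0"
      using R bump_outside(1) [of R y y0] by (simp add: dist_norm norm_minus_commute)
    then show ?thesis using True c by (simp add: lift_def)
  qed simp
  show "(\<integral>x. lift R x * f x \<partial>volume M) = integral Q (\<lambda>y. vol_density M c y * bump y0 R y * f (chart_inv c y))"
  proof -
    have "(\<integral>x. lift R x * f x \<partial>volume M) = integral Q ?g"
      using integral_volume_chart(1) [OF c m] integral_lborel_compact_support [OF gc out]
      by (simp add: lift_def)
    also have "\<dots> = integral Q (\<lambda>y. vol_density M c y * bump y0 R y * f (chart_inv c y))"
      by (rule integral_cong) (rule g)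
    finally show ?thesis .
  qed
  have "integrable lborel (\<lambda>y. indicator Q y *\<^sub>R ?g y)"
    using gc by (intro borel_integrable_compact compact_cbox)
  also have "(\<lambda>y. indicator Q y *\<^sub>R ?g y) = ?g"
    using out by (auto simp: indicator_def fun_eq_iff)
  finally show "integrable (volume M) (\<lambda>x. lift R x * f x)"
    using integral_volume_chart(2) [OF c m] by (simp add: lift_def)
qed

text \<open>Multiplying the equation by the volume density cancels the division in
  \<open>laplace_beltrami\<close> and leaves pure divergence form.\<close>

lemma solution_local:
  assumes sol: "is_solution M p u0 T u"
  shows "local_solution T (\<lambda>t y. u (chart_inv c y) t) (\<lambda>t y. deriv (u (chart_inv c y)) t)"
proof -
  let ?W = "chart_range c"
  have C21: "(\<forall>t\<in>{0<..<T}. Ck_on 2 (\<lambda>y. u (chart_inv c y) t) ?W)"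
    "(\<forall>y\<in>?W. \<forall>t\<in>{0<..<T}. u (chart_inv c y) differentiable at t)"
    "continuous_on (?W \<times> {0<..<T}) (\<lambda>(y, t). u (chart_inv c y) t)"
    "continuous_on (?W \<times> {0<..<T}) (\<lambda>(y, t). deriv (u (chart_inv c y)) t)"
    using sol c unfolding is_solution_def C21_on_def Let_def by auto
  have swap: "continuous_on ({0<..<T} \<times> ?W) (\<lambda>(t, y). F y t)"
    if "continuous_on (?W \<times> {0<..<T}) (\<lambda>(y, t). F y t)" for F :: "_ \<Rightarrow> _ \<Rightarrow> real"
  proof -
    have "continuous_on ({0<..<T} \<times> ?W) (\<lambda>z. (snd z, fst z))"
      by (intro continuous_intros)
    from continuous_on_compose2 [OF that this]
    have "continuous_on ({0<..<T} \<times> ?W) (\<lambda>z. case (snd z, fst z) of (y, t) \<Rightarrow> F y t)"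
      by fastforce
    then show ?thesis
      by (simp add: case_prod_beta)
  qed
  show ?thesis
    unfolding local_solution_def
  proof (intro conjI ballI allI)
    fix t y assume t: "t \<in> {0<..<T}" and y: "y \<in> ?W"
    show "0 \<le> u (chart_inv c y) t"
      using sol t unfolding is_solution_def by blast
    show "((\<lambda>t. u (chart_inv c y) t) has_real_derivative deriv (u (chart_inv c y)) t) (at t)"
      using C21(2) t y DERIV_deriv_iff_real_differentiable by blast
    have "deriv (u (chart_inv c y)) t - laplace_beltrami M c (\<lambda>z. u z t) (chart_inv c y) = u (chart_inv c y) t powr p"
      using sol t y c chart_inv_in [OF c y] unfolding is_solution_def by blast
    then have "deriv (u (chart_inv c y)) t = laplace_beltrami M c (\<lambda>z. u z t) (chart_inv c y) + u (chart_inv c y) t powr p"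
      by linarith
    then have "vol_density M c y * deriv (u (chart_inv c y)) t
       = vol_density M c y * laplace_beltrami M c (\<lambda>z. u z t) (chart_inv c y) + vol_density M c y * u (chart_inv c y) t powr p"
      by (simp only: distrib_left)
    moreover have "vol_density M c y * laplace_beltrami M c (\<lambda>z. u z t) (chart_inv c y)
      = (\<Sum>i\<in>UNIV. pd i (\<lambda>y. \<Sum>j\<in>UNIV. vol_density M c y * metric_inv M c y $ i $ j * pd j (\<lambda>y. u (chart_inv c y) t) y) y)"
      (is "_ = ?S")
    proof -
      have "laplace_beltrami M c (\<lambda>z. u z t) (chart_inv c y) = ?S / vol_density M c y"
        using c y by (simp add: laplace_beltrami_def o_def sum_distrib_left mult.assoc)
      then show ?thesis
        using vol_density_pos [OF c y] by simp
    qed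
    ultimately show "vol_density M c y * deriv (u (chart_inv c y)) t
      = (\<Sum>i\<in>UNIV. pd i (\<lambda>y. \<Sum>j\<in>UNIV. vol_density M c y * metric_inv M c y $ i $ j * pd j (\<lambda>y. u (chart_inv c y) t) y) y)
        + vol_density M c y * u (chart_inv c y) t powr p"
      by simp
  next
    fix t assume t: "t \<in> {0<..<T}"
    then have C2: "Ck_on (Suc (Suc 0)) (\<lambda>y. u (chart_inv c y) t) ?W"
      using C21(1) by (simp add: numeral_2_eq_2)
    show "C1_on (\<lambda>y. u (chart_inv c y) t) ?W"
      by (rule Ck_on_imp_C1_on [OF W C2])
    show "C1_on (pd j (\<lambda>y. u (chart_inv c y) t)) ?W" for j
      using C2 by (intro Ck_on_imp_C1_on [OF W, where k = 0]) simp
  qed (use swap C21 in blast)+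
qed

text \<open>\<open>lift R\<close> is an admissible function in the weak initial condition, and for t
  > 0 its pairing with the solution is the coordinate mass.\<close>

lemma mass_tendsto:
  assumes sol: "is_solution M p u0 T u" and T: "T > 0" and R: "0 < R" "R \<le> r0"
  shows "(mass (\<lambda>t y. u (chart_inv c y) t) R \<longlongrightarrow> (\<integral>x. lift R x * u0 x \<partial>volume M)) (at_right 0)"
proof (rule Lim_transform_eventually)
  show "((\<lambda>t. \<integral>x. lift R x * u x t \<partial>volume M) \<longlongrightarrow> (\<integral>x. lift R x * u0 x \<partial>volume M)) (at_right 0)"
    using sol lift_continuous [OF R] lift_support [OF R] unfolding is_solution_def by blast
  have "(\<integral>x. lift R x * u x t \<partial>volume M) = mass (\<lambda>t y. u (chart_inv c y) t) R t" if "t \<in> {0<..<T}" for t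
  proof -
    have "C1_on (\<lambda>y. u (chart_inv c y) t) (chart_range c)"
      using solution_local [OF sol] that unfolding local_solution_def by blast
    from lift_integral(1) [OF R C1_on_continuous [OF this]] show ?thesis
      by (simp add: mass_def)
  qed
  then show "\<forall>\<^sub>F t in at_right 0. (\<integral>x. lift R x * u x t \<partial>volume M) = mass (\<lambda>t y. u (chart_inv c y) t) R t"
    using T unfolding eventually_at_right_field by (intro exI [of _ T]) auto
qed

end

lemma box_neighbourhood:
  fixes y0 :: "real^'n::finite"
  assumes "open W" "y0 \<in> W"
  obtains r where "0 < r" "r \<le> 1" "cbox (\<chi> i. y0 $ i - r) (\<chi> i. y0 $ i + r) \<subseteq> W"
proof -
  obtain e where e: "e > 0" "ball y0 e \<subseteq> W"
    using assms open_contains_ball by blast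
  \<comment> \<open>In the box the norm is at most the sum of N coordinate differences, hence at
    most N r, which this choice keeps below \<open>e\<close>.\<close>
  define r where "r = min 1 (e / (2 * real CARD('n)))"
  have N: "0 < real CARD('n)" by simp
  have r: "0 < r" "r \<le> 1" "real CARD('n) * r \<le> e / 2"
  proof -
    show "0 < r" "r \<le> 1" using e by (auto simp: r_def)
    have "real CARD('n) * r \<le> real CARD('n) * (e / (2 * real CARD('n)))"
      by (intro mult_left_mono) (auto simp: r_def)
    also have "\<dots> = e / 2" by simp
    finally show "real CARD('n) * r \<le> e / 2" .
  qed
  show ?thesis
  proof (rule that [OF r(1,2)])
    show "cbox (\<chi> i. y0 $ i - r) (\<chi> i. y0 $ i + r) \<subseteq> W"
    proof
      fix y assume y: "y \<in> cbox (\<chi> i. y0 $ i - r) (\<chi> i. y0 $ i + r)"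
      have "norm (y - y0) \<le> (\<Sum>i\<in>UNIV. \<bar>(y - y0) $ i\<bar>)"
        by (rule norm_le_l1_cart)
      also have "\<dots> \<le> (\<Sum>i\<in>(UNIV::'n set). r)"
      proof (rule sum_mono)
        fix i
        show "\<bar>(y - y0) $ i\<bar> \<le> r"
          using y by (auto simp: mem_box_cart abs_le_iff algebra_simps)
      qed
      also have "\<dots> < e" using r e by simp
      finally show "y \<in> W"
        using e by (auto simp: dist_norm norm_minus_commute subset_iff)
    qed
  qed
qed

section \<open>Initial data built from shrinking coordinate balls\<close>

context riemannian
begin

text \<open>A globally finite integral bounds the integral over every ball, so one estimate serves
  all radii, including infinite ones.\<close>

lemma Lq_ulocI:
  assumes m: "f \<in> borel_measurable borel" and fin: "(\<integral>\<^sup>+x. ennreal (\<bar>f x\<bar> powr q) \<partial>volume M) < \<infinity>" and q: "q > 0"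
  shows "f \<in> Lq_uloc M q \<rho>"
proof -
  let ?S = "\<integral>\<^sup>+x. ennreal (\<bar>f x\<bar> powr q) \<partial>volume M"
  have le: "(\<integral>\<^sup>+x\<in>A. ennreal (\<bar>f x\<bar> powr q) \<partial>volume M) \<le> ?S" for A
    by (intro nn_integral_mono) (auto simp: indicator_def)
  have "uloc_norm M q \<rho> f \<le> ennreal (enn2real ?S powr (1 / q))"
    unfolding uloc_norm_def
  proof (rule SUP_least)
    fix z
    let ?I = "\<integral>\<^sup>+x\<in>rball M z \<rho>. ennreal (\<bar>f x\<bar> powr q) \<partial>volume M"
    have fI: "?I < \<infinity>" using le fin by (rule le_less_trans)
    have "enn2real ?I \<le> enn2real ?S"
      using le fin by (intro enn2real_mono) auto
    then have "enn2real ?I powr (1 / q) \<le> enn2real ?S powr (1 / q)"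
      using q by (intro powr_mono2) auto
    then show "ennreal_root q ?I \<le> ennreal (enn2real ?S powr (1 / q))"
      using fI by (auto simp: ennreal_root_def intro: ennreal_leI)
  qed
  then have "uloc_norm M q \<rho> f < \<infinity>"
    by (rule le_less_trans) simp
  moreover have "f \<in> Lq_loc M q"
    unfolding Lq_loc_def using m le fin
    by (auto simp: measurable_cong_sets [OF sets_volume refl] intro: le_less_trans)
  ultimately show ?thesis
    by (simp add: Lq_uloc_def)
qed

end

context chart_problem
begin

text \<open>Working with the \<open>q\<close>-th power in \<open>[0, \<infinity>]\<close> avoids Minkowski's inequality and any
  discussion of the single point where the series may diverge.\<close>

lemma initial_datum_exists:
  fixes b s :: "nat \<Rightarrow> real" and q :: real
  assumes q: "1 \<le> q" and s: "\<And>i. 0 < s i" "\<And>i. s i \<le> r0" and b: "\<And>i. 0 \<le> b i"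
    and sm: "summable (\<lambda>i. b i powr q * s i ^ CARD('n))"
  shows "\<exists>u0 \<delta>. (\<forall>x. 0 \<le> u0 x) \<and> (\<forall>\<rho>. u0 \<in> Lq_uloc M q \<rho>) \<and> \<delta> > 0 \<and>
    (\<forall>R. 0 \<le> (\<integral>x. lift R x * u0 x \<partial>volume M)) \<and>
    (\<forall>i R. 2 * s i \<le> R \<and> R \<le> r0 \<longrightarrow> \<delta> * (b i * s i ^ CARD('n)) \<le> (\<integral>x. lift R x * u0 x \<partial>volume M))"
proof -
  obtain \<rho>0 where \<rho>0: "\<rho>0 > 0" "\<And>y. y \<in> Q \<Longrightarrow> \<rho>0 \<le> vol_density M c y"
    using \<rho>_lower_bound by blast
  obtain \<rho>1 where \<rho>1: "\<rho>1 > 0" "\<And>y. y \<in> Q \<Longrightarrow> \<bar>vol_density M c y\<bar> \<le> \<rho>1"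
    using bounded_on_Q [OF C1_on_continuous [OF \<rho>_C1]] by blast
  define V where "V = unit_ball_vol (real CARD('n))"
  have V: "V > 0" by (simp add: V_def)
  define A where "A = (\<lambda>i. coord_ball (s i))"
  have mA: "A i \<in> sets borel" for i
    unfolding A_def by (rule borel_coord_ball [OF s(2)])
  have ball: "emeasure lborel (cball y0 (s i)) = ennreal (V * s i ^ CARD('n))" for i
    using emeasure_cball [of "s i" y0] s(1) [of i] by (simp add: V_def)
  have volA: "emeasure (volume M) (A i) = (\<integral>\<^sup>+y\<in>cball y0 (s i). ennreal (vol_density M c y) \<partial>lborel)" for i
    using emeasure_volume [OF c borel_coord_ball [OF s(2)] coord_ball_dom [OF s(2)]]
    by (simp add: chart_vol_def A_def coord_coord_ball [OF s(2)])
  have upper: "emeasure (volume M) (A i) \<le> ennreal (\<rho>1 * (V * s i ^ CARD('n)))" for i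
  proof -
    have "emeasure (volume M) (A i) \<le> (\<integral>\<^sup>+y. ennreal \<rho>1 * indicator (cball y0 (s i)) y \<partial>lborel)"
      unfolding volA
    proof (rule nn_integral_mono)
      fix y
      show "ennreal (vol_density M c y) * indicator (cball y0 (s i)) y \<le> ennreal \<rho>1 * indicator (cball y0 (s i)) y"
      proof (cases "y \<in> cball y0 (s i)")
        case True
        then have "y \<in> Q" using cball_subset_Q [OF s(2)] by blast
        from \<rho>1(2) [OF this] show ?thesis using True by (auto intro: ennreal_leI)
      qed simp
    qed
    also have "\<dots> = ennreal (\<rho>1 * (V * s i ^ CARD('n)))"
      using \<rho>1 by (simp add: nn_integral_cmult_indicator ball ennreal_mult')
    finally show ?thesis .
  qed
  have lower: "ennreal (\<rho>0 * (V * s i ^ CARD('n))) \<le> emeasure (volume M) (A i)" for i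
  proof -
    have "ennreal (\<rho>0 * (V * s i ^ CARD('n))) = (\<integral>\<^sup>+y. ennreal \<rho>0 * indicator (cball y0 (s i)) y \<partial>lborel)"
      using \<rho>0 by (simp add: nn_integral_cmult_indicator ball ennreal_mult')
    also have "\<dots> \<le> emeasure (volume M) (A i)"
      unfolding volA
    proof (rule nn_integral_mono)
      fix y
      show "ennreal \<rho>0 * indicator (cball y0 (s i)) y \<le> ennreal (vol_density M c y) * indicator (cball y0 (s i)) y"
      proof (cases "y \<in> cball y0 (s i)")
        case True
        then have "y \<in> Q" using cball_subset_Q [OF s(2)] by blast
        from \<rho>0(2) [OF this] show ?thesis using True by (auto intro: ennreal_leI)
      qed simp
    qed
    finally show ?thesis .
  qed
  \<comment> \<open>The q-th power of the datum: heights b_i^q on the nested or repeated balls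
    simply add, so integrability of \<open>U\<close> is the assumed summability.\<close>
  define U where "U = (\<lambda>x. \<Sum>i. ennreal (b i powr q) * indicator (A i) x)"
  define g where "g = (\<lambda>x. enn2real (U x))"
  define u0 where "u0 = (\<lambda>x. g x powr (1 / q))"
  have mterm: "(\<lambda>x. ennreal (b i powr q) * indicator (A i) x) \<in> borel_measurable borel" for i
    by (intro borel_measurable_times_ennreal measurable_const borel_measurable_indicator mA) simp
  have mU [measurable]: "U \<in> borel_measurable borel"
    unfolding U_def by (rule borel_measurable_suminf_order [OF mterm])
  have mg [measurable]: "g \<in> borel_measurable borel"
    unfolding g_def by measurable
  have mu0 [measurable]: "u0 \<in> borel_measurable borel"
    unfolding u0_def by measurable
  have "(\<integral>\<^sup>+x. U x \<partial>volume M) = (\<Sum>i. \<integral>\<^sup>+x. ennreal (b i powr q) * indicator (A i) x \<partial>volume M)"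
    unfolding U_def
    by (rule nn_integral_suminf) (use mterm in \<open>simp only: measurable_cong_sets [OF sets_volume refl]\<close>)
  also have "\<dots> = (\<Sum>i. ennreal (b i powr q) * emeasure (volume M) (A i))"
    by (simp add: nn_integral_cmult_indicator mA)
  also have "\<dots> \<le> (\<Sum>i. ennreal (\<rho>1 * V * (b i powr q * s i ^ CARD('n))))"
  proof (rule suminf_le)
    fix i
    have "ennreal (b i powr q) * emeasure (volume M) (A i) \<le> ennreal (b i powr q) * ennreal (\<rho>1 * (V * s i ^ CARD('n)))"
      using upper by (intro mult_left_mono) auto
    also have "\<dots> = ennreal (\<rho>1 * V * (b i powr q * s i ^ CARD('n)))"
      by (subst ennreal_mult' [symmetric]) (auto simp: mult_ac)
    finally show "ennreal (b i powr q) * emeasure (volume M) (A i) \<le> ennreal (\<rho>1 * V * (b i powr q * s i ^ CARD('n)))" .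
  qed auto
  also have "\<dots> = ennreal (\<Sum>i. \<rho>1 * V * (b i powr q * s i ^ CARD('n)))"
  proof (rule suminf_ennreal2)
    show "0 \<le> \<rho>1 * V * (b i powr q * s i ^ CARD('n))" for i
      using \<rho>1(1) V s(1) [of i] by simp
    show "summable (\<lambda>i. \<rho>1 * V * (b i powr q * s i ^ CARD('n)))"
      by (rule summable_mult [OF sm])
  qed
  also have "\<dots> < \<infinity>" by simp
  finally have Ufin: "(\<integral>\<^sup>+x. U x \<partial>volume M) < \<infinity>" .
  have mU' [measurable]: "U \<in> borel_measurable (volume M)" and mg' [measurable]: "g \<in> borel_measurable (volume M)"
    and mu0' [measurable]: "u0 \<in> borel_measurable (volume M)"
    using mU mg mu0 by (simp_all add: measurable_cong_sets [OF sets_volume refl])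
  have AEfin: "AE x in volume M. U x \<noteq> \<infinity>"
    using Ufin by (intro nn_integral_PInf_AE mU') auto
  have g0: "g x \<ge> 0" for x by (simp add: g_def)
  have uq: "\<bar>u0 x\<bar> powr q = g x" for x
    using q g0 [of x] by (simp add: u0_def powr_powr)
  have gU: "ennreal (g x) \<le> U x" for x
    unfolding g_def by (cases "U x") auto
  have gfin: "(\<integral>\<^sup>+x. ennreal (g x) \<partial>volume M) < \<infinity>"
    using nn_integral_mono [of "volume M" "\<lambda>x. ennreal (g x)" U] gU Ufin by (blast intro: le_less_trans)
  have gint: "integrable (volume M) g"
    using gfin g0 by (intro integrableI_nonneg) auto
  \<comment> \<open>This turns integrability of the q-th power into integrability of the datum
    against the bounded, integrable function \<open>lift R\<close>.\<close>
  have u0g: "u0 x \<le> 1 + g x" for x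
  proof (cases "g x \<le> 1")
    case True
    then have "u0 x \<le> 1" using q g0 [of x] by (auto simp: u0_def intro: powr_le1)
    then show ?thesis using g0 [of x] by simp
  next
    case False
    then have "u0 x \<le> g x powr 1" unfolding u0_def using q by (intro powr_mono) auto
    then show ?thesis using g0 [of x] by simp
  qed
  have u00: "0 \<le> u0 x" for x by (simp add: u0_def)
  \<comment> \<open>Where \<open>U\<close> is infinite, \<open>enn2real\<close> returns 0 and the
    lower bound could fail; such points form a null set.\<close>
  have big: "AE x in volume M. \<forall>i. x \<in> A i \<longrightarrow> b i \<le> u0 x"
    using AEfin
  proof (rule AE_mp, intro AE_I2 impI allI)
    fix x i assume fin: "U x \<noteq> \<infinity>" and x: "x \<in> A i"
    have "ennreal (b i powr q) * indicator (A i) x \<le> U x"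
    proof -
      define f where "f = (\<lambda>i. ennreal (b i powr q) * indicator (A i) x)"
      have "sum f {i} \<le> suminf f"
        by (rule sum_le_suminf) auto
      then show ?thesis
        by (simp add: U_def flip: f_def)
         (simp add: f_def)
    qed
    then have "ennreal (b i powr q) \<le> U x"
      using x by simp
    then have "b i powr q \<le> g x"
      unfolding g_def using fin enn2real_mono [of "ennreal (b i powr q)" "U x"] by (auto simp: less_top)
    then have "(b i powr q) powr (1 / q) \<le> u0 x"
      unfolding u0_def using q by (intro powr_mono2) auto
    then show "b i \<le> u0 x"
      using q b [of i] by (simp add: powr_powr)
  qed
  show ?thesis
  proof (intro exI [of _ u0] exI [of _ "\<rho>0 * V"] conjI allI impI)
    show "0 \<le> u0 x" for x by (rule u00)
    show "u0 \<in> Lq_uloc M q \<rho>" for \<rho>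
      using gfin q by (intro Lq_ulocI mu0) (simp_all add: uq)
    show "\<rho>0 * V > 0" using \<rho>0 V by simp
    show "0 \<le> (\<integral>x. lift R x * u0 x \<partial>volume M)" for R
      using u00 lift_bounds(1) by (intro integral_nonneg_AE) auto
    fix i R assume "2 * s i \<le> R \<and> R \<le> r0"
    then have R: "2 * s i \<le> R" "R \<le> r0" by simp_all
    then have R0: "0 < R" using s(1) [of i] by linarith
    have mlift [measurable]: "lift R \<in> borel_measurable (volume M)"
      using borel_measurable_continuous_onI [OF lift_continuous [OF R0 R(2)]]
      by (simp add: measurable_cong_sets [OF sets_volume refl])
    have lint: "integrable (volume M) (lift R)"
      using lift_integral(2) [OF R0 R(2), of "\<lambda>x. 1"] by simp
    have int: "integrable (volume M) (\<lambda>x. lift R x * u0 x)"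
    proof (rule Bochner_Integration.integrable_bound [OF Bochner_Integration.integrable_add [OF lint gint]])
      show "AE x in volume M. norm (lift R x * u0 x) \<le> norm (lift R x + g x)"
      proof (rule AE_I2)
        fix x
        have "lift R x * u0 x \<le> lift R x * (1 + g x)"
          using u0g lift_bounds(1) by (intro mult_left_mono)
        also have "\<dots> \<le> lift R x + g x"
          using lift_bounds [of R x] g0 [of x] by (simp add: distrib_left mult_left_le_one_le)
        finally show "norm (lift R x * u0 x) \<le> norm (lift R x + g x)"
          using lift_bounds [of R x] u00 [of x] g0 [of x] by simp
      qed
    qed measurable
    have Ai: "A i \<in> sets (volume M)" "emeasure (volume M) (A i) < \<infinity>"
      using upper [of i] mA by (auto intro: le_less_trans)
    have "emeasure (volume M) (A i) = ennreal (measure (volume M) (A i))"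
      using Ai(2) by (intro emeasure_eq_ennreal_measure) auto
    with lower [of i] have "\<rho>0 * (V * s i ^ CARD('n)) \<le> measure (volume M) (A i)"
      by simp
    from mult_left_mono [OF this b [of i]]
    have "\<rho>0 * V * (b i * s i ^ CARD('n)) \<le> b i * measure (volume M) (A i)"
      by (simp add: mult_ac)
    also have "\<dots> = (\<integral>x. b i * indicator (A i) x \<partial>volume M)"
      using Ai by simp
    also have "\<dots> \<le> (\<integral>x. lift R x * u0 x \<partial>volume M)"
    proof (rule integral_mono_AE [OF _ int])
      show "integrable (volume M) (\<lambda>x. b i * indicator (A i) x)"
        using Ai by (intro integrable_mult_right integrable_real_indicator)
      show "AE x in volume M. b i * indicator (A i) x \<le> lift R x * u0 x"
        using big
      proof (rule AE_mp, intro AE_I2 impI)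
        fix x assume *: "\<forall>i. x \<in> A i \<longrightarrow> b i \<le> u0 x"
        show "b i * indicator (A i) x \<le> lift R x * u0 x"
        proof (cases "x \<in> A i")
          case True
          then have "lift R x = 1"
            using lift_inside [OF R0 R] by (simp add: A_def)
          then show ?thesis using True * by simp
        qed (use u00 lift_bounds(1) in simp)
      qed
    qed
    finally show "\<rho>0 * V * (b i * s i ^ CARD('n)) \<le> (\<integral>x. lift R x * u0 x \<partial>volume M)" .
  qed
qed

end

section \<open>Contradiction with the mass bounds in the two cases\<close>

context chart_problem
begin

text \<open>Heights s_i^(-a) on dyadic balls imitate the power |y - y0|^(-a). The mass at scale s is
  then at least a multiple of s^(N-a), while a solution would force it below a multiple of
  s^(N-2/(p-1)); this is impossible for small s because a > 2/(p-1).\<close>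

lemma supercritical_nonexistence:
  assumes p: "p > p_Fujita CARD('n)" and q: "1 \<le> q" "q < real CARD('n) * (p - 1) / 2"
  shows "\<exists>u0. (\<forall>x. 0 \<le> u0 x) \<and> (\<forall>\<rho>. u0 \<in> Lq_uloc M q \<rho>) \<and> (\<forall>T>0. \<not> (\<exists>u. is_solution M p u0 T u))"
proof -
  let ?N = "real CARD('n)"
  have p1: "p - 1 > 0" using p_gt_1 by simp
  have "2 / (p - 1) < ?N / q"
    using q p1 by (simp add: field_simps)
  then obtain a where a: "2 / (p - 1) < a" "a < ?N / q"
    using dense by blast
  have a0: "a > 0" using a(1) p1 by (smt (verit) divide_pos_pos)
  \<comment> \<open>The exponent \<open>Suc i\<close> leaves room for the test radius 2 s_i, which
    must not exceed \<open>r0\<close>.\<close>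
  define s where "s = (\<lambda>i::nat. r0 / 2 ^ Suc i)"
  have s0: "0 < s i" "s i \<le> r0" for i
  proof -
    show "0 < s i" using r0 by (simp add: s_def)
    have "r0 / 2 ^ Suc i \<le> r0 / 1" using r0 by (intro divide_left_mono) (auto simp del: power_Suc)
    then show "s i \<le> r0" by (simp add: s_def)
  qed
  define b where "b = (\<lambda>i. s i powr (- a))"
  have spow: "s i powr x = (r0 / 2) powr x * ((1 / 2) powr x) ^ i" for i x
  proof -
    have "s i = (r0 / 2) * (1 / 2) ^ i" by (simp add: s_def power_divide)
    then have "s i powr x = (r0 / 2) powr x * ((1 / 2) ^ i) powr x"
      using r0 by (simp only: powr_mult)
    also have "((1 / 2 :: real) ^ i) powr x = ((1 / 2) powr x) ^ i"
      by (simp add: powr_powr mult.commute flip: powr_realpow)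
    finally show ?thesis .
  qed
  have "?N - a * q > 0" using a(2) q by (simp add: field_simps)
  then have "((1::real) / 2) powr (?N - a * q) < 1"
    using powr_less_mono' [of "1 / 2" 0 "?N - a * q"] by simp
  then have "summable (\<lambda>i. (r0 / 2) powr (?N - a * q) * ((1 / 2) powr (?N - a * q)) ^ i)"
    by (intro summable_mult summable_geometric) simp
  moreover have "b i powr q * s i ^ CARD('n) = (r0 / 2) powr (?N - a * q) * ((1 / 2) powr (?N - a * q)) ^ i" for i
  proof -
    have "b i powr q * s i ^ CARD('n) = s i powr (?N - a * q)"
      using s0(1) [of i] by (simp add: b_def powr_powr powr_add [symmetric] flip: powr_realpow)
    then show ?thesis by (simp only: spow)
  qed
  ultimately have sm: "summable (\<lambda>i. b i powr q * s i ^ CARD('n))"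
    by simp
  have b0: "0 \<le> b i" for i by (simp add: b_def)
  obtain u0 \<delta> where u0: "\<forall>x. 0 \<le> u0 x" "\<forall>\<rho>. u0 \<in> Lq_uloc M q \<rho>" and \<delta>: "\<delta> > 0"
    and low: "\<forall>i R. 2 * s i \<le> R \<and> R \<le> r0 \<longrightarrow> \<delta> * (b i * s i ^ CARD('n)) \<le> (\<integral>x. lift R x * u0 x \<partial>volume M)"
    using initial_datum_exists [OF q(1) s0 b0 sm] by (elim exE conjE)
  obtain C where C: "C > 0" and bound: "\<And>T w wt R n \<mu> I. local_solution T w wt \<Longrightarrow> 0 < R \<Longrightarrow> R \<le> r0 \<Longrightarrow> R\<^sup>2 < T \<Longrightarrow> \<mu> 0 = 1 \<Longrightarrow>
       (\<And>k. 0 \<le> \<mu> k) \<Longrightarrow> (\<And>k. k \<le> n \<Longrightarrow> (mass w (R / 2 ^ k) \<longlongrightarrow> I k) (at_right 0)) \<Longrightarrow>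
       (\<Sum>k\<le>n. \<mu> k * I k) \<le>
         C * (\<Sum>k\<le>n. \<mu> k powr (p / (p - 1)) * (R / 2 ^ k) powr (?N + 2 - 2 * (p / (p - 1))))"
    using mass_sum_bound by blast
  have False if T: "T > 0" and sol: "is_solution M p u0 T u" for T u
  proof -
    define e where "e = a - 2 / (p - 1)"
    have e: "e > 0" using a by (simp add: e_def)
    have exps: "?N + 2 - 2 * (p / (p - 1)) = ?N - 2 / (p - 1)"
      using p1 by (simp add: field_simps)
    have slim: "s \<longlonglongrightarrow> 0"
    proof -
      have "(\<lambda>i. (r0 / 2) * (1 / 2) ^ i) \<longlonglongrightarrow> (r0 / 2) * 0"
        by (intro tendsto_mult tendsto_const LIMSEQ_realpow_zero) auto
      then show ?thesis by (simp add: s_def [abs_def] power_divide)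
    qed
    have key: "\<delta> \<le> C * 2 powr (?N - 2 / (p - 1)) * s i powr e" if small: "(2 * s i)\<^sup>2 < T" for i
    proof -
      define R where "R = 2 * s i"
      have R: "0 < R" "R \<le> r0" "R\<^sup>2 < T" 
      proof -
        show "0 < R" "R\<^sup>2 < T" using s0(1) [of i] small by (simp_all add: R_def)
        have "r0 / 2 ^ i \<le> r0 / 1" using r0 by (intro divide_left_mono) auto
        then show "R \<le> r0" by (simp add: R_def s_def)
      qed
      \<comment> \<open>A single scale is enough here, so the dyadic bound is used with n =
        0.\<close>
      have "(\<Sum>k\<le>0. (\<lambda>_. 1::real) k * (\<lambda>k. \<integral>x. lift (R / 2 ^ k) x * u0 x \<partial>volume M) k)
         \<le> C * (\<Sum>k\<le>0. (\<lambda>_. 1::real) k powr (p / (p - 1)) * (R / 2 ^ k) powr (?N + 2 - 2 * (p / (p - 1))))"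
        by (rule bound [OF solution_local [OF sol] R]) (use mass_tendsto [OF sol T R(1,2)] in auto)
      then have "(\<integral>x. lift R x * u0 x \<partial>volume M) \<le> C * R powr (?N - 2 / (p - 1))"
        unfolding exps by simp
      with low R have "\<delta> * (b i * s i ^ CARD('n)) \<le> C * R powr (?N - 2 / (p - 1))"
        unfolding R_def by fastforce
      moreover have "b i * s i ^ CARD('n) = s i powr (?N - a)"
        using s0(1) [of i] by (simp add: b_def powr_add [symmetric] flip: powr_realpow)
      moreover have "R powr (?N - 2 / (p - 1)) = 2 powr (?N - 2 / (p - 1)) * (s i powr e * s i powr (?N - a))"
        using s0(1) [of i] by (simp add: R_def powr_mult powr_add [symmetric] e_def)
      ultimately have "\<delta> * s i powr (?N - a) \<le> (C * 2 powr (?N - 2 / (p - 1)) * s i powr e) * s i powr (?N - a)"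
        by (simp add: mult_ac)
      then show ?thesis
        using s0(1) [of i] by simp
    qed
    have "(\<lambda>i. (2 * s i)\<^sup>2) \<longlonglongrightarrow> (2 * 0)\<^sup>2"
      by (intro tendsto_intros slim)
    then have "\<forall>\<^sub>F i in sequentially. (2 * s i)\<^sup>2 < T"
      by (rule order_tendstoD(2)) (use T in simp)
    then have ev: "\<forall>\<^sub>F i in sequentially. \<delta> \<le> C * 2 powr (?N - 2 / (p - 1)) * s i powr e"
      by eventually_elim (rule key)
    have "(\<lambda>i. s i powr e) \<longlonglongrightarrow> 0"
      using slim s0 e by (intro tendsto_zero_powrI [OF slim tendsto_const]) (auto simp: less_imp_le)
    then have "(\<lambda>i. C * 2 powr (?N - 2 / (p - 1)) * s i powr e) \<longlonglongrightarrow> C * 2 powr (?N - 2 / (p - 1)) * 0"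
      by (intro tendsto_mult tendsto_const)
    from tendsto_lowerbound [OF this ev] show False
      using \<delta> by simp
  qed
  then show ?thesis
    using u0 by blast
qed

text \<open>If the masses of scales 0 to n are all at least \<theta>, a constant weight m on scales
  1 to n gives n m \<theta> \<le> C (1 + n m^p'). The choice of m makes the last term half of the
  left side, so n \<theta>^p stays bounded. The datum has \<theta> of order 2^(-i) on about 16^i
  scales, and p \<le> 3, so n \<theta>^p grows at least like 2^i.\<close>

lemma critical_nonexistence:
  assumes p: "p = p_Fujita CARD('n)"
  shows "\<exists>u0. (\<forall>x. 0 \<le> u0 x) \<and> (\<forall>\<rho>. u0 \<in> Lq_uloc M 1 \<rho>) \<and> (\<forall>T>0. \<not> (\<exists>u. is_solution M p u0 T u))"
proof -
  let ?N = "real CARD('n)"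
  have N1: "?N \<ge> 1" using one_le_card_finite by simp
  have pm1: "p - 1 = 2 / ?N" using p N1 by (simp add: p_Fujita_def field_simps)
  \<comment> \<open>p - 1 = 2/N and N \<ge> 1; the bound 2 later replaces the power p - 1 by a
    square, uniformly in N.\<close>
  have p2: "p - 1 > 0" "p - 1 \<le> 2"
    using p_gt_1 pm1 divide_left_mono [of 1 ?N 2] N1 by simp_all
  have exps: "?N + 2 - 2 * (p / (p - 1)) = 0"
  proof -
    have p_eq: "p = 1 + 2 / ?N" using pm1 by simp
    show ?thesis unfolding p_eq using N1 by (simp add: field_simps)
  qed
  \<comment> \<open>The base 16 beats the factor 8^i that is lost through \<theta>^3. The
    \<open>Suc\<close> makes 2 s_i equal to r0 / 2^(16^i), a dyadic radius.\<close>
  define s where "s = (\<lambda>i::nat. r0 / 2 ^ Suc (16 ^ i))"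
  have s0: "0 < s i" "s i \<le> r0" for i
  proof -
    show "0 < s i" using r0 by (simp add: s_def)
    have "r0 / 2 ^ Suc (16 ^ i) \<le> r0 / 1" using r0 by (intro divide_left_mono) (auto simp del: power_Suc)
    then show "s i \<le> r0" by (simp add: s_def)
  qed
  \<comment> \<open>Normalised so that the i-th ball carries mass comparable to 2^(-i), which is
    summable.\<close>
  define b where "b = (\<lambda>i. (1 / 2) ^ i / s i ^ CARD('n))"
  have b0: "0 \<le> b i" for i using s0(1) [of i] by (simp add: b_def)
  have bs: "b i * s i ^ CARD('n) = (1 / 2) ^ i" for i
    using s0(1) [of i] by (simp add: b_def)
  have sm: "summable (\<lambda>i. b i powr 1 * s i ^ CARD('n))"
    using b0 by (simp add: bs summable_geometric)
  obtain u0 \<delta> where u0: "\<forall>x. 0 \<le> u0 x" "\<forall>\<rho>. u0 \<in> Lq_uloc M 1 \<rho>" and \<delta>: "\<delta> > 0"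
    and nonneg: "\<forall>R. 0 \<le> (\<integral>x. lift R x * u0 x \<partial>volume M)"
    and low: "\<forall>i R. 2 * s i \<le> R \<and> R \<le> r0 \<longrightarrow> \<delta> * (b i * s i ^ CARD('n)) \<le> (\<integral>x. lift R x * u0 x \<partial>volume M)"
    using initial_datum_exists [OF order_refl s0 b0 sm] by (elim exE conjE)
  obtain C where C: "C > 0" and bound: "\<And>T w wt R n \<mu> I. local_solution T w wt \<Longrightarrow> 0 < R \<Longrightarrow> R \<le> r0 \<Longrightarrow> R\<^sup>2 < T \<Longrightarrow> \<mu> 0 = 1 \<Longrightarrow>
       (\<And>k. 0 \<le> \<mu> k) \<Longrightarrow> (\<And>k. k \<le> n \<Longrightarrow> (mass w (R / 2 ^ k) \<longlongrightarrow> I k) (at_right 0)) \<Longrightarrow>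
       (\<Sum>k\<le>n. \<mu> k * I k) \<le>
         C * (\<Sum>k\<le>n. \<mu> k powr (p / (p - 1)) * (R / 2 ^ k) powr (?N + 2 - 2 * (p / (p - 1))))"
    using mass_sum_bound by blast
  have False if T: "T > 0" and sol: "is_solution M p u0 T u" for T u
  proof -
    have "(\<lambda>k. (r0 * (1 / 2) ^ k)\<^sup>2) \<longlonglongrightarrow> (r0 * 0)\<^sup>2"
      by (intro tendsto_intros LIMSEQ_realpow_zero) auto
    then have "\<forall>\<^sub>F k in sequentially. (r0 * (1 / 2) ^ k)\<^sup>2 < T"
      by (rule order_tendstoD(2)) (use T in simp)
    \<comment> \<open>The lifetime T enters only through this starting scale; the datum was fixed
      before T.\<close>
    then obtain k0 :: nat where k0: "(r0 / 2 ^ k0)\<^sup>2 < T"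
      by (auto simp: eventually_sequentially power_divide)
    define R where "R = r0 / 2 ^ k0"
    have Rle: "R / 2 ^ k \<le> r0" "0 < R / 2 ^ k" for k
    proof -
      show "0 < R / 2 ^ k" using r0 by (simp add: R_def)
      have "r0 / 2 ^ (k0 + k) \<le> r0 / 1" using r0 by (intro divide_left_mono) auto
      then show "R / 2 ^ k \<le> r0" by (simp add: R_def power_add)
    qed
    have R: "0 < R" "R \<le> r0" "R\<^sup>2 < T"
      using Rle [of 0] k0 by (simp_all add: R_def)
    define L where "L = 8 * C ^ 3 / \<delta> ^ 3"
    have key: "(real (16 ^ i) - real k0) * (1 / 8) ^ i \<le> L"
      if i: "k0 \<le> 16 ^ i" "\<delta> * (1 / 2) ^ i \<le> 2 * C" for i
    proof -
      \<comment> \<open>The last scale R / 2^n is exactly 2 s_i, the smallest radius at which the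
        i-th ball lies in the plateau.\<close>
      define n where "n = 16 ^ i - k0"
      define \<theta> where "\<theta> = \<delta> * (1 / 2) ^ i"
      have \<theta>: "\<theta> > 0" using \<delta> by (simp add: \<theta>_def)
      \<comment> \<open>Since p' = 1 + 1/(p-1), this choice gives m^p' = m \<theta> / (2C), so the
        sum on the right is half absorbed by the left.\<close>
      define m where "m = (\<theta> / (2 * C)) powr (p - 1)"
      have m0: "m > 0" using \<theta> C by (simp add: m_def)
      define \<mu> where "\<mu> = (\<lambda>k::nat. if k = 0 then 1 else m)"
      define I where "I = (\<lambda>k. \<integral>x. lift (R / 2 ^ k) x * u0 x \<partial>volume M)"
      have I0: "I 0 \<ge> 0" unfolding I_def using nonneg by blast
      have Ik: "\<theta> \<le> I k" if "k \<le> n" for k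
      proof -
        have "k0 + k \<le> 16 ^ i" using that i unfolding n_def by linarith
        then have "r0 / 2 ^ (16 ^ i) \<le> r0 / 2 ^ (k0 + k)"
          using r0 by (intro divide_left_mono power_increasing) auto
        then have "2 * s i \<le> R / 2 ^ k"
          by (simp add: s_def R_def power_add)
        with low Rle(1) have "\<delta> * (b i * s i ^ CARD('n)) \<le> I k"
          unfolding I_def by blast
        then show ?thesis
          by (simp add: bs \<theta>_def)
      qed
      have "(\<Sum>k\<le>n. \<mu> k * I k) \<le> C * (\<Sum>k\<le>n. \<mu> k powr (p / (p - 1)) * (R / 2 ^ k) powr (?N + 2 - 2 * (p / (p - 1))))"
      proof (rule bound [OF solution_local [OF sol] R])
        show "(mass (\<lambda>t y. u (chart_inv c y) t) (R / 2 ^ k) \<longlongrightarrow> I k) (at_right 0)" for k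
          unfolding I_def by (rule mass_tendsto [OF sol T Rle(2) Rle(1)])
      qed (use m0 in \<open>auto simp: \<mu>_def\<close>)
      also have "\<dots> = C * (\<Sum>k\<le>n. \<mu> k powr (p / (p - 1)))"
        unfolding exps using R(1) by simp
      finally have ineq: "(\<Sum>k\<le>n. \<mu> k * I k) \<le> C * (\<Sum>k\<le>n. \<mu> k powr (p / (p - 1)))" .
      have split: "{..n} = insert 0 {1..n}" by auto
      have "real n * (m * \<theta>) = (\<Sum>k\<in>{1..n}. m * \<theta>)" by simp
      also have "\<dots> \<le> (\<Sum>k\<in>{1..n}. \<mu> k * I k)"
        using Ik m0 by (intro sum_mono) (auto simp: \<mu>_def)
      also have "\<dots> \<le> (\<Sum>k\<le>n. \<mu> k * I k)"
        unfolding split using I0 by (simp add: \<mu>_def)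
      also have "\<dots> \<le> C * (\<Sum>k\<le>n. \<mu> k powr (p / (p - 1)))" by (rule ineq)
      also have "(\<Sum>k\<le>n. \<mu> k powr (p / (p - 1))) = 1 + real n * m powr (p / (p - 1))"
        unfolding split by (simp add: \<mu>_def)
      also have "m powr (p / (p - 1)) = m * (\<theta> / (2 * C))"
      proof -
        have "m powr (p / (p - 1)) = m powr (1 + 1 / (p - 1))"
          using p2 by (simp add: field_simps)
        also have "\<dots> = m * m powr (1 / (p - 1))"
          using m0 by (simp add: powr_add)
        also have "m powr (1 / (p - 1)) = \<theta> / (2 * C)"
          using p2 \<theta> C by (simp add: m_def powr_powr)
        finally show ?thesis .
      qed
      finally have nm: "real n * (m * \<theta>) \<le> 2 * C"
        using C by (simp add: field_simps)
      \<comment> \<open>The base is at most 1 for the indices considered, so raising the exponent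
        from p - 1 to 2 only decreases the power.\<close>
      have m_ge: "(\<theta> / (2 * C))\<^sup>2 \<le> m"
      proof -
        have le1: "0 \<le> \<theta> / (2 * C)" "\<theta> / (2 * C) \<le> 1"
          using \<theta> C i(2) by (simp_all add: \<theta>_def)
        have "(\<theta> / (2 * C)) powr 2 \<le> (\<theta> / (2 * C)) powr (p - 1)"
          by (rule powr_mono' [OF p2(2) le1])
        then show ?thesis
          unfolding m_def using le1(1) by (simp only: powr_numeral)
      qed
      have "real n * ((\<theta> / (2 * C))\<^sup>2 * \<theta>) \<le> real n * (m * \<theta>)"
        by (rule mult_left_mono [OF mult_right_mono [OF m_ge]]) (use \<theta> in simp_all)
      also note nm
      finally have "real n * ((\<theta> / (2 * C))\<^sup>2 * \<theta>) \<le> 2 * C" .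
      then have "real n * \<theta> ^ 3 \<le> 8 * C ^ 3"
        using C by (simp add: field_simps power2_eq_square power3_eq_cube)
      moreover have "\<theta> ^ 3 = \<delta> ^ 3 * (1 / 8) ^ i"
      proof -
        have "((1 / 2 :: real) ^ i) ^ 3 = ((1 / 2) ^ 3) ^ i"
          by (simp only: power_mult [symmetric] mult.commute)
        then show ?thesis
          by (simp add: \<theta>_def power_mult_distrib power3_eq_cube)
      qed
      ultimately have "real n * (1 / 8) ^ i \<le> 8 * C ^ 3 / \<delta> ^ 3"
        using \<delta> by (simp add: field_simps)
      then show ?thesis
        using i by (simp add: n_def of_nat_diff L_def)
    qed
    have "(\<lambda>i. \<delta> * (1 / 2) ^ i) \<longlonglongrightarrow> \<delta> * 0"
      by (intro tendsto_mult tendsto_const LIMSEQ_realpow_zero) auto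
    then have ev1: "\<forall>\<^sub>F i in sequentially. \<delta> * (1 / 2) ^ i < 2 * C"
      by (rule order_tendstoD(2)) (use C in simp)
    have ev2: "\<forall>\<^sub>F i in sequentially. real k0 + L < real i"
      using filterlim_real_sequentially by (auto simp: filterlim_at_top_dense)
    obtain i where i: "\<delta> * (1 / 2) ^ i < 2 * C" "real k0 + L < real i"
      using eventually_happens' [OF _ eventually_conj [OF ev1 ev2]] by auto
    have "L \<ge> 0" using C \<delta> by (simp add: L_def)
    have i2: "real i < 2 ^ i" by (rule of_nat_less_two_power)
    have "k0 \<le> 16 ^ i"
    proof -
      have "real k0 \<le> 2 ^ i" using i i2 \<open>L \<ge> 0\<close> by linarith
      also have "\<dots> \<le> 16 ^ i" by (rule power_mono) auto
      finally show ?thesis by (metis of_nat_le_iff of_nat_numeral of_nat_power)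
    qed
    from key [OF this less_imp_le [OF i(1)]]
    have "16 ^ i * (1 / 8) ^ i - real k0 * (1 / 8) ^ i \<le> L"
      by (simp add: left_diff_distrib)
    moreover have "(16::real) ^ i * (1 / 8) ^ i = 2 ^ i"
      by (simp flip: power_mult_distrib)
    moreover have "real k0 * (1 / 8) ^ i \<le> real k0"
      by (simp add: mult_left_le power_le_one)
    ultimately show False
      using i i2 by linarith
  qed
  then show ?thesis
    using u0 by blast
qed

end

theorem corollary2p3:
  fixes M :: "('m::{t2_space, second_countable_topology}, 'n::finite) riemannian_structure"
    and \<kappa> p q :: real
  assumes "riemannian_manifold M"
    and "connected (UNIV :: 'm set)"
    and "complete_riemannian M"
    and "0 < inj_radius M"
    and "CARD('n) \<ge> 2 \<longrightarrow> 0 \<le> \<kappa> \<and> sec_bounded M \<kappa>"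
    and "(p > p_Fujita CARD('n) \<and> 1 \<le> q \<and> q < real CARD('n) * (p - 1) / 2) \<or>
         (p = p_Fujita CARD('n) \<and> q = 1)"
  shows "\<exists>u0 :: 'm \<Rightarrow> real. (\<forall>x. 0 \<le> u0 x) \<and> u0 \<in> Lq_uloc M q (rho_infty M \<kappa>) \<and>
           (\<forall>T>0. \<not> (\<exists>u. is_solution M p u0 T u))"
proof -
  interpret riemannian M
    by unfold_locales (rule assms(1))
  \<comment> \<open>\<open>undefined\<close> serves as an arbitrary point of M; its coordinates
    become the centre \<open>y0\<close>.\<close>
  obtain c where c: "c \<in> charts M" "undefined \<in> chart_dom c"
    using chart_cover by blast
  obtain r0 where r0: "0 < r0" "r0 \<le> 1"
    "cbox (\<chi> i. coord c undefined $ i - r0) (\<chi> i. coord c undefined $ i + r0) \<subseteq> chart_range c"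
    using box_neighbourhood [OF open_range [OF c(1)] coord_in [OF c(2)]] .
  have "p_Fujita CARD('n) > 1"
    by (simp add: p_Fujita_def field_simps)
  then have p1: "p > 1"
    using assms(6) by auto
  obtain K h h1 h2 where "cutoff p K h h1 h2"
    using cutoff_exists [OF p1] by blast
  then interpret cutoff p K h h1 h2 .
  interpret chart_problem M p K h h1 h2 c "coord c undefined" r0
    by unfold_locales
      (use r0 c open_range vol_density_C1 vol_density_pos flux_coefficient_C1 in simp_all)
  show ?thesis
    using assms(6)
  proof (elim disjE conjE)
    assume "p > p_Fujita CARD('n)" "1 \<le> q" "q < real CARD('n) * (p - 1) / 2"
    from supercritical_nonexistence [OF this] show ?thesis by blast
  next
    assume "p = p_Fujita CARD('n)" "q = 1"
    with critical_nonexistence show ?thesis by blast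
  qed
qed

end
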